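(* Let $\mathcal{C}$ be a Calabi--Yau category of dimension $n$. Then the categories of twisted objects $\mathrm{tw}_l(\mathcal{C})$ and $\mathrm{tw}_r(\mathcal{C})$ are Calabi--Yau categories of dimension $n$.
   Context: $k$ is a field of characteristic zero. $A_\infty$-categories are small, $k$-linear, strictly unital, cohomologically $\mathbb{Z}$-graded, with operations $m_n$ of degree $2-n$; equivalently, after shifting, maps $b_n:\mathrm{Hom}(x_{n-1},x_n)[1]\otimes\cdots\otimes\mathrm{Hom}(x_0,x_1)[1]\to\mathrm{Hom}(x_0,x_n)[1]$ of degree $1$ with $\sum_{a+b+c=n}b_{a+1+c}(\mathrm{id}^{\otimes a}\otimes b_b\otimes\mathrm{id}^{\otimes c})=0$ (Koszul sign rule). A Calabi--Yau category of dimension $n$ is an $A_\infty$-category $\mathcal C$ with, for each pair of objects $A,B$, a nondegenerate pairing $\langle\bullet,\bullet\rangle_{B,A}:\mathrm{Hom}_{\mathcal C}(A,B)\otimes\mathrm{Hom}_{\mathcal C}(B,A)\to k[-n]$ such that $\langle\bullet,\bullet\rangle_{A,B}$ is obtained from $\langle\bullet,\bullet\rangle_{B,A}$ by precomposing with the (Koszul-signed) symmetry isomorphism, and such that, for all $t$ and all objects $A_0,\dots,A_{t-1}$, the functional $W_t=\frac1t\langle b_{t-1}(\bullet,\dots,\bullet),\bullet\rangle$ on $\mathrm{Hom}(A_{t-1},A_0)[1]\otimes\mathrm{Hom}(A_{t-2},A_{t-1})[1]\otimes\cdots\otimes\mathrm{Hom}(A_0,A_1)[1]$ is invariant under cyclic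 permutation of the tensor factors (with Koszul signs). $\mathrm{tw}_r(\mathcal C)$: let $h_{\mathcal C}[\mathbb Z]$ have objects the formal shifts $h_x[m]$, $x\in\mathcal C$, $m\in\mathbb Z$, with $\mathrm{Hom}(h_x[m],h_y[m'])=\mathrm{Hom}_{\mathcal C}(x,y)[m'-m]$ and the induced compositions. Objects of $\mathrm{tw}_r(\mathcal C)$ are pairs $(\tau,A)$ with $\tau=(z_1,\dots,z_p)$, $p\geq1$, a tuple of objects of $h_{\mathcal C}[\mathbb Z]$ and $A$ a strictly upper triangular matrix of degree $1$ morphisms $A_{ij}\in\mathrm{Hom}^1(z_j,z_i)$ with $\sum_{i\geq1}b_i(A,\dots,A)=0$. Morphisms $(\tau,A)\to(\tau',A')$ are matrices $(M_{ij})$ with $M_{ij}\in\mathrm{Hom}(z_j,z'_i)$. For composable $M_1,\dots,M_t$, with $M_i$ going from $(\tau_{i-1},A_{i-1})$ to $(\tau_i,A_i)$, $$b_t(M_t,\dots,M_1)=\sum_{p_0,\dots,p_t\geq0}b_{t+\sum p_i}(A_t^{\otimes p_t},M_t,A_{t-1}^{\otimes p_{t-1}},\dots,M_1,A_0^{\otimes p_0}),$$ where compositions of matrices are formed entrywise as in matrix multiplication (a finite sum). $\mathrm{tw}_l(\mathcal C)$ is defined in the same way, but using $h^{\mathcal C}[\mathbb Z]$ in place of $h_{\mathcal C}[\mathbb Z]$, where $h^{\mathcal C}[\mathbb Z]$ has objects $h^x[m]$ (shifts of the left modules $h^x=\mathrm{Hom}_{\mathcal C}(x,-)$) and morphisms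 $\mathrm{Hom}(h^x[m],h^y[m'])=\mathrm{Hom}_{\mathcal C}(y,x)[m'-m]$ with the compositions of $\mathcal C^{\mathrm{op}}$, and with strictly lower triangular matrices $A$ in place of strictly upper triangular ones. *)

theory Defs
  imports Complex_Main "HOL-Library.Function_Algebras" "HOL-Library.Groups_Big_Fun"
begin

section \<open>Strictly unital A-infinity categories\<close>

text \<open>
  A homogeneous morphism carries its source, target and (unshifted) degree. This is needed because
  \<open>Hom x y d\<close> below is a family of subspaces of one ambient vector space, and an element of
  the ambient space may belong to several of them. The graded vector space of morphisms is the
  (external) direct sum of the \<open>Hom x y d\<close> over all integers \<open>d\<close>; all multilinear data
  are given on homogeneous morphisms.
\<close>

datatype ('o, 'v) arrow = Arrow (src: 'o) (tgt: 'o) (deg: int) (val: 'v)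

text \<open>
  \<open>bop C [f\<^sub>n, \<dots>, f\<^sub>1]\<close> is \<open>b\<^sub>n(f\<^sub>n, \<dots>, f\<^sub>1)\<close>; the arrow applied first is the last in the list.
\<close>

record ('o, 'v, 'k) ainf =
  Obj :: "'o set"
  Hom :: "'o \<Rightarrow> 'o \<Rightarrow> int \<Rightarrow> 'v set"
  scal :: "'k \<Rightarrow> 'v \<Rightarrow> 'v"
  bop :: "('o, 'v) arrow list \<Rightarrow> 'v"

definition signed :: "int \<Rightarrow> 'a::ab_group_add \<Rightarrow> 'a" where
  "signed d v = (if even d then v else - v)"

text \<open>The degree of a morphism as an element of \<open>Hom[1]\<close>.\<close>

definition sdeg :: "('o, 'v) arrow \<Rightarrow> int" where
  "sdeg f = deg f - 1"

definition is_arrow :: "('o, 'v, 'k) ainf \<Rightarrow> ('o, 'v) arrow \<Rightarrow> bool" where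
  "is_arrow C f \<longleftrightarrow> src f \<in> Obj C \<and> tgt f \<in> Obj C \<and> val f \<in> Hom C (src f) (tgt f) (deg f)"

definition composable :: "('o, 'v, 'k) ainf \<Rightarrow> ('o, 'v) arrow list \<Rightarrow> bool" where
  "composable C fs \<longleftrightarrow>
     fs \<noteq> [] \<and> (\<forall>f \<in> set fs. is_arrow C f) \<and> successively (\<lambda>g f. src g = tgt f) fs"

text \<open>
  The value of \<open>b\<^sub>n\<close> as a homogeneous morphism: degree \<open>1\<close> on \<open>Hom[1]\<close> means
  degree \<open>2 - n\<close> on unshifted degrees.
\<close>

definition barrow :: "('o, 'v, 'k) ainf \<Rightarrow> ('o, 'v) arrow list \<Rightarrow> ('o, 'v) arrow" where
  "barrow C fs =
     Arrow (src (last fs)) (tgt (hd fs)) (sum_list (map deg fs) + 2 - int (length fs)) (bop C fs)"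

definition multilinear_ops :: "('o, 'v::ab_group_add, 'k::field) ainf \<Rightarrow> bool" where
  "multilinear_ops C \<longleftrightarrow>
     (\<forall>us x y d v w c vs. composable C (us @ Arrow x y d v # vs) \<longrightarrow> w \<in> Hom C x y d \<longrightarrow>
        bop C (us @ Arrow x y d (scal C c v + w) # vs) =
          scal C c (bop C (us @ Arrow x y d v # vs)) + bop C (us @ Arrow x y d w # vs))"

text \<open>
  The sum ranges over \<open>a + l + c = n\<close> with \<open>l \<ge> 1\<close>; the sign is the Koszul sign for moving
  the inner operation, of degree \<open>1\<close>, past the first \<open>a\<close> factors.
\<close>

definition ainf_relations :: "('o, 'v::ab_group_add, 'k) ainf \<Rightarrow> bool" where
  "ainf_relations C \<longleftrightarrow>
     (\<forall>fs. composable C fs \<longrightarrow>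
        (\<Sum>(a, l) \<in> {(a, l). 1 \<le> l \<and> a + l \<le> length fs}.
           signed (sum_list (map sdeg (take a fs)))
             (bop C (take a fs @ [barrow C (take l (drop a fs))] @ drop (a + l) fs))) = 0)"

text \<open>
  With \<open>m\<^sub>n = s\<inverse> \<circ> b\<^sub>n \<circ> s\<^sup>\<otimes>\<^sup>n\<close>, where \<open>s : Hom \<rightarrow> Hom[1]\<close> has degree \<open>-1\<close>, one has
  \<open>m\<^sub>2(f, g) = (-1)\<^sup>|\<^sup>f\<^sup>| b\<^sub>2(f, g)\<close>. The first two equations thus say
  \<open>m\<^sub>2(e, f) = f\<close> and \<open>m\<^sub>2(f, e) = f\<close>.
\<close>

definition strict_unit :: "('o, 'v::ab_group_add, 'k) ainf \<Rightarrow> 'o \<Rightarrow> 'v \<Rightarrow> bool" where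
  "strict_unit C x e \<longleftrightarrow> e \<in> Hom C x x 0 \<and>
     (\<forall>f. is_arrow C f \<and> tgt f = x \<longrightarrow> bop C [Arrow x x 0 e, f] = val f) \<and>
     (\<forall>f. is_arrow C f \<and> src f = x \<longrightarrow> bop C [f, Arrow x x 0 e] = signed (deg f) (val f)) \<and>
     (\<forall>fs. composable C fs \<and> length fs \<noteq> 2 \<and> Arrow x x 0 e \<in> set fs \<longrightarrow> bop C fs = 0)"

definition ainf_category :: "('o, 'v::ab_group_add, 'k::field) ainf \<Rightarrow> bool" where
  "ainf_category C \<longleftrightarrow>
     vector_space (scal C) \<and>
     (\<forall>x \<in> Obj C. \<forall>y \<in> Obj C. \<forall>d. module.subspace (scal C) (Hom C x y d)) \<and>
     (\<forall>fs. composable C fs \<longrightarrow> is_arrow C (barrow C fs)) \<and>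
     multilinear_ops C \<and>
     ainf_relations C \<and>
     (\<forall>x \<in> Obj C. \<exists>e. strict_unit C x e)"


section \<open>Calabi--Yau categories\<close>

text \<open>
  \<open>P f g\<close> is \<open>\<langle>f, g\<rangle>\<^sub>B\<^sub>,\<^sub>A\<close> for \<open>f : A \<rightarrow> B\<close> and \<open>g : B \<rightarrow> A\<close>.
\<close>

type_synonym ('o, 'v, 'k) pairing = "('o, 'v) arrow \<Rightarrow> ('o, 'v) arrow \<Rightarrow> 'k"

definition opposed :: "('o, 'v, 'k) ainf \<Rightarrow> ('o, 'v) arrow \<Rightarrow> ('o, 'v) arrow \<Rightarrow> bool" where
  "opposed C f g \<longleftrightarrow> is_arrow C f \<and> is_arrow C g \<and> src g = tgt f \<and> tgt g = src f"

definition bilinear_pairing ::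
    "('o, 'v::ab_group_add, 'k::field) ainf \<Rightarrow> ('o, 'v, 'k) pairing \<Rightarrow> bool" where
  "bilinear_pairing C P \<longleftrightarrow>
     (\<forall>x y d v w c g. opposed C (Arrow x y d v) g \<longrightarrow> w \<in> Hom C x y d \<longrightarrow>
        P (Arrow x y d (scal C c v + w)) g = c * P (Arrow x y d v) g + P (Arrow x y d w) g) \<and>
     (\<forall>x y d v w c f. opposed C f (Arrow x y d v) \<longrightarrow> w \<in> Hom C x y d \<longrightarrow>
        P f (Arrow x y d (scal C c v + w)) = c * P f (Arrow x y d v) + P f (Arrow x y d w))"

text \<open>The target \<open>k[-n]\<close> is concentrated in degree \<open>n\<close>.\<close>

definition pairing_degree ::
    "int \<Rightarrow> ('o, 'v, 'k) ainf \<Rightarrow> ('o, 'v, 'k::field) pairing \<Rightarrow> bool" where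
  "pairing_degree n C P \<longleftrightarrow> (\<forall>f g. opposed C f g \<and> deg f + deg g \<noteq> n \<longrightarrow> P f g = 0)"

definition nondegenerate_pairing ::
    "('o, 'v::ab_group_add, 'k) ainf \<Rightarrow> ('o, 'v, 'k::field) pairing \<Rightarrow> bool" where
  "nondegenerate_pairing C P \<longleftrightarrow>
     (\<forall>f. is_arrow C f \<and> (\<forall>g. opposed C f g \<longrightarrow> P f g = 0) \<longrightarrow> val f = 0) \<and>
     (\<forall>g. is_arrow C g \<and> (\<forall>f. opposed C f g \<longrightarrow> P f g = 0) \<longrightarrow> val g = 0)"

definition symmetric_pairing ::
    "('o, 'v, 'k) ainf \<Rightarrow> ('o, 'v, 'k::field) pairing \<Rightarrow> bool" where
  "symmetric_pairing C P \<longleftrightarrow> (\<forall>f g. opposed C f g \<longrightarrow> P f g = signed (deg f * deg g) (P g f))"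

text \<open>
  \<open>W C P [a\<^sub>t\<^sub>-\<^sub>1, \<dots>, a\<^sub>0] = 1/t \<langle>b\<^sub>t\<^sub>-\<^sub>1(a\<^sub>t\<^sub>-\<^sub>1, \<dots>, a\<^sub>1), a\<^sub>0\<rangle>\<close>. As a functional on a tensor product of
  spaces \<open>Hom[1]\<close> it uses the pairing precomposed with the desuspension
  \<open>Hom[1] \<otimes> Hom[1] \<rightarrow> Hom \<otimes> Hom\<close>; moving the second desuspension, of degree \<open>1\<close>, past
  the first factor gives the Koszul sign below. Without it, ordinary graded Frobenius algebras
  would not satisfy cyclic invariance.
\<close>

definition W ::
    "('o, 'v, 'k) ainf \<Rightarrow> ('o, 'v, 'k::field) pairing \<Rightarrow> ('o, 'v) arrow list \<Rightarrow> 'k" where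
  "W C P fs =
     (1 / of_nat (length fs)) *
     signed (sdeg (barrow C (butlast fs))) (P (barrow C (butlast fs)) (last fs))"

definition cyclic_pairing ::
    "('o, 'v, 'k) ainf \<Rightarrow> ('o, 'v, 'k::field) pairing \<Rightarrow> bool" where
  "cyclic_pairing C P \<longleftrightarrow>
     (\<forall>us vs. composable C (us @ vs) \<and> 2 \<le> length (us @ vs) \<and>
        src (last (us @ vs)) = tgt (hd (us @ vs)) \<longrightarrow>
        W C P (us @ vs) =
          signed (sum_list (map sdeg us) * sum_list (map sdeg vs)) (W C P (vs @ us)))"

definition calabi_yau_pairing ::
    "int \<Rightarrow> ('o, 'v::ab_group_add, 'k::field) ainf \<Rightarrow> ('o, 'v, 'k) pairing \<Rightarrow> bool" where
  "calabi_yau_pairing n C P \<longleftrightarrow>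
     bilinear_pairing C P \<and> pairing_degree n C P \<and> nondegenerate_pairing C P \<and>
     symmetric_pairing C P \<and> cyclic_pairing C P"

definition calabi_yau_category ::
    "int \<Rightarrow> ('o, 'v::ab_group_add, 'k::field) ainf \<Rightarrow> bool" where
  "calabi_yau_category n C \<longleftrightarrow> ainf_category C \<and> (\<exists>P. calabi_yau_pairing n C P)"


section \<open>Opposite category and formal shifts\<close>

text \<open>
  The operations of the opposite category are those of \<open>C\<close> precomposed with the Koszul-signed
  reversal of the tensor factors in \<open>Hom[1]\<close>; the extra factor \<open>(-1)\<^sup>n\<^sup>-\<^sup>1\<close> yields
  \<open>m\<^sub>1\<^sup>o\<^sup>p = m\<^sub>1\<close> and \<open>m\<^sub>2\<^sup>o\<^sup>p(f, g) = (-1)\<^sup>|\<^sup>f\<^sup>|\<^sup>|\<^sup>g\<^sup>| m\<^sub>2(g, f)\<close>, as for dg categories.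
\<close>

definition opp_cat :: "('o, 'v::ab_group_add, 'k) ainf \<Rightarrow> ('o, 'v, 'k) ainf" where
  "opp_cat C =
     \<lparr> Obj = Obj C,
       Hom = (\<lambda>x y d. Hom C y x d),
       scal = scal C,
       bop = (\<lambda>fs. signed
          (int (length fs) - 1 + (\<Sum>i<length fs. \<Sum>j<i. sdeg (fs ! i) * sdeg (fs ! j)))
          (bop C (map (\<lambda>f. Arrow (tgt f) (src f) (deg f) (val f)) (rev fs)))) \<rparr>"

text \<open>
  The object \<open>(x, m)\<close> is the formal shift \<open>x[m]\<close>. Writing a morphism \<open>x[m] \<rightarrow> y[m']\<close> as
  \<open>s\<^sup>m\<^sup>' f s\<^sup>-\<^sup>m\<close> with \<open>s\<close> of degree \<open>-1\<close>, the inner shifts in a composition cancel, and moving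
  \<open>b\<^sub>n\<close> past the leftmost factor \<open>s\<^sup>m\<^sup>'\<close> contributes the sign \<open>(-1)\<^sup>m\<^sup>'\<close>, where \<open>m'\<close> is the
  shift of the final target.
\<close>

definition shift_cat :: "('o, 'v::ab_group_add, 'k) ainf \<Rightarrow> ('o \<times> int, 'v, 'k) ainf" where
  "shift_cat C =
     \<lparr> Obj = Obj C \<times> UNIV,
       Hom = (\<lambda>(x, m) (y, m') d. Hom C x y (d + (m' - m))),
       scal = scal C,
       bop = (\<lambda>fs. signed (snd (tgt (hd fs)))
          (bop C (map (\<lambda>f. Arrow (fst (src f)) (fst (tgt f))
             (deg f + (snd (tgt f) - snd (src f))) (val f)) fs))) \<rparr>"


section \<open>Twisted objects\<close>

text \<open>
  Tuples of objects, with matrices of morphisms between them. Row indices of a matrix refer to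
  the target tuple and column indices to the source tuple; entries outside this range are zero.
\<close>

type_synonym 'v matrix = "nat \<Rightarrow> nat \<Rightarrow> 'v"

definition entry :: "('o list, 'v matrix) arrow \<Rightarrow> nat \<Rightarrow> nat \<Rightarrow> ('o, 'v) arrow" where
  "entry F i j = Arrow (src F ! j) (tgt F ! i) (deg F) (val F i j)"

definition index_paths ::
    "('o list, 'v matrix) arrow list \<Rightarrow> nat \<Rightarrow> nat \<Rightarrow> nat list set" where
  "index_paths Fs i j =
     {ks. length ks = length Fs + 1 \<and> hd ks = i \<and> last ks = j \<and>
          (\<forall>r<length Fs. ks ! r < length (tgt (Fs ! r)) \<and> ks ! Suc r < length (src (Fs ! r)))}"

definition mat_cat ::
    "('o, 'v::ab_group_add, 'k) ainf \<Rightarrow> ('o list, 'v matrix, 'k) ainf" where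
  "mat_cat D =
     \<lparr> Obj = {zs. zs \<noteq> [] \<and> set zs \<subseteq> Obj D},
       Hom = (\<lambda>zs zs' d. {M. \<forall>i j.
          if i < length zs' \<and> j < length zs then M i j \<in> Hom D (zs ! j) (zs' ! i) d
          else M i j = 0}),
       scal = (\<lambda>c M i j. scal D c (M i j)),
       bop = (\<lambda>Fs i j. \<Sum>ks \<in> index_paths Fs i j.
          bop D (map (\<lambda>r. entry (Fs ! r) (ks ! r) (ks ! Suc r)) [0..<length Fs])) \<rparr>"

type_synonym ('o, 'v) twobj = "'o list \<times> 'v matrix"

definition tw_arrow :: "('o, 'v) twobj \<Rightarrow> ('o list, 'v matrix) arrow" where
  "tw_arrow T = Arrow (fst T) (fst T) 1 (snd T)"

definition mat_arrow :: "(('o, 'v) twobj, 'v matrix) arrow \<Rightarrow> ('o list, 'v matrix) arrow" where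
  "mat_arrow F = Arrow (fst (src F)) (fst (tgt F)) (deg F) (val F)"

text \<open>
  For \<open>Fs = [M\<^sub>t, \<dots>, M\<^sub>1]\<close> and \<open>ps = [p\<^sub>t, \<dots>, p\<^sub>0]\<close> this is the list
  \<open>A\<^sub>t, \<dots>, A\<^sub>t, M\<^sub>t, A\<^sub>t\<^sub>-\<^sub>1, \<dots>, M\<^sub>1, A\<^sub>0, \<dots>, A\<^sub>0\<close> with \<open>A\<^sub>i\<close> repeated \<open>p\<^sub>i\<close> times.
\<close>

definition tw_insert ::
    "(('o, 'v) twobj, 'v matrix) arrow list \<Rightarrow> nat list \<Rightarrow> ('o list, 'v matrix) arrow list" where
  "tw_insert Fs ps =
     replicate (hd ps) (tw_arrow (tgt (hd Fs))) @
     concat (map2 (\<lambda>F p. mat_arrow F # replicate p (tw_arrow (src F))) Fs (tl ps))"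

text \<open>
  \<open>Sum_any\<close> is the sum of a family with finite support. All families below have finite support,
  because long enough products of strictly triangular matrices vanish. The relation \<open>R\<close> says
  which entries \<open>(i, j)\<close> of the matrix \<open>A\<close> may be nonzero.
\<close>

definition maurer_cartan :: "('o, 'v::ab_group_add, 'k) ainf \<Rightarrow> ('o, 'v) twobj \<Rightarrow> bool" where
  "maurer_cartan D T \<longleftrightarrow>
     Sum_any (\<lambda>i. if 1 \<le> i then bop (mat_cat D) (replicate i (tw_arrow T)) else 0) = 0"

definition tw_cat ::
    "(nat \<Rightarrow> nat \<Rightarrow> bool) \<Rightarrow> ('o, 'v::ab_group_add, 'k) ainf \<Rightarrow>
      (('o, 'v) twobj, 'v matrix, 'k) ainf" where
  "tw_cat R D =
     \<lparr> Obj = {T. is_arrow (mat_cat D) (tw_arrow T) \<and>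
                 (\<forall>i j. snd T i j \<noteq> 0 \<longrightarrow> R i j) \<and> maurer_cartan D T},
       Hom = (\<lambda>T T' d. Hom (mat_cat D) (fst T) (fst T') d),
       scal = scal (mat_cat D),
       bop = (\<lambda>Fs. Sum_any (\<lambda>ps.
          if length ps = length Fs + 1 then bop (mat_cat D) (tw_insert Fs ps) else 0)) \<rparr>"

definition tw_r ::
    "('o, 'v::ab_group_add, 'k) ainf \<Rightarrow> (('o \<times> int, 'v) twobj, 'v matrix, 'k) ainf" where
  "tw_r C = tw_cat (\<lambda>i j. i < j) (shift_cat C)"

definition tw_l ::
    "('o, 'v::ab_group_add, 'k) ainf \<Rightarrow> (('o \<times> int, 'v) twobj, 'v matrix, 'k) ainf" where
  "tw_l C = tw_cat (\<lambda>i j. j < i) (shift_cat (opp_cat C))"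

end

theory Submission
  imports Defs
begin

text \<open>
  A category of twisted objects is reached from \<open>C\<close> in steps: the opposite category (only for
  \<open>tw_l\<close>), formal shifts, matrices over tuples of objects, and finally the deformation of the
  matrix operations by the twisting matrices. Each step carries A-infinity categories to A-infinity
  categories and Calabi--Yau pairings of dimension \<open>n\<close> to Calabi--Yau pairings of dimension \<open>n\<close>.
  Strictly upper and strictly lower triangular matrices are treated at once: all that matters is that
  nonzero entries occur only along a transitive irreflexive relation \<open>R\<close> of indices
  (\<open>calabi_yau_tw_cat\<close>).

  The opposite category and the shifts only change signs (\<open>calabi_yau_opp\<close>,
  \<open>calabi_yau_shift\<close>). For the shifts, the pairing of \<open>f : x[m] \<rightarrow> y[m']\<close> with
  \<open>g : y[m'] \<rightarrow> x[m]\<close> is multiplied by \<open>(-1)\<close> to the power \<open>m + n m'\<close>. That this sign is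
  compatible with cyclic rotation uses that a pairing of degree \<open>n\<close> makes the cyclic functional
  vanish outside total degree \<open>n - 3\<close>.

  On matrices the pairing is the trace, the sum of the pairings of \<open>F i j\<close> with \<open>G j i\<close>. A
  composition of matrices is a sum over paths of indices and the cyclic functional is a sum over
  closed paths (\<open>U_mat\<close>), so the A-infinity relations hold path by path and cyclic invariance is
  the rotation of closed paths. Matrices with a single nonzero entry show that the trace pairing is
  nondegenerate.

  A twisted composition is a sum over words in the morphisms and the twisting matrices. Only finitely
  many words contribute, since a long run of one strictly triangular matrix has no nonzero path of
  indices (\<open>long_run_zero\<close>). Summing the relations of the matrix category over all words gives a
  sum over the ways to cut a word into three pieces, the middle one being composed first. If the
  middle piece contains no morphism, the sum over its length is the Maurer--Cartan equation
  (\<open>maurer_cartan_term\<close>); otherwise the sum over the lengths of all runs is a nested twisted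
  composition (\<open>tw_term\<close>). What remains are the relations of the twisted category
  (\<open>ainf_relations_tw\<close>). Since twisting matrices have degree \<open>0\<close> in \<open>Hom[1]\<close>, they do not
  affect any sign. In the cyclic functional of \<open>t\<close> morphisms there is one run of twisting
  matrices in front of each of them (\<open>U_tw\<close>), a description that is invariant under rotation, so
  cyclic invariance follows from that of matrices.
\<close>


section \<open>Signs\<close>

lemma signed_0 [simp]: "signed d 0 = 0"
  by (simp add: signed_def)

lemma signed_zero [simp]: "signed 0 v = v"
  by (simp add: signed_def)

lemma signed_even [simp]: "even d \<Longrightarrow> signed d v = v"
  by (simp add: signed_def)

lemma signed_signed [simp]: "signed d (signed e v) = signed (d + e) v"
  by (simp add: signed_def)

lemma signed_add: "signed d (v + w) = signed d v + signed d w"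
  by (simp add: signed_def)

lemma signed_sum: "signed d (\<Sum>x\<in>A. f x) = (\<Sum>x\<in>A. signed d (f x))"
  by (simp add: signed_def sum_negf)

lemma signed_cong: "even (d + e) \<Longrightarrow> signed d v = signed e v"
  by (auto simp: signed_def)

lemma signed_eq_0_iff [simp]: "signed d v = 0 \<longleftrightarrow> v = 0"
  by (simp add: signed_def)

lemma mult_signed: "c * signed d (x :: 'k::field) = signed d (c * x)"
  by (simp add: signed_def)

lemma signed_apply: "signed d M i = signed d (M i)"
  by (simp add: signed_def)


section \<open>Sums over consecutive pieces of a list\<close>

text \<open>
  The pieces \<open>(X, Y, Z)\<close> index the terms of an A-infinity relation, with \<open>Y\<close> composed first.
  Unlike positions in a list, they behave well under reversal and under cutting words.
\<close>

definition splits :: "'a list \<Rightarrow> ('a list \<times> 'a list \<times> 'a list) set" where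
  "splits fs = {(X, Y, Z). X @ Y @ Z = fs \<and> Y \<noteq> []}"

lemma append_three_pieces: "take a fs @ take l (drop a fs) @ drop (a + l) fs = fs"
  by (metis append_take_drop_id drop_drop add.commute)

lemma sum_splits:
  "(\<Sum>(a, l) \<in> {(a, l). 1 \<le> l \<and> a + l \<le> length fs}.
      g (take a fs) (take l (drop a fs)) (drop (a + l) fs)) = (\<Sum>(X, Y, Z) \<in> splits fs. g X Y Z)"
  by (rule sum.reindex_bij_witness
      [where i = "\<lambda>(X, Y, Z). (length X, length Y)"
         and j = "\<lambda>(a, l). (take a fs, take l (drop a fs), drop (a + l) fs)"])
    (auto simp: splits_def append_three_pieces min_def Suc_le_eq)

lemma finite_splits [simp]: "finite (splits fs)"
proof (rule finite_subset)
  show "splits fs \<subseteq> (\<lambda>(a, l). (take a fs, take l (drop a fs), drop (a + l) fs)) `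
      ({..length fs} \<times> {..length fs})"
  proof
    fix p assume "p \<in> splits fs"
    then obtain X Y Z where "p = (X, Y, Z)" "X @ Y @ Z = fs" by (auto simp: splits_def)
    then show "p \<in> (\<lambda>(a, l). (take a fs, take l (drop a fs), drop (a + l) fs)) `
      ({..length fs} \<times> {..length fs})"
      by (intro image_eqI[of _ _ "(length X, length Y)"]) auto
  qed
qed auto

lemma sum_splits_cong:
  "(\<And>X Y Z. X @ Y @ Z = fs \<Longrightarrow> Y \<noteq> [] \<Longrightarrow> g X Y Z = h X Y Z) \<Longrightarrow>
    (\<Sum>(X, Y, Z) \<in> splits fs. g X Y Z) = (\<Sum>(X, Y, Z) \<in> splits fs. h X Y Z)"
  by (rule sum.cong) (auto simp: splits_def)

lemma sum_splits_map:
  "(\<Sum>(X, Y, Z) \<in> splits (map f fs). g X Y Z) =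
   (\<Sum>(X, Y, Z) \<in> splits fs. g (map f X) (map f Y) (map f Z))"
  by (simp add: take_map drop_map
      flip: sum_splits[where g = g] sum_splits[where g = "\<lambda>X Y Z. g (map f X) (map f Y) (map f Z)"])


section \<open>Composable lists\<close>

abbreviation tdeg :: "('o, 'v) arrow list \<Rightarrow> int" where
  "tdeg fs \<equiv> sum_list (map sdeg fs)"

lemma composable_append:
  "us \<noteq> [] \<Longrightarrow> vs \<noteq> [] \<Longrightarrow> composable C (us @ vs) \<longleftrightarrow>
     composable C us \<and> composable C vs \<and> src (last us) = tgt (hd vs)"
  by (auto simp: composable_def successively_append_iff)

lemma composable_single [simp]: "composable C [f] \<longleftrightarrow> is_arrow C f"
  by (simp add: composable_def)

lemma composable_Cons:
  "vs \<noteq> [] \<Longrightarrow> composable C (f # vs) \<longleftrightarrow> is_arrow C f \<and> composable C vs \<and> src f = tgt (hd vs)"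
  using composable_append[of "[f]" vs C] by simp

lemma composable_prefix: "composable C (us @ vs) \<Longrightarrow> us \<noteq> [] \<Longrightarrow> composable C us"
  by (auto simp: composable_def successively_append_iff)

lemma composable_suffix: "composable C (us @ vs) \<Longrightarrow> vs \<noteq> [] \<Longrightarrow> composable C vs"
  by (auto simp: composable_def successively_append_iff)

lemma composable_middle: "composable C (us @ vs @ ws) \<Longrightarrow> vs \<noteq> [] \<Longrightarrow> composable C vs"
  using composable_prefix composable_suffix by blast

text \<open>
  Every change of a list below (composing a piece, changing the value of an entry) replaces a piece by
  one morphism with the same ends.
\<close>

lemma composable_replace:
  assumes "composable C (us @ vs @ ws)" "vs \<noteq> []"
    and "is_arrow C f" "src f = src (last vs)" "tgt f = tgt (hd vs)"
  shows "composable C (us @ f # ws)"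
  using assms by (cases "us = []"; cases "ws = []")
    (auto simp: composable_append composable_Cons)

lemma barrow_sel [simp]:
  "src (barrow C fs) = src (last fs)" "tgt (barrow C fs) = tgt (hd fs)"
  "deg (barrow C fs) = sum_list (map deg fs) + 2 - int (length fs)"
  "val (barrow C fs) = bop C fs"
  by (simp_all add: barrow_def)

lemma sum_list_sdeg: "tdeg fs = sum_list (map deg fs) - int (length fs)"
  by (induction fs) (auto simp: sdeg_def)

lemma deg_barrow: "deg (barrow C fs) = tdeg fs + 2"
  by (simp add: sum_list_sdeg)

lemma sdeg_barrow: "sdeg (barrow C fs) = tdeg fs + 1"
  by (simp add: sdeg_def sum_list_sdeg)


section \<open>Calculus in an A-infinity category\<close>

text \<open>
  Operations and pairings are additive only in arguments from one space of morphisms, so expanding a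
  sum needs this relative form.
\<close>

lemma additive_sum_on:
  fixes \<phi> :: "'a::ab_group_add \<Rightarrow> 'b::ab_group_add"
  assumes add: "\<And>v w. v \<in> H \<Longrightarrow> w \<in> H \<Longrightarrow> \<phi> (v + w) = \<phi> v + \<phi> w"
    and H: "0 \<in> H" "\<And>v w. v \<in> H \<Longrightarrow> w \<in> H \<Longrightarrow> v + w \<in> H"
    and f: "\<And>x. x \<in> A \<Longrightarrow> f x \<in> H"
  shows "\<phi> (\<Sum>x\<in>A. f x) = (\<Sum>x\<in>A. \<phi> (f x))"
proof -
  have "\<phi> 0 = 0" using add[of 0 0] H(1) by simp
  moreover have "(\<Sum>x\<in>A. f x) \<in> H \<and> \<phi> (\<Sum>x\<in>A. f x) = (\<Sum>x\<in>A. \<phi> (f x))"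
    if "finite A" using that f
    by (induction A) (auto simp: \<open>\<phi> 0 = 0\<close> H add)
  ultimately show ?thesis by (cases "finite A") auto
qed

locale ainf_cat =
  fixes C :: "('o, 'v::ab_group_add, 'k::field) ainf"
  assumes ainf: "ainf_category C"
begin

sublocale vector_space "scal C"
  using ainf by (simp add: ainf_category_def)

lemma hom_subspace: "x \<in> Obj C \<Longrightarrow> y \<in> Obj C \<Longrightarrow> subspace (Hom C x y d)"
  using ainf by (simp add: ainf_category_def)

lemma is_arrow_barrow: "composable C fs \<Longrightarrow> is_arrow C (barrow C fs)"
  using ainf by (simp add: ainf_category_def)

lemma composable_barrow:
  "composable C (X @ Y @ Z) \<Longrightarrow> Y \<noteq> [] \<Longrightarrow> composable C (X @ barrow C Y # Z)"
  by (rule composable_replace) (auto intro: is_arrow_barrow composable_middle)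

lemma relations: "composable C fs \<Longrightarrow>
  (\<Sum>(X, Y, Z) \<in> splits fs. signed (tdeg X) (bop C (X @ barrow C Y # Z))) = 0"
  using ainf sum_splits[where fs = fs and
      g = "\<lambda>X Y Z. signed (tdeg X) (bop C (X @ barrow C Y # Z))"]
  by (simp add: ainf_category_def ainf_relations_def)

lemma hom_zero: "x \<in> Obj C \<Longrightarrow> y \<in> Obj C \<Longrightarrow> 0 \<in> Hom C x y d"
  using hom_subspace subspace_0 by blast

lemma hom_add: "\<lbrakk>x \<in> Obj C; y \<in> Obj C; v \<in> Hom C x y d; w \<in> Hom C x y d\<rbrakk> \<Longrightarrow> v + w \<in> Hom C x y d"
  using hom_subspace subspace_add by blast

lemma hom_scale: "\<lbrakk>x \<in> Obj C; y \<in> Obj C; v \<in> Hom C x y d\<rbrakk> \<Longrightarrow> scal C c v \<in> Hom C x y d"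
  using hom_subspace subspace_scale by blast

lemma hom_signed:
  "\<lbrakk>x \<in> Obj C; y \<in> Obj C; v \<in> Hom C x y d\<rbrakk> \<Longrightarrow> signed e v \<in> Hom C x y d"
  using hom_subspace subspace_neg by (auto simp: signed_def)

lemma hom_sum:
  "\<lbrakk>x \<in> Obj C; y \<in> Obj C; \<And>a. a \<in> A \<Longrightarrow> f a \<in> Hom C x y d\<rbrakk> \<Longrightarrow> (\<Sum>a\<in>A. f a) \<in> Hom C x y d"
  using hom_subspace subspace_sum by blast

lemma scal_signed: "scal C (signed d c) v = signed d (scal C c v)"
  by (simp add: signed_def)

lemma signed_scal: "scal C c (signed d v) = signed d (scal C c v)"
  by (simp add: signed_def)

lemma is_arrow_signed:
  "is_arrow C f \<Longrightarrow> is_arrow C (Arrow (src f) (tgt f) (deg f) (signed e (val f)))"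
  by (simp add: is_arrow_def hom_signed)

lemma bop_linear:
  "\<lbrakk>composable C (us @ Arrow x y d v # vs); w \<in> Hom C x y d\<rbrakk> \<Longrightarrow>
    bop C (us @ Arrow x y d (scal C c v + w) # vs) =
      scal C c (bop C (us @ Arrow x y d v # vs)) + bop C (us @ Arrow x y d w # vs)"
  using ainf by (simp add: ainf_category_def multilinear_ops_def)

lemma composable_change:
  assumes "composable C (us @ Arrow x y d v # vs)" "w \<in> Hom C x y e"
  shows "composable C (us @ Arrow x y e w # vs)"
proof -
  have "is_arrow C (Arrow x y d v)" using assms by (auto simp: composable_def)
  then show ?thesis
    using assms composable_replace[of C us "[Arrow x y d v]" vs "Arrow x y e w"]
    by (simp add: is_arrow_def)
qed

lemma composable_objs:
  assumes "composable C (us @ Arrow x y d v # vs)"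
  shows "x \<in> Obj C" "y \<in> Obj C"
  using assms by (auto simp: composable_def is_arrow_def)

lemma bop_zero:
  assumes "composable C (us @ Arrow x y d v # vs)"
  shows "bop C (us @ Arrow x y d 0 # vs) = 0"
proof -
  have 0: "0 \<in> Hom C x y d" using composable_objs[OF assms] by (rule hom_zero)
  show ?thesis using bop_linear[OF composable_change[OF assms 0] 0, where c = 1] by simp
qed

lemma bop_zero_val:
  assumes "composable C (us @ f # vs)" "val f = 0"
  shows "bop C (us @ f # vs) = 0"
  using assms bop_zero by (cases f) auto

lemma bop_signed:
  assumes c: "composable C (us @ Arrow x y d v # vs)"
  shows "bop C (us @ Arrow x y d (signed e v) # vs) = signed e (bop C (us @ Arrow x y d v # vs))"
  using bop_linear[OF c hom_zero[OF composable_objs[OF c]], where c = "signed e 1"] bop_zero[OF c]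
  by (simp add: scal_signed)

lemma bop_sum:
  assumes x: "composable C (us @ Arrow x y d u # vs)"
    and f: "\<And>a. a \<in> A \<Longrightarrow> f a \<in> Hom C x y d"
  shows "bop C (us @ Arrow x y d (\<Sum>a\<in>A. f a) # vs) =
    (\<Sum>a\<in>A. bop C (us @ Arrow x y d (f a) # vs))"
proof (rule additive_sum_on[where H = "Hom C x y d"])
  fix v w assume "v \<in> Hom C x y d" "w \<in> Hom C x y d"
  then show "bop C (us @ Arrow x y d (v + w) # vs) =
      bop C (us @ Arrow x y d v # vs) + bop C (us @ Arrow x y d w # vs)"
    using bop_linear[OF composable_change[OF x], where v = v and w = w and c = 1] by simp
qed (use composable_objs[OF x] f hom_zero hom_add in auto)

end

lemma ainf_relationsI:
  assumes "\<And>fs. composable C fs \<Longrightarrow>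
    (\<Sum>(X, Y, Z) \<in> splits fs. signed (tdeg X) (bop C (X @ barrow C Y # Z))) = 0"
  shows "ainf_relations C"
  using assms sum_splits[where
      g = "\<lambda>X Y Z. signed (tdeg X) (bop C (X @ barrow C Y # Z))"]
  by (simp add: ainf_relations_def)


section \<open>The cyclic functional\<close>

text \<open>
  This is \<open>t\<close> times the functional \<open>W\<close> on \<open>t\<close> morphisms. The factor \<open>1/t\<close> has no effect
  on invariance under rotation, but it would obstruct expanding a value on twisted objects as a sum of
  values on longer lists, as those lists have varying lengths.
\<close>

definition U ::
    "('o, 'v, 'k) ainf \<Rightarrow> ('o, 'v, 'k::field) pairing \<Rightarrow> ('o, 'v) arrow list \<Rightarrow> 'k" where
  "U C P fs = signed (sdeg (barrow C (butlast fs))) (P (barrow C (butlast fs)) (last fs))"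

definition cyclic_list :: "('o, 'v, 'k) ainf \<Rightarrow> ('o, 'v) arrow list \<Rightarrow> bool" where
  "cyclic_list C fs \<longleftrightarrow> composable C fs \<and> 2 \<le> length fs \<and> src (last fs) = tgt (hd fs)"

lemma cyclic_pairing_iff_U:
  fixes P :: "('o, 'v, 'k::field_char_0) pairing"
  shows "cyclic_pairing C P \<longleftrightarrow>
    (\<forall>us vs. cyclic_list C (us @ vs) \<longrightarrow>
       U C P (us @ vs) = signed (tdeg us * tdeg vs) (U C P (vs @ us)))"
proof -
  have W: "W C P fs = 1 / of_nat (length fs) * U C P fs" for fs
    by (simp add: W_def U_def)
  have "(W C P (us @ vs) = signed e (W C P (vs @ us))) \<longleftrightarrow> (U C P (us @ vs) = signed e (U C P (vs @ us)))"
    if "2 \<le> length (us @ vs)" for us vs e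
  proof -
    define N :: 'k where "N = of_nat (length us + length vs)"
    have "N \<noteq> 0"
      using that unfolding N_def of_nat_eq_0_iff by auto
    moreover have "W C P (us @ vs) = 1 / N * U C P (us @ vs)" "W C P (vs @ us) = 1 / N * U C P (vs @ us)"
      by (simp_all add: W N_def add.commute)
    ultimately show ?thesis
      using mult_cancel_left[of "1 / N" "U C P (us @ vs)" "signed e (U C P (vs @ us))"]
      by (simp only: mult_signed) simp
  qed
  then show ?thesis by (auto simp: cyclic_pairing_def cyclic_list_def)
qed

lemma opposed_sym: "opposed C f g \<longleftrightarrow> opposed C g f"
  by (auto simp: opposed_def)

lemma cyclic_listE:
  assumes "cyclic_list C fs"
  obtains gs g where "fs = gs @ [g]" "gs \<noteq> []" "composable C gs" "is_arrow C g"
    "src (last gs) = tgt g" "src g = tgt (hd gs)"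
proof (cases fs rule: rev_cases)
  case (snoc gs g)
  then have "gs \<noteq> []" using assms by (auto simp: cyclic_list_def)
  then show ?thesis
    using that[of gs g] assms snoc by (auto simp: cyclic_list_def composable_append)
qed (use assms in \<open>simp add: cyclic_list_def\<close>)

lemma cyclic_list_opposed:
  assumes "ainf_category C" "cyclic_list C fs"
  shows "opposed C (barrow C (butlast fs)) (last fs)"
proof -
  interpret ainf_cat C by standard fact
  have "butlast fs \<noteq> []" using assms(2) by (cases fs rule: rev_cases) (auto simp: cyclic_list_def)
  then obtain gs g where fs: "fs = gs @ [g]" "gs \<noteq> []"
    using assms(2) by (cases fs rule: rev_cases) (auto simp: cyclic_list_def)
  then have "composable C gs" "is_arrow C g" "src (last gs) = tgt g" "src g = tgt (hd gs)"
    using assms(2) composable_append[of gs "[g]" C] by (auto simp: cyclic_list_def)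
  then show ?thesis using fs is_arrow_barrow by (auto simp: opposed_def)
qed

lemma cyclic_list_rotate: "cyclic_list C (us @ vs) \<Longrightarrow> cyclic_list C (vs @ us)"
  by (cases "us = []"; cases "vs = []") (auto simp: cyclic_list_def composable_append)

locale cy_cat = ainf_cat C for C :: "('o, 'v::ab_group_add, 'k::field_char_0) ainf" +
  fixes n :: int and P :: "('o, 'v, 'k) pairing"
  assumes cy: "calabi_yau_pairing n C P"
begin

lemma
  bilinear: "bilinear_pairing C P" and
  pairing_deg: "pairing_degree n C P" and
  nondegenerate: "nondegenerate_pairing C P" and
  symmetric: "symmetric_pairing C P" and
  cyclic: "cyclic_pairing C P"
  using cy by (simp_all add: calabi_yau_pairing_def)

lemma U_cyclic: "cyclic_list C (us @ vs) \<Longrightarrow>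
    U C P (us @ vs) = signed (tdeg us * tdeg vs) (U C P (vs @ us))"
  using cyclic by (auto simp: cyclic_pairing_iff_U)

lemma pairing_change_left:
  assumes "opposed C (Arrow x y d v) g" "w \<in> Hom C x y d"
  shows "opposed C (Arrow x y d w) g"
  using assms by (auto simp: opposed_def is_arrow_def)

lemma pairing_linear_left:
  "\<lbrakk>opposed C (Arrow x y d v) g; w \<in> Hom C x y d\<rbrakk> \<Longrightarrow>
    P (Arrow x y d (scal C c v + w)) g = c * P (Arrow x y d v) g + P (Arrow x y d w) g"
  using bilinear by (simp add: bilinear_pairing_def)

lemma pairing_linear_right:
  "\<lbrakk>opposed C f (Arrow x y d v); w \<in> Hom C x y d\<rbrakk> \<Longrightarrow>
    P f (Arrow x y d (scal C c v + w)) = c * P f (Arrow x y d v) + P f (Arrow x y d w)"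
  using bilinear by (simp add: bilinear_pairing_def)

lemma pairing_sum_left:
  assumes x: "opposed C (Arrow x y d u) g"
    and f: "\<And>a. a \<in> A \<Longrightarrow> f a \<in> Hom C x y d"
  shows "P (Arrow x y d (\<Sum>a\<in>A. f a)) g = (\<Sum>a\<in>A. P (Arrow x y d (f a)) g)"
proof (rule additive_sum_on[where H = "Hom C x y d"])
  fix v w assume "v \<in> Hom C x y d" "w \<in> Hom C x y d"
  then show "P (Arrow x y d (v + w)) g = P (Arrow x y d v) g + P (Arrow x y d w) g"
    using pairing_linear_left[OF pairing_change_left[OF x], where v = v and w = w and c = 1] by simp
qed (use x f hom_zero hom_add in \<open>auto simp: opposed_def is_arrow_def\<close>)

lemma pairing_zero_left:
  assumes "opposed C f g" "val f = 0" shows "P f g = 0"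
  using assms pairing_sum_left[of "src f" "tgt f" "deg f" "val f" g "{}"] by (cases f) auto

lemma pairing_swap: "opposed C f g \<Longrightarrow> P f g = signed (deg f * deg g) (P g f)"
  using symmetric by (simp add: symmetric_pairing_def)

lemma pairing_signed_left:
  assumes "opposed C (Arrow x y d v) g"
  shows "P (Arrow x y d (signed e v)) g = signed e (P (Arrow x y d v) g)"
proof -
  have 0: "0 \<in> Hom C x y d" using assms by (auto simp: opposed_def is_arrow_def hom_zero)
  show ?thesis
    using pairing_linear_left[OF assms 0, where c = "signed e 1"]
      pairing_zero_left[OF pairing_change_left[OF assms 0]]
    by (cases "even e") (simp_all add: signed_def)
qed

lemma pairing_zero_right:
  assumes "opposed C f g" "val g = 0" shows "P f g = 0"
  using pairing_swap[OF assms(1)] pairing_zero_left[of g f] assms opposed_sym[of C f g] by simp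

text \<open>
  The composition of the first \<open>t - 1\<close> morphisms raises the shifted degree by \<open>1\<close>, and the
  pairing vanishes unless the unshifted degrees of its two arguments add up to \<open>n\<close>.
\<close>

lemma U_degree:
  assumes "cyclic_list C fs" "tdeg fs \<noteq> n - 3"
  shows "U C P fs = 0"
proof -
  obtain gs g where fs: "fs = gs @ [g]"
    using assms by (cases fs rule: rev_cases) (auto simp: cyclic_list_def)
  have "deg (barrow C (butlast fs)) + deg (last fs) \<noteq> n"
    using assms(2) sdeg_barrow[of C gs] unfolding fs by (simp add: sdeg_def)
  then show ?thesis
    using pairing_deg cyclic_list_opposed[OF ainf assms(1)] by (auto simp: pairing_degree_def U_def)
qed

end


section \<open>The opposite category\<close>

definition op_arrow :: "('o, 'v) arrow \<Rightarrow> ('o, 'v) arrow" where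
  "op_arrow f = Arrow (tgt f) (src f) (deg f) (val f)"

definition op_list :: "('o, 'v) arrow list \<Rightarrow> ('o, 'v) arrow list" where
  "op_list fs = map op_arrow (rev fs)"

text \<open>
  The Koszul exponent of reversing the tensor factors in \<open>Hom[1]\<close>.
\<close>

definition rev_sign :: "('o, 'v) arrow list \<Rightarrow> int" where
  "rev_sign fs = (\<Sum>i<length fs. \<Sum>j<i. sdeg (fs ! i) * sdeg (fs ! j))"

definition op_sign :: "('o, 'v) arrow list \<Rightarrow> int" where
  "op_sign fs = int (length fs) - 1 + rev_sign fs"

lemma op_arrow_sel [simp]:
  "src (op_arrow f) = tgt f" "tgt (op_arrow f) = src f" "deg (op_arrow f) = deg f"
  "val (op_arrow f) = val f" "sdeg (op_arrow f) = sdeg f"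
  "op_arrow (op_arrow f) = f" "op_arrow (Arrow x y d v) = Arrow y x d v"
  by (simp_all add: op_arrow_def sdeg_def)

lemma op_list_simps [simp]:
  "op_list [] = []" "op_list (us @ vs) = op_list vs @ op_list us"
  "op_list (f # vs) = op_list vs @ [op_arrow f]"
  "op_list (op_list fs) = fs" "op_list fs = [] \<longleftrightarrow> fs = []" "length (op_list fs) = length fs"
  "tdeg (op_list fs) = tdeg fs"
  by (simp_all add: op_list_def rev_map o_def) (simp add: rev_map[symmetric])

lemma op_list_hd [simp]: "fs \<noteq> [] \<Longrightarrow> hd (op_list fs) = op_arrow (last fs)"
  "fs \<noteq> [] \<Longrightarrow> last (op_list fs) = op_arrow (hd fs)"
  by (simp_all add: op_list_def hd_map last_map hd_rev last_rev)

lemma rev_sign_snoc: "rev_sign (fs @ [f]) = rev_sign fs + tdeg fs * sdeg f"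
proof -
  have "rev_sign (fs @ [f]) =
      (\<Sum>i<length fs. \<Sum>j<i. sdeg (fs ! i) * sdeg (fs ! j)) + (\<Sum>j<length fs. sdeg f * sdeg (fs ! j))"
    by (simp add: rev_sign_def nth_append)
  also have "(\<Sum>j<length fs. sdeg f * sdeg (fs ! j)) = tdeg fs * sdeg f"
    by (simp add: sum_list_sum_nth atLeast0LessThan sum_distrib_left sum_distrib_right mult.commute)
  finally show ?thesis by (simp add: rev_sign_def)
qed

lemma rev_sign_Nil [simp]: "rev_sign [] = 0"
  by (simp add: rev_sign_def)

lemma rev_sign_append: "rev_sign (us @ vs) = rev_sign us + rev_sign vs + tdeg us * tdeg vs"
proof (induction vs rule: rev_induct)
  case (snoc f vs)
  have "rev_sign (us @ vs @ [f]) = rev_sign (us @ vs) + tdeg (us @ vs) * sdeg f"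
    using rev_sign_snoc[of "us @ vs" f] by simp
  then show ?case using snoc by (simp add: rev_sign_snoc algebra_simps)
qed simp

lemma rev_sign_Cons: "rev_sign (f # vs) = rev_sign vs + sdeg f * tdeg vs"
  using rev_sign_append[of "[f]" vs] rev_sign_snoc[of "[]" f] by simp

lemma opp_cat_simps:
  "Obj (opp_cat C) = Obj C" "Hom (opp_cat C) x y d = Hom C y x d" "scal (opp_cat C) = scal C"
  "bop (opp_cat C) fs = signed (op_sign fs) (bop C (op_list fs))"
  by (simp_all add: opp_cat_def op_sign_def rev_sign_def op_list_def op_arrow_def[abs_def])

lemma is_arrow_opp: "is_arrow (opp_cat C) f \<longleftrightarrow> is_arrow C (op_arrow f)"
  by (auto simp: is_arrow_def opp_cat_simps)

lemma composable_opp: "composable (opp_cat C) fs \<longleftrightarrow> composable C (op_list fs)"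
  by (auto simp: composable_def is_arrow_opp op_list_def successively_map eq_commute)

lemma opposed_opp: "opposed (opp_cat C) f g \<longleftrightarrow> opposed C (op_arrow f) (op_arrow g)"
  by (auto simp: opposed_def is_arrow_opp)

lemma op_barrow:
  assumes "fs \<noteq> []"
  shows "op_arrow (barrow (opp_cat C) fs) =
    (let b = barrow C (op_list fs) in Arrow (src b) (tgt b) (deg b) (signed (op_sign fs) (val b)))"
proof -
  have "sum_list (map deg (op_list fs)) = sum_list (map deg fs)"
    by (simp add: op_list_def rev_map[symmetric] o_def)
  then show ?thesis using assms by (simp add: barrow_def Let_def opp_cat_simps)
qed

text \<open>
  Reversal exchanges the outer pieces \<open>X\<close> and \<open>Z\<close>. The Koszul signs of the two nested reversals
  differ from that of reversing the whole list by the sign of moving the inner operation past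
  \<open>X\<close> and \<open>Z\<close>, and the sign past \<open>X\<close> is already present. Hence the term of the opposite category
  at \<open>(X, Y, Z)\<close> is, up to one sign for the whole list, the term of \<open>C\<close> at the reversed pieces.
\<close>

lemma (in ainf_cat) bop_opp_barrow:
  assumes c: "composable (opp_cat C) (X @ Y @ Z)" "Y \<noteq> []"
  shows "signed (tdeg X) (bop (opp_cat C) (X @ barrow (opp_cat C) Y # Z)) =
    signed (op_sign (X @ Y @ Z))
      (signed (tdeg Z) (bop C (op_list Z @ barrow C (op_list Y) # op_list X)))"
proof -
  let ?B = "barrow C (op_list Y)" and ?Bo = "barrow (opp_cat C) Y"
  have C: "composable C (op_list Z @ ?B # op_list X)"
    using c by (intro composable_barrow) (auto simp: composable_opp)
  have "bop (opp_cat C) (X @ ?Bo # Z) =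
      signed (op_sign (X @ ?Bo # Z)) (bop C (op_list Z @ op_arrow ?Bo # op_list X))"
    by (simp add: opp_cat_simps)
  also have "bop C (op_list Z @ op_arrow ?Bo # op_list X) =
      signed (op_sign Y) (bop C (op_list Z @ ?B # op_list X))"
    using bop_signed[of "op_list Z" "src ?B" "tgt ?B" "deg ?B" "val ?B" "op_list X"] C c(2)
    by (simp add: op_barrow Let_def del: barrow_sel)
  finally show ?thesis
    by (auto intro!: signed_cong simp: op_sign_def rev_sign_append rev_sign_Cons sdeg_barrow algebra_simps)
qed

lemma ainf_category_opp:
  assumes "ainf_category C"
  shows "ainf_category (opp_cat C)"
proof -
  interpret ainf_cat C by standard fact
  have "multilinear_ops (opp_cat C)"
    unfolding multilinear_ops_def
  proof (intro allI impI)
    fix us x y d v w c vs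
    assume a: "composable (opp_cat C) (us @ Arrow x y d v # vs)" "w \<in> Hom (opp_cat C) x y d"
    define e where "e = op_sign (us @ Arrow x y d v # vs)"
    have "op_sign (us @ Arrow x y d u # vs) = e" for u
      by (simp add: e_def op_sign_def rev_sign_append rev_sign_Cons sdeg_def)
    then show "bop (opp_cat C) (us @ Arrow x y d (scal (opp_cat C) c v + w) # vs) =
        scal (opp_cat C) c (bop (opp_cat C) (us @ Arrow x y d v # vs)) +
        bop (opp_cat C) (us @ Arrow x y d w # vs)"
      using a bop_linear[of "op_list vs" y x d v "op_list us" w c]
      by (simp add: opp_cat_simps composable_opp signed_add signed_scal)
  qed
  moreover have "ainf_relations (opp_cat C)"
  proof (rule ainf_relationsI)
    fix fs assume c: "composable (opp_cat C) fs"
    let ?g = "\<lambda>X Y Z. signed (tdeg X) (bop C (X @ barrow C Y # Z))"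
    have "(\<Sum>(X, Y, Z) \<in> splits fs. signed (tdeg X) (bop (opp_cat C) (X @ barrow (opp_cat C) Y # Z))) =
        (\<Sum>(X, Y, Z) \<in> splits fs. signed (op_sign fs) (?g (op_list Z) (op_list Y) (op_list X)))"
      by (rule sum_splits_cong) (use bop_opp_barrow c in auto)
    also have "\<dots> = signed (op_sign fs) (\<Sum>(X, Y, Z) \<in> splits (op_list fs). ?g X Y Z)"
      unfolding signed_sum
      by (rule sum.reindex_bij_witness
          [where i = "\<lambda>(X, Y, Z). (op_list Z, op_list Y, op_list X)"
             and j = "\<lambda>(X, Y, Z). (op_list Z, op_list Y, op_list X)"])
        (auto simp: splits_def dest: arg_cong[of _ _ op_list])
    also have "(\<Sum>(X, Y, Z) \<in> splits (op_list fs). ?g X Y Z) = 0"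
      using relations c by (simp add: composable_opp)
    finally show "(\<Sum>(X, Y, Z) \<in> splits fs.
        signed (tdeg X) (bop (opp_cat C) (X @ barrow (opp_cat C) Y # Z))) = 0" by simp
  qed
  moreover have "is_arrow (opp_cat C) (barrow (opp_cat C) fs)" if "composable (opp_cat C) fs" for fs
  proof -
    have "fs \<noteq> []" using that by (simp add: composable_def)
    then show ?thesis
      using that is_arrow_signed[OF is_arrow_barrow[of "op_list fs"]]
      unfolding is_arrow_opp by (simp add: composable_opp op_barrow Let_def del: barrow_sel)
  qed
  moreover have "strict_unit (opp_cat C) x e" if "strict_unit C x e" for x e
  proof -
    have u: "Arrow x x 0 e \<in> set (op_list fs) \<longleftrightarrow> Arrow x x 0 e \<in> set fs" for fs
    proof -
      have "set (op_list gs) = op_arrow ` set gs" for gs :: "('o, 'v) arrow list" by (simp add: op_list_def)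
      then show ?thesis
        by (metis (no_types, lifting) image_iff op_arrow_sel(6,7))
    qed
    have "op_sign [Arrow x x 0 e, f] = 2 - deg f" "op_sign [f, Arrow x x 0 e] = 2 - deg f" for f
      by (simp_all add: op_sign_def rev_sign_Cons sdeg_def)
    then show ?thesis
      using that unfolding strict_unit_def
      by (auto simp: opp_cat_simps is_arrow_opp composable_opp u signed_def)
  qed
  ultimately show ?thesis
    using ainf unfolding ainf_category_def
    by (simp add: opp_cat_simps) metis
qed

text \<open>
  Reversal puts the last morphism \<open>g\<close> first; one rotation in \<open>C\<close> brings it back to the end and
  completes the sign of reversing all of \<open>fs\<close>.
\<close>

lemma (in cy_cat) U_opp:
  assumes "cyclic_list (opp_cat C) fs"
  shows "U (opp_cat C) (\<lambda>f g. P (op_arrow f) (op_arrow g)) fs =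
    signed (int (length fs) + rev_sign fs) (U C P (op_list fs))"
proof -
  let ?P = "\<lambda>f g. P (op_arrow f) (op_arrow g)"
  obtain gs g where fs: "fs = gs @ [g]" "gs \<noteq> []"
    using assms by (rule cyclic_listE)
  have cyc: "cyclic_list C (op_list fs)"
    using assms fs(2) by (auto simp: cyclic_list_def composable_opp fs(1))
  have cyc': "cyclic_list C (op_list gs @ [op_arrow g])"
    using cyclic_list_rotate[of C "[op_arrow g]" "op_list gs"] cyc fs by simp
  let ?B = "barrow C (op_list gs)"
  have opp: "opposed C ?B (op_arrow g)" using cyclic_list_opposed[OF ainf cyc'] by simp
  have "U (opp_cat C) ?P fs = signed (tdeg gs + 1) (P (op_arrow (barrow (opp_cat C) gs)) (op_arrow g))"
    by (simp add: U_def fs sdeg_barrow)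
  also have "P (op_arrow (barrow (opp_cat C) gs)) (op_arrow g) = signed (op_sign gs) (P ?B (op_arrow g))"
    using pairing_signed_left[of "src ?B" "tgt ?B" "deg ?B" "val ?B" "op_arrow g"] opp fs(2)
    by (simp add: op_barrow Let_def del: barrow_sel)
  also have "signed (tdeg gs + 1) (signed (op_sign gs) (P ?B (op_arrow g))) =
      signed (op_sign gs) (U C P (op_list gs @ [op_arrow g]))"
    by (simp add: U_def sdeg_barrow add.commute)
  also have "U C P (op_list gs @ [op_arrow g]) = signed (tdeg gs * sdeg g) (U C P (op_list fs))"
    using U_cyclic[OF cyc'] fs by simp
  finally show ?thesis
    by (auto intro!: signed_cong simp: fs op_sign_def rev_sign_snoc)
qed

theorem calabi_yau_opp:
  fixes C :: "('o, 'v::ab_group_add, 'k::field_char_0) ainf"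
  assumes "calabi_yau_category n C"
  shows "calabi_yau_category n (opp_cat C)"
proof -
  from assms obtain P where "ainf_category C" "calabi_yau_pairing n C P"
    by (auto simp: calabi_yau_category_def)
  then interpret cy_cat C n P by unfold_locales
  let ?P = "\<lambda>f g. P (op_arrow f) (op_arrow g)"
  have "bilinear_pairing (opp_cat C) ?P"
    using pairing_linear_left pairing_linear_right
    by (simp add: bilinear_pairing_def opposed_opp opp_cat_simps)
  moreover have "pairing_degree n (opp_cat C) ?P"
    using pairing_deg by (simp add: pairing_degree_def opposed_opp)
  moreover have "nondegenerate_pairing (opp_cat C) ?P"
  proof -
    have left: "P (op_arrow f) g = 0"
      if "\<forall>g. opposed C (op_arrow f) (op_arrow g) \<longrightarrow> P (op_arrow f) (op_arrow g) = 0"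
        "opposed C (op_arrow f) g" for f g
      using that op_arrow_sel(6)[of g] by metis
    have right: "P f (op_arrow g) = 0"
      if "\<forall>f. opposed C (op_arrow f) (op_arrow g) \<longrightarrow> P (op_arrow f) (op_arrow g) = 0"
        "opposed C f (op_arrow g)" for f g
      using that op_arrow_sel(6)[of f] by metis
    show ?thesis
      using nondegenerate left right
      unfolding nondegenerate_pairing_def opposed_opp is_arrow_opp by (metis op_arrow_sel(4))
  qed
  moreover have "symmetric_pairing (opp_cat C) ?P"
    using symmetric by (simp add: symmetric_pairing_def opposed_opp)
  moreover have "cyclic_pairing (opp_cat C) ?P"
    unfolding cyclic_pairing_iff_U
  proof (intro allI impI)
    fix us vs assume c: "cyclic_list (opp_cat C) (us @ vs)"
    then have c': "cyclic_list C (op_list vs @ op_list us)"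
      by (cases "us @ vs = []") (auto simp: cyclic_list_def composable_opp simp flip: op_list_simps(2))
    show "U (opp_cat C) ?P (us @ vs) = signed (tdeg us * tdeg vs) (U (opp_cat C) ?P (vs @ us))"
      unfolding U_opp[OF c] U_opp[OF cyclic_list_rotate[OF c]]
      using U_cyclic[OF c']
      by (auto intro!: signed_cong simp: rev_sign_append mult.commute)
  qed
  ultimately show ?thesis
    using ainf_category_opp[OF ainf]
    by (auto simp: calabi_yau_category_def calabi_yau_pairing_def)
qed


section \<open>Formal shifts\<close>

definition unshift :: "('o \<times> int, 'v) arrow \<Rightarrow> ('o, 'v) arrow" where
  "unshift f =
    Arrow (fst (src f)) (fst (tgt f)) (deg f + (snd (tgt f) - snd (src f))) (val f)"

lemma unshift_sel [simp]:
  "src (unshift f) = fst (src f)" "tgt (unshift f) = fst (tgt f)"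
  "deg (unshift f) = deg f + (snd (tgt f) - snd (src f))" "val (unshift f) = val f"
  "sdeg (unshift f) = sdeg f + (snd (tgt f) - snd (src f))"
  by (simp_all add: unshift_def sdeg_def)

lemma unshift_Arrow [simp]:
  "unshift (Arrow x y d v) = Arrow (fst x) (fst y) (d + (snd y - snd x)) v"
  by (simp add: unshift_def)

lemma shift_cat_simps:
  "Obj (shift_cat C) = Obj C \<times> UNIV"
  "Hom (shift_cat C) x y d = Hom C (fst x) (fst y) (d + (snd y - snd x))"
  "scal (shift_cat C) = scal C"
  "bop (shift_cat C) fs = signed (snd (tgt (hd fs))) (bop C (map unshift fs))"
  by (simp_all add: shift_cat_def unshift_def[abs_def] case_prod_beta)

lemma is_arrow_shift: "is_arrow (shift_cat C) f \<longleftrightarrow> is_arrow C (unshift f)"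
  by (cases "src f"; cases "tgt f") (auto simp: is_arrow_def shift_cat_simps)

lemma composable_shift:
  assumes "composable (shift_cat C) fs"
  shows "composable C (map unshift fs)"
proof -
  have "successively (\<lambda>g f. fst (src g) = fst (tgt f)) fs"
    by (rule successively_mono[where P = "\<lambda>g f. src g = tgt f"])
      (use assms in \<open>auto simp: composable_def\<close>)
  then show ?thesis using assms
    by (auto simp: composable_def is_arrow_shift successively_map)
qed

lemma opposed_shift: "opposed (shift_cat C) f g \<Longrightarrow> opposed C (unshift f) (unshift g)"
  by (auto simp: opposed_def is_arrow_shift)

text \<open>The shifts of the intermediate objects cancel.\<close>

lemma tdeg_unshift:
  "composable (shift_cat C) fs \<Longrightarrow>
    tdeg (map unshift fs) = tdeg fs + (snd (tgt (hd fs)) - snd (src (last fs)))"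
proof (induction fs)
  case (Cons f fs)
  then show ?case by (cases "fs = []") (auto simp: composable_Cons)
qed (simp add: composable_def)

lemma unshift_barrow:
  assumes "composable (shift_cat C) fs"
  shows "unshift (barrow (shift_cat C) fs) =
    (let b = barrow C (map unshift fs)
     in Arrow (src b) (tgt b) (deg b) (signed (snd (tgt (hd fs))) (val b)))"
proof -
  have "fs \<noteq> []" using assms by (simp add: composable_def)
  moreover have "sum_list (map deg (map unshift fs)) =
      sum_list (map deg fs) + (snd (tgt (hd fs)) - snd (src (last fs)))"
    using tdeg_unshift[OF assms] by (simp add: sum_list_sdeg del: map_map)
  ultimately show ?thesis
    by (simp add: barrow_def Let_def shift_cat_simps unshift_def hd_map last_map)
qed

text \<open>
  Let \<open>a\<close>, \<open>b\<close> be the shifts of the target of the whole list and of \<open>Y\<close>. The operations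
  contribute the exponent \<open>a + b\<close>, which is also the change of the degree of \<open>X\<close>: the two cancel.
\<close>

lemma (in ainf_cat) bop_shift_barrow:
  assumes c: "composable (shift_cat C) (X @ Y @ Z)" "Y \<noteq> []"
  shows "signed (tdeg X) (bop (shift_cat C) (X @ barrow (shift_cat C) Y # Z)) =
    signed (tdeg (map unshift X))
      (bop C (map unshift X @ barrow C (map unshift Y) # map unshift Z))"
proof -
  let ?B = "barrow C (map unshift Y)" and ?Bs = "barrow (shift_cat C) Y"
  have Y: "composable (shift_cat C) Y" using c composable_middle by blast
  have C: "composable C (map unshift X @ ?B # map unshift Z)"
    using c composable_shift[OF c(1)] by (intro composable_barrow) auto
  have "bop (shift_cat C) (X @ ?Bs # Z) = signed (snd (tgt (hd (X @ ?Bs # Z))))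
      (bop C (map unshift X @ unshift ?Bs # map unshift Z))"
    by (simp add: shift_cat_simps)
  also have "bop C (map unshift X @ unshift ?Bs # map unshift Z) =
      signed (snd (tgt (hd Y))) (bop C (map unshift X @ ?B # map unshift Z))"
    using bop_signed[of "map unshift X" "src ?B" "tgt ?B" "deg ?B" "val ?B" "map unshift Z"] C
    by (simp add: unshift_barrow[OF Y] Let_def del: barrow_sel)
  finally have eq: "bop (shift_cat C) (X @ ?Bs # Z) =
    signed (snd (tgt (hd (X @ ?Bs # Z))) + snd (tgt (hd Y)))
      (bop C (map unshift X @ ?B # map unshift Z))" by simp
  show ?thesis
  proof (cases "X = []")
    case True
    then show ?thesis using eq by (auto intro!: signed_cong)
  next
    case False
    then have X: "composable (shift_cat C) X" "src (last X) = tgt (hd Y)"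
      using c by (auto simp: composable_append)
    show ?thesis
      unfolding eq tdeg_unshift[OF X(1)] using False X(2)
      by (auto intro!: signed_cong)
  qed
qed

lemma ainf_category_shift:
  assumes "ainf_category C"
  shows "ainf_category (shift_cat C)"
proof -
  interpret ainf_cat C by standard fact
  have "multilinear_ops (shift_cat C)"
    unfolding multilinear_ops_def
  proof (intro allI impI)
    fix us x y d v w c vs
    assume a: "composable (shift_cat C) (us @ Arrow x y d v # vs)" "w \<in> Hom (shift_cat C) x y d"
    define h where "h = tgt (hd (us @ Arrow x y d v # vs))"
    have "tgt (hd (us @ Arrow x y d u # vs)) = h" for u
      by (cases us) (auto simp: h_def)
    then show "bop (shift_cat C) (us @ Arrow x y d (scal (shift_cat C) c v + w) # vs) =
        scal (shift_cat C) c (bop (shift_cat C) (us @ Arrow x y d v # vs)) +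
        bop (shift_cat C) (us @ Arrow x y d w # vs)"
      using a bop_linear[of "map unshift us" "fst x" "fst y" "d + (snd y - snd x)" v
          "map unshift vs" w c] composable_shift[OF a(1)]
      by (simp add: shift_cat_simps signed_add signed_scal)
  qed
  moreover have "ainf_relations (shift_cat C)"
  proof (rule ainf_relationsI)
    fix fs assume c: "composable (shift_cat C) fs"
    have "(\<Sum>(X, Y, Z) \<in> splits fs. signed (tdeg X) (bop (shift_cat C) (X @ barrow (shift_cat C) Y # Z))) =
        (\<Sum>(X, Y, Z) \<in> splits (map unshift fs). signed (tdeg X) (bop C (X @ barrow C Y # Z)))"
      unfolding sum_splits_map by (rule sum_splits_cong) (use bop_shift_barrow c in auto)
    then show "(\<Sum>(X, Y, Z) \<in> splits fs.
        signed (tdeg X) (bop (shift_cat C) (X @ barrow (shift_cat C) Y # Z))) = 0"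
      using relations[OF composable_shift[OF c]] by simp
  qed
  moreover have "is_arrow (shift_cat C) (barrow (shift_cat C) fs)"
    if "composable (shift_cat C) fs" for fs
    using is_arrow_signed[OF is_arrow_barrow[OF composable_shift[OF that]]]
    by (simp add: is_arrow_shift unshift_barrow[OF that] Let_def del: barrow_sel)
  \<comment> \<open>A composition ending in \<open>(x, m)\<close> carries the sign of \<open>m\<close>, which the sign of the unit cancels.\<close>
  moreover have "strict_unit (shift_cat C) (x, m) (signed m e)"
    if u: "strict_unit C x e" and x: "x \<in> Obj C" for x m e
  proof -
    let ?E = "Arrow (x, m) (x, m) 0 (signed m e)" and ?e = "Arrow x x 0 e"
    have E: "unshift ?E = Arrow x x 0 (signed m e)" by (simp add: unshift_def)
    have e: "is_arrow C ?e" using u x by (auto simp: strict_unit_def is_arrow_def)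
    have sgn: "bop C (us @ unshift ?E # vs) = signed m (bop C (us @ ?e # vs))"
      and comp: "composable C (us @ ?e # vs)" if "composable C (us @ unshift ?E # vs)" for us vs
    proof -
      show "composable C (us @ ?e # vs)"
        using that e composable_change by (fastforce simp: E is_arrow_def)
      then show "bop C (us @ unshift ?E # vs) = signed m (bop C (us @ ?e # vs))"
        unfolding E by (rule bop_signed)
    qed
    have E_arrow: "is_arrow C (unshift ?E)"
      using e by (auto simp: E is_arrow_def hom_signed)
    show ?thesis
      unfolding strict_unit_def
    proof (intro conjI allI impI)
      show "signed m e \<in> Hom (shift_cat C) (x, m) (x, m) 0"
        using E_arrow by (simp add: shift_cat_simps is_arrow_def E)
    next
      fix f assume f: "is_arrow (shift_cat C) f \<and> tgt f = (x, m)"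
      then have "composable C ([] @ unshift ?E # [unshift f])"
        using E_arrow by (simp add: composable_Cons E is_arrow_shift)
      from sgn[OF this] show "bop (shift_cat C) [?E, f] = val f"
        using u f by (simp add: shift_cat_simps strict_unit_def is_arrow_shift)
    next
      fix f assume f: "is_arrow (shift_cat C) f \<and> src f = (x, m)"
      then have "composable C ([unshift f] @ unshift ?E # [])"
        using E_arrow by (simp add: composable_Cons E is_arrow_shift)
      from sgn[OF this] show "bop (shift_cat C) [f, ?E] = signed (deg f) (val f)"
        using u f
        by (simp add: shift_cat_simps strict_unit_def is_arrow_shift) (auto intro!: signed_cong)
    next
      fix fs assume fs: "composable (shift_cat C) fs \<and> length fs \<noteq> 2 \<and> ?E \<in> set fs"
      then obtain us vs where "fs = us @ ?E # vs" by (auto dest: split_list)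
      then have c: "composable C (map unshift us @ unshift ?E # map unshift vs)"
        and eq: "map unshift fs = map unshift us @ unshift ?E # map unshift vs"
        and "length (map unshift us @ ?e # map unshift vs) \<noteq> 2"
        using fs composable_shift[of C fs] by auto
      then have "bop C (map unshift us @ ?e # map unshift vs) = 0"
        using u comp[OF c] by (auto simp: strict_unit_def)
      then show "bop (shift_cat C) fs = 0"
        unfolding shift_cat_simps eq sgn[OF c] by simp
    qed
  qed
  ultimately show ?thesis
    using ainf unfolding ainf_category_def
    by (simp add: shift_cat_simps) blast
qed

text \<open>
  The factor \<open>snd (src f)\<close> compensates the signs which the composition and its shifted degree
  contribute to the cyclic functional; the factor \<open>n * snd (tgt f)\<close> accounts for rotation and makes
  the pairing symmetric.
\<close>

definition shift_pairing ::
    "int \<Rightarrow> ('o, 'v, 'k::field) pairing \<Rightarrow> ('o \<times> int, 'v, 'k) pairing" where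
  "shift_pairing n P f g = signed (snd (src f) + n * snd (tgt f)) (P (unshift f) (unshift g))"

lemma cyclic_list_shift: "cyclic_list (shift_cat C) fs \<Longrightarrow> cyclic_list C (map unshift fs)"
  by (cases "fs = []") (auto simp: cyclic_list_def composable_shift hd_map last_map)

lemma (in cy_cat) U_shift:
  assumes "cyclic_list (shift_cat C) fs"
  shows "U (shift_cat C) (shift_pairing n P) fs =
    signed (n * snd (tgt (hd fs))) (U C P (map unshift fs))"
proof -
  obtain gs g where fs: "fs = gs @ [g]" "gs \<noteq> []" "composable (shift_cat C) gs"
    "src (last gs) = tgt g"
    using assms by (rule cyclic_listE)
  let ?B = "barrow C (map unshift gs)"
  have opp: "opposed C ?B (unshift g)"
    using cyclic_list_opposed[OF ainf cyclic_list_shift[OF assms]] fs by simp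
  have "U (shift_cat C) (shift_pairing n P) fs =
      signed (tdeg gs + 1 + snd (src (last gs)) + n * snd (tgt (hd gs)))
        (P (unshift (barrow (shift_cat C) gs)) (unshift g))"
    by (simp add: U_def fs sdeg_barrow shift_pairing_def add.assoc)
  also have "P (unshift (barrow (shift_cat C) gs)) (unshift g) =
      signed (snd (tgt (hd gs))) (P ?B (unshift g))"
    using pairing_signed_left[of "src ?B" "tgt ?B" "deg ?B" "val ?B" "unshift g"] opp
    by (simp add: unshift_barrow[OF fs(3)] Let_def del: barrow_sel)
  also have "P ?B (unshift g) = signed (tdeg (map unshift gs) + 1) (U C P (map unshift fs))"
    by (simp add: U_def fs sdeg_barrow del: map_map)
  finally show ?thesis
    unfolding tdeg_unshift[OF fs(3)] using fs(2)
    by (auto intro!: signed_cong simp: fs(1))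
qed

theorem calabi_yau_shift:
  fixes C :: "('o, 'v::ab_group_add, 'k::field_char_0) ainf"
  assumes "calabi_yau_category n C"
  shows "calabi_yau_category n (shift_cat C)"
proof -
  from assms obtain P where "ainf_category C" "calabi_yau_pairing n C P"
    by (auto simp: calabi_yau_category_def)
  then interpret cy_cat C n P by unfold_locales
  let ?P = "shift_pairing n P"
  have deg: "deg (unshift f) + deg (unshift g) = deg f + deg g"
    if "opposed (shift_cat C) f g" for f g
    using that by (auto simp: opposed_def)
  have "bilinear_pairing (shift_cat C) ?P"
    unfolding bilinear_pairing_def shift_pairing_def shift_cat_simps unshift_Arrow
    by (intro conjI allI impI)
      (auto dest!: opposed_shift simp: pairing_linear_left pairing_linear_right signed_add mult_signed)
  moreover have degP: "pairing_degree n (shift_cat C) ?P"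
    using pairing_deg opposed_shift deg by (fastforce simp: pairing_degree_def shift_pairing_def)
  moreover have "nondegenerate_pairing (shift_cat C) ?P"
  proof -
    have lift: "\<exists>g. unshift g = h \<and> src g = a \<and> tgt g = b"
      if "src h = fst a" "tgt h = fst b" for a b and h :: "('o, 'v) arrow"
      using that
      by (intro exI[of _ "Arrow a b (deg h - (snd b - snd a)) (val h)"]) (cases h, simp)
    show ?thesis
      unfolding nondegenerate_pairing_def
    proof (intro conjI allI impI)
      fix f assume f: "is_arrow (shift_cat C) f \<and> (\<forall>g. opposed (shift_cat C) f g \<longrightarrow> ?P f g = 0)"
      have "P (unshift f) h = 0" if h: "opposed C (unshift f) h" for h
      proof -
        obtain g where "unshift g = h" "src g = tgt f" "tgt g = src f"
          using lift[of h "tgt f" "src f"] h by (auto simp: opposed_def)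
        then show ?thesis using f h by (auto simp: opposed_def is_arrow_shift shift_pairing_def)
      qed
      then show "val f = 0"
        using nondegenerate f by (auto simp: nondegenerate_pairing_def is_arrow_shift)
    next
      fix g assume g: "is_arrow (shift_cat C) g \<and> (\<forall>f. opposed (shift_cat C) f g \<longrightarrow> ?P f g = 0)"
      have "P h (unshift g) = 0" if h: "opposed C h (unshift g)" for h
      proof -
        obtain f where "unshift f = h" "src f = tgt g" "tgt f = src g"
          using lift[of h "tgt g" "src g"] h by (auto simp: opposed_def)
        then show ?thesis using g h by (auto simp: opposed_def is_arrow_shift shift_pairing_def)
      qed
      then show "val g = 0"
        using nondegenerate g by (auto simp: nondegenerate_pairing_def is_arrow_shift)
    qed
  qed
  moreover have "symmetric_pairing (shift_cat C) ?P"
    unfolding symmetric_pairing_def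
  proof (intro allI impI)
    fix f g assume o: "opposed (shift_cat C) f g"
    show "?P f g = signed (deg f * deg g) (?P g f)"
    proof (cases "deg f + deg g = n")
      case True
      then have n: "n = deg f + deg g" by simp
      have ends: "src g = tgt f" "tgt g = src f" using o by (auto simp: opposed_def)
      show ?thesis
        unfolding shift_pairing_def pairing_swap[OF opposed_shift[OF o]]
        by (auto intro!: signed_cong simp: ends n algebra_simps)
    next
      case False
      then have "?P f g = 0" "?P g f = 0"
        using degP o opposed_sym[of "shift_cat C" f g] by (auto simp: pairing_degree_def add.commute)
      then show ?thesis by simp
    qed
  qed
  moreover have "cyclic_pairing (shift_cat C) ?P"
    unfolding cyclic_pairing_iff_U
  proof (intro allI impI)
    fix us vs assume c: "cyclic_list (shift_cat C) (us @ vs)"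
    show "U (shift_cat C) ?P (us @ vs) = signed (tdeg us * tdeg vs) (U (shift_cat C) ?P (vs @ us))"
    proof (cases "us = [] \<or> vs = []")
      case False
      have c': "cyclic_list C (map unshift us @ map unshift vs)"
        using cyclic_list_shift[OF c] by simp
      have uv: "composable (shift_cat C) us" "composable (shift_cat C) vs"
        "src (last us) = tgt (hd vs)" "src (last vs) = tgt (hd us)"
        using c False by (auto simp: cyclic_list_def composable_append)
      \<comment> \<open>Rotation changes the target by \<open>\<delta>\<close>; the excess sign \<open>\<delta> (u + v + 1)\<close> is \<open>n \<delta>\<close> modulo 2.\<close>
      define u v \<delta> where "u = tdeg us" and "v = tdeg vs"
        and "\<delta> = snd (tgt (hd us)) - snd (tgt (hd vs))"
      have tu: "tdeg (map unshift us) = u + \<delta>" and tv: "tdeg (map unshift vs) = v - \<delta>"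
        unfolding tdeg_unshift[OF uv(1)] tdeg_unshift[OF uv(2)] by (simp_all add: u_def v_def \<delta>_def uv)
      have eq: "U (shift_cat C) ?P (us @ vs) = signed (n * snd (tgt (hd us)) + (u + \<delta>) * (v - \<delta>))
          (U C P (map unshift vs @ map unshift us))"
        using U_shift[OF c] U_cyclic[OF c'] False by (simp add: tu tv del: map_map)
      have eq': "U (shift_cat C) ?P (vs @ us) = signed (n * snd (tgt (hd vs)))
          (U C P (map unshift vs @ map unshift us))"
        using U_shift[OF cyclic_list_rotate[OF c]] False by simp
      show ?thesis
      proof (cases "u + v = n - 3")
        case True
        then have n: "n = u + v + 3" by simp
        have h: "snd (tgt (hd us)) = \<delta> + snd (tgt (hd vs))" by (simp add: \<delta>_def)
        show ?thesis
          unfolding eq eq' u_def[symmetric] v_def[symmetric]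
          by (simp, rule signed_cong) (auto simp: h n algebra_simps)
      next
        case False
        then have "U C P (map unshift vs @ map unshift us) = 0"
          using U_degree[OF cyclic_list_rotate[OF c']] tu tv by (simp del: map_map)
        then show ?thesis unfolding eq eq' by simp
      qed
    qed auto
  qed
  ultimately show ?thesis
    using ainf_category_shift[OF ainf]
    by (auto simp: calabi_yau_category_def calabi_yau_pairing_def)
qed


section \<open>Index paths\<close>

lemma sum_fun_apply: "(\<Sum>x\<in>A. f x) i = (\<Sum>x\<in>A. f x i)"
  for f :: "'a \<Rightarrow> 'b \<Rightarrow> 'c::ab_group_add"
  by (induction A rule: infinite_finite_induct) auto

definition path_arrows :: "('o list, 'v matrix) arrow list \<Rightarrow> nat list \<Rightarrow> ('o, 'v) arrow list" where
  "path_arrows Fs ks = map (\<lambda>r. entry (Fs ! r) (ks ! r) (ks ! Suc r)) [0..<length Fs]"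

lemma entry_sel [simp]:
  "src (entry F i j) = src F ! j" "tgt (entry F i j) = tgt F ! i" "deg (entry F i j) = deg F"
  "val (entry F i j) = val F i j" "sdeg (entry F i j) = sdeg F"
  "entry (Arrow x y d M) i j = Arrow (x ! j) (y ! i) d (M i j)"
  by (simp_all add: entry_def sdeg_def)

lemma length_path_arrows [simp]: "length (path_arrows Fs ks) = length Fs"
  by (simp add: path_arrows_def)

lemma path_arrows_Nil [simp]: "path_arrows [] ks = []"
  by (simp add: path_arrows_def)

lemma path_arrows_eq_Nil [simp]: "path_arrows Fs ks = [] \<longleftrightarrow> Fs = []"
  by (simp add: path_arrows_def)

lemma map_deg_path_arrows [simp]:
  "map deg (path_arrows Fs ks) = map deg Fs" "map sdeg (path_arrows Fs ks) = map sdeg Fs"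
  by (auto intro: nth_equalityI simp: path_arrows_def)

lemma path_arrows_Cons: "path_arrows (F # Fs) (i # ks) = entry F i (ks ! 0) # path_arrows Fs ks"
  by (simp add: path_arrows_def upt_conv_Cons map_Suc_upt[symmetric] o_def del: upt_Suc)

lemma index_paths_Nil: "index_paths [] i j = (if i = j then {[i]} else {})"
  by (auto simp: index_paths_def length_Suc_conv)

lemma index_paths_Cons:
  "index_paths (F # Fs) i j =
    (if i < length (tgt F) then \<Union>k<length (src F). (#) i ` index_paths Fs k j else {})"
proof -
  have "ks \<in> index_paths (F # Fs) i j \<longleftrightarrow> i < length (tgt F) \<and>
      (\<exists>k<length (src F). \<exists>ks'. ks = i # ks' \<and> ks' \<in> index_paths Fs k j)" for ks
  proof (cases ks)
    case (Cons a ks')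
    then show ?thesis
      by (cases ks') (auto simp: index_paths_def less_Suc_eq_0_disj all_conj_distrib
          split: nat.splits)
  qed (simp add: index_paths_def)
  then show ?thesis by (simp add: set_eq_iff) blast
qed

lemma index_paths_nth_0: "ks \<in> index_paths Fs i j \<Longrightarrow> ks ! 0 = i"
  by (cases ks) (auto simp: index_paths_def)

lemma finite_index_paths [simp]: "finite (index_paths Fs i j)"
  by (induction Fs arbitrary: i) (auto simp: index_paths_Nil index_paths_Cons)

lemma sum_paths_Cons:
  "(\<Sum>ks \<in> index_paths (F # Fs) i j. \<phi> (path_arrows (F # Fs) ks)) =
    (if i < length (tgt F)
     then \<Sum>k<length (src F). \<Sum>ks \<in> index_paths Fs k j. \<phi> (entry F i k # path_arrows Fs ks)
     else 0)"
proof (cases "i < length (tgt F)")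
  case True
  have "(\<Sum>ks \<in> index_paths (F # Fs) i j. \<phi> (path_arrows (F # Fs) ks)) =
      (\<Sum>k<length (src F). \<Sum>ks \<in> (#) i ` index_paths Fs k j. \<phi> (path_arrows (F # Fs) ks))"
    using True unfolding index_paths_Cons if_P[OF True]
    by (subst sum.UNION_disjoint) (auto dest: index_paths_nth_0)
  also have "\<dots> = (\<Sum>k<length (src F). \<Sum>ks \<in> index_paths Fs k j. \<phi> (entry F i k # path_arrows Fs ks))"
    by (auto intro!: sum.cong simp: sum.reindex path_arrows_Cons index_paths_nth_0)
  finally show ?thesis using True by simp
qed (simp add: index_paths_Cons)

lemma sum_paths_Nil [simp]: "(\<Sum>ks \<in> index_paths [] i j. c) = (if i = j then c else 0)"
  by (simp add: index_paths_Nil)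

lemma sum_paths_single:
  "(\<Sum>ks \<in> index_paths [F] i j. \<phi> (path_arrows [F] ks)) =
    (if i < length (tgt F) \<and> j < length (src F) then \<phi> [entry F i j] else 0)"
  by (simp add: sum_paths_Cons)

text \<open>
  A path through \<open>Fs @ Gs\<close> is a path through \<open>Fs\<close> followed by a path through \<open>Gs\<close> that starts
  at its end \<open>k\<close>. For empty \<open>Fs\<close> the only path is constant, which is why \<open>i < K\<close> is required then.
\<close>

lemma sum_paths_append:
  assumes "Fs = [] \<Longrightarrow> i < K" "Fs \<noteq> [] \<Longrightarrow> length (src (last Fs)) = K"
  shows "(\<Sum>ks \<in> index_paths (Fs @ Gs) i j. \<phi> (path_arrows (Fs @ Gs) ks)) =
    (\<Sum>k<K. \<Sum>ks \<in> index_paths Fs i k. \<Sum>ls \<in> index_paths Gs k j.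
       \<phi> (path_arrows Fs ks @ path_arrows Gs ls))"
  using assms
proof (induction Fs arbitrary: i \<phi>)
  case Nil
  then show ?case by simp
next
  case (Cons F Fs)
  show ?case
  proof (cases "i < length (tgt F)")
    case True
    have "(\<Sum>ks \<in> index_paths (F # Fs @ Gs) i j. \<phi> (path_arrows (F # Fs @ Gs) ks)) =
        (\<Sum>m<length (src F). \<Sum>ks \<in> index_paths (Fs @ Gs) m j.
           \<phi> (entry F i m # path_arrows (Fs @ Gs) ks))"
      using True by (simp add: sum_paths_Cons)
    also have "\<dots> = (\<Sum>m<length (src F). \<Sum>k<K. \<Sum>ks \<in> index_paths Fs m k. \<Sum>ls \<in> index_paths Gs k j.
           \<phi> (entry F i m # path_arrows Fs ks @ path_arrows Gs ls))"
      by (rule sum.cong[OF refl], rule Cons.IH[where \<phi> = "\<lambda>l. \<phi> (entry F i _ # l)"])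
        (use Cons.prems in auto)
    also have "\<dots> = (\<Sum>k<K. \<Sum>m<length (src F). \<Sum>ks \<in> index_paths Fs m k. \<Sum>ls \<in> index_paths Gs k j.
           \<phi> ((entry F i m # path_arrows Fs ks) @ path_arrows Gs ls))"
      by (subst sum.swap) simp
    also have "\<dots> = (\<Sum>k<K. \<Sum>ks \<in> index_paths (F # Fs) i k. \<Sum>ls \<in> index_paths Gs k j.
           \<phi> (path_arrows (F # Fs) ks @ path_arrows Gs ls))"
      using True
      by (subst sum_paths_Cons[where \<phi> = "\<lambda>l. \<Sum>ls \<in> index_paths Gs _ j. \<phi> (l @ path_arrows Gs ls)"]) simp
    finally show ?thesis by simp
  qed (simp add: index_paths_Cons)
qed


section \<open>Matrix categories\<close>

lemma mat_cat_simps: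
  "Obj (mat_cat D) = {zs. zs \<noteq> [] \<and> set zs \<subseteq> Obj D}"
  "M \<in> Hom (mat_cat D) zs zs' d \<longleftrightarrow> (\<forall>i j.
      if i < length zs' \<and> j < length zs then M i j \<in> Hom D (zs ! j) (zs' ! i) d else M i j = 0)"
  "scal (mat_cat D) c M i j = scal D c (M i j)"
  "bop (mat_cat D) Fs i j = (\<Sum>ks \<in> index_paths Fs i j. bop D (path_arrows Fs ks))"
  by (simp_all add: mat_cat_def path_arrows_def)

lemma is_arrow_entry:
  "\<lbrakk>is_arrow (mat_cat D) F; i < length (tgt F); j < length (src F)\<rbrakk> \<Longrightarrow> is_arrow D (entry F i j)"
  by (auto simp: is_arrow_def mat_cat_simps)

lemma val_outside:
  "\<lbrakk>is_arrow (mat_cat D) F; \<not> (i < length (tgt F) \<and> j < length (src F))\<rbrakk> \<Longrightarrow> val F i j = 0"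
  by (auto simp: is_arrow_def mat_cat_simps)

lemma composable_path_arrows:
  assumes "composable (mat_cat D) Fs" "ks \<in> index_paths Fs i j"
  shows "composable D (path_arrows Fs ks) \<and> tgt (hd (path_arrows Fs ks)) = tgt (hd Fs) ! i \<and>
    src (last (path_arrows Fs ks)) = src (last Fs) ! j \<and>
    i < length (tgt (hd Fs)) \<and> j < length (src (last Fs))"
  using assms
proof (induction Fs arbitrary: i ks)
  case (Cons F Fs)
  from Cons.prems(2) obtain k ls where k: "i < length (tgt F)" "k < length (src F)"
    "ks = i # ls" "ls \<in> index_paths Fs k j" by (auto simp: index_paths_Cons split: if_splits)
  have F: "is_arrow (mat_cat D) F" using Cons.prems(1) by (simp add: composable_def)
  have eq: "path_arrows (F # Fs) ks = entry F i k # path_arrows Fs ls"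
    using k by (simp add: path_arrows_Cons index_paths_nth_0)
  show ?case
  proof (cases "Fs = []")
    case True
    then show ?thesis using k eq is_arrow_entry[OF F]
      by (auto simp: index_paths_Nil split: if_splits)
  next
    case False
    then have Fs: "composable (mat_cat D) Fs" "src F = tgt (hd Fs)"
      using Cons.prems(1) by (auto simp: composable_Cons)
    show ?thesis
      using Cons.IH[OF Fs(1) k(4)] False Fs(2) k(1,2) is_arrow_entry[OF F]
      by (auto simp: eq composable_Cons)
  qed
qed (simp add: composable_def)

lemma composable_path_insert:
  assumes c: "composable (mat_cat D) (X @ F # Z)"
    and X: "ks \<in> index_paths X i k" and Z: "ls \<in> index_paths Z m j"
    and km: "k < length (tgt F)" "m < length (src F)"
  shows "composable D (path_arrows X ks @ entry F k m # path_arrows Z ls)"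
proof -
  have F: "is_arrow D (entry F k m)"
    using c km by (intro is_arrow_entry) (auto simp: composable_def)
  have FZ: "composable D (entry F k m # path_arrows Z ls)"
  proof (cases "Z = []")
    case False
    then have cZ: "composable (mat_cat D) Z" "src F = tgt (hd Z)"
      using c composable_suffix[of _ X "F # Z"] by (auto simp: composable_Cons)
    then show ?thesis using F False composable_path_arrows[OF cZ(1) Z]
      by (simp add: composable_Cons)
  qed (use F in simp)
  show ?thesis
  proof (cases "X = []")
    case False
    then have cX: "composable (mat_cat D) X" "src (last X) = tgt F"
      using c by (auto simp: composable_append)
    then show ?thesis using False FZ composable_path_arrows[OF cX(1) X]
      by (simp add: composable_append)
  qed (use FZ in simp)
qed

text \<open>
  A composition of matrices depends linearly on the entries of each factor: this expansion reduces
  multilinearity, units and nested compositions of matrices to statements about entries.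
\<close>

lemma bop_mat_insert:
  assumes "i < length (tgt (hd (X @ F # Z)))" "X \<noteq> [] \<Longrightarrow> src (last X) = tgt F"
  shows "bop (mat_cat D) (X @ F # Z) i j =
    (\<Sum>k<length (tgt F). \<Sum>ks \<in> index_paths X i k. \<Sum>m<length (src F). \<Sum>ls \<in> index_paths Z m j.
       bop D (path_arrows X ks @ entry F k m # path_arrows Z ls))"
proof -
  have "bop (mat_cat D) (X @ F # Z) i j =
      (\<Sum>k<length (tgt F). \<Sum>ks \<in> index_paths X i k. \<Sum>ls \<in> index_paths (F # Z) k j.
        bop D (path_arrows X ks @ path_arrows (F # Z) ls))"
    unfolding mat_cat_simps by (rule sum_paths_append) (use assms in auto)
  also have "\<dots> = (\<Sum>k<length (tgt F). \<Sum>ks \<in> index_paths X i k. \<Sum>m<length (src F). \<Sum>ls \<in> index_paths Z m j.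
       bop D (path_arrows X ks @ entry F k m # path_arrows Z ls))"
    by (intro sum.cong refl) (subst sum_paths_Cons[where \<phi> = "\<lambda>l. bop D (_ @ l)"], simp)
  finally show ?thesis .
qed

lemma sum_paths_append3:
  assumes c: "composable (mat_cat D) (X @ Y @ Z)" "Y \<noteq> []" and i: "i < length (tgt (hd (X @ Y)))"
  shows "(\<Sum>ks \<in> index_paths (X @ Y @ Z) i j. \<phi> (path_arrows (X @ Y @ Z) ks)) =
    (\<Sum>k<length (tgt (hd Y)). \<Sum>ks \<in> index_paths X i k. \<Sum>m<length (src (last Y)).
      \<Sum>ls \<in> index_paths Z m j. \<Sum>ps \<in> index_paths Y k m.
        \<phi> (path_arrows X ks @ path_arrows Y ps @ path_arrows Z ls))"
proof -
  have "(\<Sum>ks \<in> index_paths (X @ Y @ Z) i j. \<phi> (path_arrows (X @ Y @ Z) ks)) =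
      (\<Sum>k<length (tgt (hd Y)). \<Sum>ks \<in> index_paths X i k. \<Sum>ls \<in> index_paths (Y @ Z) k j.
        \<phi> (path_arrows X ks @ path_arrows (Y @ Z) ls))"
    by (rule sum_paths_append) (use c i in \<open>auto simp: composable_append\<close>)
  also have "\<dots> = (\<Sum>k<length (tgt (hd Y)). \<Sum>ks \<in> index_paths X i k. \<Sum>m<length (src (last Y)).
      \<Sum>ps \<in> index_paths Y k m. \<Sum>ls \<in> index_paths Z m j.
        \<phi> (path_arrows X ks @ path_arrows Y ps @ path_arrows Z ls))"
    by (intro sum.cong refl, rule sum_paths_append[where \<phi> = "\<lambda>l. \<phi> (_ @ l)"]) (use c in auto)
  also have "\<dots> = (\<Sum>k<length (tgt (hd Y)). \<Sum>ks \<in> index_paths X i k. \<Sum>m<length (src (last Y)).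
      \<Sum>ls \<in> index_paths Z m j. \<Sum>ps \<in> index_paths Y k m.
        \<phi> (path_arrows X ks @ path_arrows Y ps @ path_arrows Z ls))"
    by (rule sum.cong[OF refl], rule sum.cong[OF refl], rule sum.cong[OF refl], rule sum.swap)
  finally show ?thesis .
qed

lemma barrow_path_arrows:
  assumes "composable (mat_cat D) Y" "ps \<in> index_paths Y k m"
  shows "barrow D (path_arrows Y ps) = Arrow (src (last Y) ! m) (tgt (hd Y) ! k)
    (deg (barrow (mat_cat D) Y)) (bop D (path_arrows Y ps))"
  using composable_path_arrows[OF assms] by (simp add: barrow_def)

lemma entry_barrow:
  "entry (barrow (mat_cat D) Y) k m = Arrow (src (last Y) ! m) (tgt (hd Y) ! k)
    (deg (barrow (mat_cat D) Y)) (\<Sum>ps \<in> index_paths Y k m. bop D (path_arrows Y ps))"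
  by (simp add: entry_def mat_cat_simps)

context ainf_cat
begin

lemma is_arrow_barrow_mat:
  assumes "composable (mat_cat C) Fs"
  shows "is_arrow (mat_cat C) (barrow (mat_cat C) Fs)"
proof -
  have ne: "Fs \<noteq> []" using assms by (simp add: composable_def)
  have ends: "tgt (hd Fs) \<in> Obj (mat_cat C)" "src (last Fs) \<in> Obj (mat_cat C)"
    using assms ne by (auto simp: composable_def is_arrow_def)
  have "bop C (path_arrows Fs ks) \<in> Hom C (src (last Fs) ! j) (tgt (hd Fs) ! i) (deg (barrow (mat_cat C) Fs))"
    if "ks \<in> index_paths Fs i j" for i j ks
    using is_arrow_barrow[of "path_arrows Fs ks"] composable_path_arrows[OF assms that]
    unfolding is_arrow_def barrow_path_arrows[OF assms that] by simp
  moreover have "index_paths Fs i j = {}" if "\<not> (i < length (tgt (hd Fs)) \<and> j < length (src (last Fs)))" for i j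
    using composable_path_arrows[OF assms] that by blast
  ultimately show ?thesis
    using ends unfolding is_arrow_def
    by (auto simp: mat_cat_simps intro!: hom_sum)
qed

text \<open>
  Expanding each entry of the inner composition as a sum over paths through \<open>Y\<close> glues these to the
  paths through \<open>X\<close> and \<open>Z\<close>, and gives a sum over paths through the whole list.
\<close>

lemma bop_mat_barrow:
  assumes c: "composable (mat_cat C) (X @ Y @ Z)" "Y \<noteq> []" and i: "i < length (tgt (hd (X @ Y)))"
  shows "bop (mat_cat C) (X @ barrow (mat_cat C) Y # Z) i j =
    (\<Sum>ks \<in> index_paths (X @ Y @ Z) i j. let w = path_arrows (X @ Y @ Z) ks in
       bop C (take (length X) w @ barrow C (take (length Y) (drop (length X) w)) #
         drop (length X + length Y) w))"
proof -
  let ?B = "barrow (mat_cat C) Y"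
  have Y: "composable (mat_cat C) Y" using c by (rule composable_middle)
  have XB: "composable (mat_cat C) (X @ ?B # Z)"
    by (rule composable_replace[OF c is_arrow_barrow_mat[OF Y]]) auto
  have key: "bop C (path_arrows X ks @ entry ?B k m # path_arrows Z ls) =
      (\<Sum>ps \<in> index_paths Y k m. bop C (path_arrows X ks @ barrow C (path_arrows Y ps) # path_arrows Z ls))"
    if "k < length (tgt ?B)" "ks \<in> index_paths X i k" "m < length (src ?B)" "ls \<in> index_paths Z m j"
    for k ks m ls
  proof -
    have "composable C (path_arrows X ks @ entry ?B k m # path_arrows Z ls)"
      using XB that by (intro composable_path_insert)
    moreover have "bop C (path_arrows Y ps) \<in> Hom C (src (last Y) ! m) (tgt (hd Y) ! k) (deg ?B)"
      if "ps \<in> index_paths Y k m" for ps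
      using is_arrow_barrow[of "path_arrows Y ps"] composable_path_arrows[OF Y that]
      unfolding is_arrow_def barrow_path_arrows[OF Y that] by simp
    ultimately show ?thesis
      unfolding entry_barrow by (subst bop_sum) (auto simp: barrow_path_arrows[OF Y])
  qed
  have "bop (mat_cat C) (X @ ?B # Z) i j =
    (\<Sum>k<length (tgt ?B). \<Sum>ks \<in> index_paths X i k. \<Sum>m<length (src ?B). \<Sum>ls \<in> index_paths Z m j.
       bop C (path_arrows X ks @ entry ?B k m # path_arrows Z ls))"
    by (rule bop_mat_insert) (use c i in \<open>auto simp: composable_append hd_append split: if_splits\<close>)
  also have "\<dots> = (\<Sum>k<length (tgt ?B). \<Sum>ks \<in> index_paths X i k. \<Sum>m<length (src ?B).
      \<Sum>ls \<in> index_paths Z m j. \<Sum>ps \<in> index_paths Y k m.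
       bop C (path_arrows X ks @ barrow C (path_arrows Y ps) # path_arrows Z ls))"
    by (intro sum.cong refl key) auto
  also have "\<dots> = (\<Sum>ks \<in> index_paths (X @ Y @ Z) i j. let w = path_arrows (X @ Y @ Z) ks in
       bop C (take (length X) w @ barrow C (take (length Y) (drop (length X) w)) #
         drop (length X + length Y) w))"
    by (subst sum_paths_append3[OF assms, where \<phi> = "\<lambda>w. let w = w in
       bop C (take (length X) w @ barrow C (take (length Y) (drop (length X) w)) #
         drop (length X + length Y) w)"]) simp
  finally show ?thesis .
qed

text \<open>
  The term which composes \<open>l\<close> matrices after the first \<open>a\<close> is, for all \<open>a\<close> and \<open>l\<close>, a sum over
  the same paths. Along each path, the terms add up to a relation of the entries.
\<close>

lemma ainf_relations_mat: "ainf_relations (mat_cat C)"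
proof (rule ainf_relationsI, intro ext)
  fix Fs i j assume c: "composable (mat_cat C) Fs"
  let ?h = "\<lambda>a l w. signed (tdeg (take a w))
    (bop C (take a w @ barrow C (take l (drop a w)) # drop (a + l) w))"
  let ?I = "{(a, l). 1 \<le> l \<and> a + l \<le> length Fs}"
  have ne: "Fs \<noteq> []" using c by (simp add: composable_def)
  have "(\<Sum>(X, Y, Z) \<in> splits Fs. signed (tdeg X)
      (bop (mat_cat C) (X @ barrow (mat_cat C) Y # Z))) i j =
    (\<Sum>(X, Y, Z) \<in> splits Fs. signed (tdeg X) (bop (mat_cat C) (X @ barrow (mat_cat C) Y # Z) i j))"
    by (simp add: sum_fun_apply case_prod_beta signed_apply)
  also have "\<dots> = 0"
  proof (cases "i < length (tgt (hd Fs))")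
    case True
    have "(\<Sum>(X, Y, Z) \<in> splits Fs. signed (tdeg X) (bop (mat_cat C) (X @ barrow (mat_cat C) Y # Z) i j)) =
      (\<Sum>(X, Y, Z) \<in> splits Fs.
        \<Sum>ks \<in> index_paths Fs i j. ?h (length X) (length Y) (path_arrows Fs ks))"
    proof (rule sum_splits_cong)
      fix X Y Z assume XYZ: "X @ Y @ Z = Fs" "Y \<noteq> []"
      have "tdeg (take (length X) (path_arrows Fs ks)) = tdeg X" for ks
        by (simp flip: take_map) (simp flip: XYZ(1))
      moreover have "i < length (tgt (hd (X @ Y)))" using True XYZ by (cases X) auto
      ultimately show "signed (tdeg X) (bop (mat_cat C) (X @ barrow (mat_cat C) Y # Z) i j) =
          (\<Sum>ks \<in> index_paths Fs i j. ?h (length X) (length Y) (path_arrows Fs ks))"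
        using bop_mat_barrow[of X Y Z i j] c XYZ by (simp add: Let_def signed_sum)
    qed
    also have "\<dots> = (\<Sum>(a, l) \<in> ?I. \<Sum>ks \<in> index_paths Fs i j. ?h a l (path_arrows Fs ks))"
      unfolding sum_splits[symmetric] by (rule sum.cong) auto
    also have "\<dots> = (\<Sum>ks \<in> index_paths Fs i j. \<Sum>(a, l) \<in> ?I. ?h a l (path_arrows Fs ks))"
      unfolding case_prod_beta by (rule sum.swap)
    also have "\<dots> = 0"
    proof (rule sum.neutral, rule ballI)
      fix ks assume "ks \<in> index_paths Fs i j"
      then have "composable C (path_arrows Fs ks)" using composable_path_arrows[OF c] by blast
      then show "(\<Sum>(a, l) \<in> ?I. ?h a l (path_arrows Fs ks)) = 0"
        using relations[of "path_arrows Fs ks"] unfolding sum_splits[symmetric] by simp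
    qed
    finally show ?thesis .
  next
    case False
    have "(\<Sum>(X, Y, Z) \<in> splits Fs. signed (tdeg X) (bop (mat_cat C) (X @ barrow (mat_cat C) Y # Z) i j)) =
        (\<Sum>(X, Y, Z) \<in> splits Fs. 0)"
    proof (rule sum_splits_cong)
      fix X Y Z assume "X @ Y @ Z = Fs" "Y \<noteq> []"
      with False have "bop (mat_cat C) (X @ barrow (mat_cat C) Y # Z) i j = 0"
        by (cases X) (auto simp: mat_cat_simps index_paths_Cons)
      then show "signed (tdeg X) (bop (mat_cat C) (X @ barrow (mat_cat C) Y # Z) i j) = 0" by simp
    qed
    then show ?thesis by (simp add: case_prod_beta)
  qed
  finally show "(\<Sum>(X, Y, Z) \<in> splits Fs. signed (tdeg X)
      (bop (mat_cat C) (X @ barrow (mat_cat C) Y # Z))) i j = 0 i j" by simp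
qed

lemma vector_space_mat: "vector_space (scal (mat_cat C))"
  by unfold_locales (auto simp: fun_eq_iff mat_cat_simps scale_right_distrib scale_left_distrib)

lemma subspace_mat:
  assumes "x \<in> Obj (mat_cat C)" "y \<in> Obj (mat_cat C)"
  shows "module.subspace (scal (mat_cat C)) (Hom (mat_cat C) x y d)"
proof -
  interpret mat: vector_space "scal (mat_cat C)" by (rule vector_space_mat)
  have "x ! j \<in> Obj C" if "j < length x" for j using that assms by (auto simp: mat_cat_simps)
  moreover have "y ! i \<in> Obj C" if "i < length y" for i using that assms by (auto simp: mat_cat_simps)
  ultimately show ?thesis
    unfolding mat.subspace_def
    by (simp add: mat_cat_simps hom_zero hom_add hom_scale)
qed

lemma multilinear_mat: "multilinear_ops (mat_cat C)"
  unfolding multilinear_ops_def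
proof (intro allI impI ext)
  fix us x y d v w c vs i j
  assume a: "composable (mat_cat C) (us @ Arrow x y d v # vs)" "w \<in> Hom (mat_cat C) x y d"
  let ?F = "\<lambda>v. us @ Arrow x y d v # vs"
  let ?G = "\<lambda>v k ks m ls. bop C (path_arrows us ks @ entry (Arrow x y d v) k m # path_arrows vs ls)"
  define h where "h = tgt (hd (?F v))"
  have hd: "tgt (hd (?F u)) = h" for u by (cases us) (auto simp: h_def)
  have us: "us \<noteq> [] \<Longrightarrow> src (last us) = y" using a(1) by (auto simp: composable_append)
  show "bop (mat_cat C) (?F (scal (mat_cat C) c v + w)) i j =
      (scal (mat_cat C) c (bop (mat_cat C) (?F v)) + bop (mat_cat C) (?F w)) i j"
  proof (cases "i < length h")
    case True
    have expand: "bop (mat_cat C) (?F u) i j =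
        (\<Sum>k<length y. \<Sum>ks \<in> index_paths us i k. \<Sum>m<length x. \<Sum>ls \<in> index_paths vs m j. ?G u k ks m ls)" for u
      using True us by (subst bop_mat_insert) (simp_all add: hd)
    have "?G (scal (mat_cat C) c v + w) k ks m ls = scal C c (?G v k ks m ls) + ?G w k ks m ls"
      if "k < length y" "ks \<in> index_paths us i k" "m < length x" "ls \<in> index_paths vs m j" for k ks m ls
    proof -
      have "w k m \<in> Hom C (x ! m) (y ! k) d" using a(2) that unfolding mat_cat_simps by metis
      then show ?thesis
        using bop_linear composable_path_insert[OF a(1) that(2,4)] that by (simp add: mat_cat_simps)
    qed
    then show ?thesis
      by (simp add: expand mat_cat_simps(3) scale_sum_right sum.distrib[symmetric])
  next
    case False
    then have "bop (mat_cat C) (?F u) i j = 0" for u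
      using hd[of u] by (cases us) (auto simp: mat_cat_simps index_paths_Cons)
    then show ?thesis by (simp add: mat_cat_simps(3))
  qed
qed

text \<open>
  The diagonal entries are units and the others are zero, so among the paths through the identity
  matrix only those which are constant there contribute.
\<close>

lemma strict_unit_mat:
  assumes zs: "zs \<in> Obj (mat_cat C)" and e: "\<And>x. x \<in> Obj C \<Longrightarrow> strict_unit C x (e x)"
  shows "strict_unit (mat_cat C) zs (\<lambda>i j. if i = j \<and> i < length zs then e (zs ! i) else 0)"
    (is "strict_unit _ _ ?E")
proof -
  have obj: "zs ! i \<in> Obj C" if "i < length zs" for i using that zs by (auto simp: mat_cat_simps)
  have u: "strict_unit C (zs ! i) (e (zs ! i))" if "i < length zs" for i using e obj that by blast
  let ?A = "Arrow zs zs 0 ?E"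
  have A: "is_arrow (mat_cat C) ?A"
    using zs u obj by (auto simp: is_arrow_def mat_cat_simps strict_unit_def hom_zero)
  show ?thesis
    unfolding strict_unit_def
  proof (intro conjI allI impI)
    show "?E \<in> Hom (mat_cat C) zs zs 0" using A by (simp add: is_arrow_def)
  next
    fix F assume F: "is_arrow (mat_cat C) F \<and> tgt F = zs"
    show "bop (mat_cat C) [?A, F] = val F"
    proof (intro ext)
      fix i j
      show "bop (mat_cat C) [?A, F] i j = val F i j"
      proof (cases "i < length zs \<and> j < length (src F)")
        case ij: True
        have "bop C [entry ?A i k, entry F k j] = (if k = i then val F i j else 0)" if k: "k < length zs" for k
        proof (cases "k = i")
          case True
          then show ?thesis using u[OF k] is_arrow_entry[of C F k j] F k ij
            by (simp add: strict_unit_def)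
        next
          case False
          have "composable C ([] @ entry ?A i k # [entry F k j])"
            using is_arrow_entry[of C F k j] is_arrow_entry[OF A, of i k] F k ij
            by (simp add: composable_Cons)
          from bop_zero_val[OF this] show ?thesis using False by simp
        qed
        then have "(\<Sum>k<length zs. bop C [entry ?A i k, entry F k j]) = val F i j"
          using ij by simp
        then show ?thesis
          using ij F
          by (simp add: mat_cat_simps(4) sum_paths_Cons[where Fs = "[F]"]
              sum_paths_single[where \<phi> = "\<lambda>l. bop C (_ # l)"] del: entry_sel)
      next
        case False
        have "composable (mat_cat C) [?A, F]" using A F by (simp add: composable_Cons)
        then have "index_paths [?A, F] i j = {}"
          using False composable_path_arrows[of C "[?A, F]" _ i j] by fastforce
        then show ?thesis using False F val_outside[of C F i j] by (simp add: mat_cat_simps(4))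
      qed
    qed
  next
    fix F assume F: "is_arrow (mat_cat C) F \<and> src F = zs"
    show "bop (mat_cat C) [F, ?A] = signed (deg F) (val F)"
    proof (intro ext)
      fix i j
      show "bop (mat_cat C) [F, ?A] i j = signed (deg F) (val F) i j"
      proof (cases "i < length (tgt F) \<and> j < length zs")
        case ij: True
        have "bop C [entry F i k, entry ?A k j] = (if k = j then signed (deg F) (val F i j) else 0)"
          if k: "k < length zs" for k
        proof (cases "k = j")
          case True
          then show ?thesis using u[OF k] is_arrow_entry[of C F i k] F k ij
            by (simp add: strict_unit_def)
        next
          case False
          have "composable C ([entry F i k] @ entry ?A k j # [])"
            using is_arrow_entry[of C F i k] is_arrow_entry[OF A, of k j] F k ij
            by (simp add: composable_Cons)
          from bop_zero_val[OF this] show ?thesis using False by simp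
        qed
        then have "(\<Sum>k<length zs. bop C [entry F i k, entry ?A k j]) = signed (deg F) (val F i j)"
          using ij by simp
        then show ?thesis
          using ij F
          by (simp add: mat_cat_simps(4) sum_paths_Cons[where Fs = "[?A]"] signed_apply
              sum_paths_single[where \<phi> = "\<lambda>l. bop C (_ # l)"] del: entry_sel)
      next
        case False
        have "composable (mat_cat C) [F, ?A]" using A F by (simp add: composable_Cons)
        then have "index_paths [F, ?A] i j = {}"
          using False composable_path_arrows[of C "[F, ?A]" _ i j] by fastforce
        then show ?thesis using False F val_outside[of C F i j] by (simp add: mat_cat_simps(4) signed_apply)
      qed
    qed
  next
    fix Fs assume Fs: "composable (mat_cat C) Fs \<and> length Fs \<noteq> 2 \<and> ?A \<in> set Fs"
    then obtain X Z where XZ: "Fs = X @ ?A # Z" by (auto dest: split_list)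
    then have c: "composable (mat_cat C) (X @ ?A # Z)" using Fs by simp
    show "bop (mat_cat C) Fs = 0"
    proof (intro ext)
      fix i j
      have zero: "bop C (path_arrows X ks @ entry ?A k m # path_arrows Z ls) = 0"
        if p: "k < length zs" "ks \<in> index_paths X i k" "m < length zs" "ls \<in> index_paths Z m j" for k ks m ls
      proof -
        have cc: "composable C (path_arrows X ks @ entry ?A k m # path_arrows Z ls)"
          using composable_path_insert[OF c p(2,4)] p(1,3) by simp
        show ?thesis
        proof (cases "k = m")
          case True
          have "length (path_arrows X ks @ entry ?A k m # path_arrows Z ls) \<noteq> 2"
            using Fs XZ by simp
          then show ?thesis using u[OF p(1)] cc True p(1)
            unfolding strict_unit_def by auto
        qed (use bop_zero_val[OF cc] in simp)
      qed
      have "bop (mat_cat C) Fs i j = 0"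
      proof (cases "i < length (tgt (hd Fs))")
        case True
        show ?thesis unfolding XZ
          by (subst bop_mat_insert) (use True XZ c in \<open>auto simp: composable_append zero simp del: entry_sel\<close>)
      next
        case False
        then have "index_paths Fs i j = {}" using composable_path_arrows[of C Fs] Fs by fastforce
        then show ?thesis by (simp add: mat_cat_simps)
      qed
      then show "bop (mat_cat C) Fs i j = 0 i j" by simp
    qed
  qed
qed

lemma ainf_category_mat: "ainf_category (mat_cat C)"
proof -
  have "\<exists>e. \<forall>x\<in>Obj C. strict_unit C x (e x)"
    using ainf unfolding ainf_category_def by (intro bchoice) blast
  then obtain e where "\<And>x. x \<in> Obj C \<Longrightarrow> strict_unit C x (e x)" by blast
  then show ?thesis
    unfolding ainf_category_def
    using vector_space_mat subspace_mat is_arrow_barrow_mat multilinear_mat ainf_relations_mat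
      strict_unit_mat by blast
qed

end


section \<open>The trace pairing on matrices\<close>

definition mat_pairing :: "('o, 'v, 'k::field) pairing \<Rightarrow> ('o list, 'v matrix, 'k) pairing" where
  "mat_pairing P F G =
    (\<Sum>i<length (tgt F). \<Sum>j<length (src F). P (entry F i j) (entry G j i))"

lemma opposed_entry:
  "\<lbrakk>opposed (mat_cat C) F G; i < length (tgt F); j < length (src F)\<rbrakk> \<Longrightarrow>
    opposed C (entry F i j) (entry G j i)"
  by (auto simp: opposed_def is_arrow_entry)

context cy_cat
begin

lemma bilinear_mat: "bilinear_pairing (mat_cat C) (mat_pairing P)"
proof -
  have hom: "w i j \<in> Hom C (x ! j) (y ! i) d"
    if "w \<in> Hom (mat_cat C) x y d" "i < length y" "j < length x" for w x y d i j
    using that unfolding mat_cat_simps by metis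
  show ?thesis
    unfolding bilinear_pairing_def
  proof (intro conjI allI impI)
    fix x y d v w c G
    assume o: "opposed (mat_cat C) (Arrow x y d v) G" and w: "w \<in> Hom (mat_cat C) x y d"
    have "P (entry (Arrow x y d (scal (mat_cat C) c v + w)) i j) (entry G j i) =
        c * P (entry (Arrow x y d v) i j) (entry G j i) + P (entry (Arrow x y d w) i j) (entry G j i)"
      if "i < length y" "j < length x" for i j
      using pairing_linear_left opposed_entry[OF o, of i j] hom[OF w] that by (simp add: mat_cat_simps)
    then show "mat_pairing P (Arrow x y d (scal (mat_cat C) c v + w)) G =
        c * mat_pairing P (Arrow x y d v) G + mat_pairing P (Arrow x y d w) G"
      by (simp add: mat_pairing_def sum_distrib_left sum.distrib del: entry_sel)
  next
    fix x y d v w c F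
    assume o: "opposed (mat_cat C) F (Arrow x y d v)" and w: "w \<in> Hom (mat_cat C) x y d"
    then have ends: "x = tgt F" "y = src F" by (auto simp: opposed_def)
    have "P (entry F i j) (entry (Arrow x y d (scal (mat_cat C) c v + w)) j i) =
        c * P (entry F i j) (entry (Arrow x y d v) j i) + P (entry F i j) (entry (Arrow x y d w) j i)"
      if "i < length x" "j < length y" for i j
      using pairing_linear_right opposed_entry[OF o, of i j] hom[OF w] that by (simp add: mat_cat_simps ends)
    then show "mat_pairing P F (Arrow x y d (scal (mat_cat C) c v + w)) =
        c * mat_pairing P F (Arrow x y d v) + mat_pairing P F (Arrow x y d w)"
      by (simp add: mat_pairing_def sum_distrib_left sum.distrib flip: ends del: entry_sel)
  qed
qed

lemma pairing_degree_mat: "pairing_degree n (mat_cat C) (mat_pairing P)"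
  unfolding pairing_degree_def mat_pairing_def
proof (intro allI impI sum.neutral ballI)
  fix F G i j
  assume "opposed (mat_cat C) F G \<and> deg F + deg G \<noteq> n" "i \<in> {..<length (tgt F)}" "j \<in> {..<length (src F)}"
  then have "opposed C (entry F i j) (entry G j i)" "deg (entry F i j) + deg (entry G j i) \<noteq> n"
    using opposed_entry by auto
  then show "P (entry F i j) (entry G j i) = 0"
    using pairing_deg unfolding pairing_degree_def by blast
qed

lemma symmetric_mat: "symmetric_pairing (mat_cat C) (mat_pairing P)"
  unfolding symmetric_pairing_def
proof (intro allI impI)
  fix F G assume o: "opposed (mat_cat C) F G"
  then have ends: "src G = tgt F" "tgt G = src F" by (auto simp: opposed_def)
  have "mat_pairing P F G = (\<Sum>i<length (tgt F). \<Sum>j<length (src F).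
      signed (deg F * deg G) (P (entry G j i) (entry F i j)))"
    unfolding mat_pairing_def
    by (intro sum.cong refl) (use pairing_swap[OF opposed_entry[OF o]] in simp)
  also have "\<dots> = signed (deg F * deg G) (mat_pairing P G F)"
    unfolding mat_pairing_def ends signed_sum by (rule sum.swap)
  finally show "mat_pairing P F G = signed (deg F * deg G) (mat_pairing P G F)" .
qed

lemma nondegenerate_mat: "nondegenerate_pairing (mat_cat C) (mat_pairing P)"
proof -
  have left: "val F = 0" if F: "is_arrow (mat_cat C) F"
    and orth: "\<And>G. opposed (mat_cat C) F G \<Longrightarrow> mat_pairing P F G = 0" for F
  proof (intro ext)
    fix i j
    show "val F i j = 0 i j"
    proof (cases "i < length (tgt F) \<and> j < length (src F)")
      case True
      have "P (entry F i j) h = 0" if h: "opposed C (entry F i j) h" for h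
      proof -
        \<comment> \<open>The matrix with the only nonzero entry \<open>h\<close> detects the entry \<open>(i, j)\<close> of \<open>F\<close>.\<close>
        let ?M = "\<lambda>a b. if a = j \<and> b = i then val h else 0"
        let ?G = "Arrow (tgt F) (src F) (deg h) ?M"
        have obj: "tgt F ! a \<in> Obj C" if "a < length (tgt F)" for a
          using F that by (auto simp: is_arrow_def mat_cat_simps)
        have obj': "src F ! a \<in> Obj C" if "a < length (src F)" for a
          using F that by (auto simp: is_arrow_def mat_cat_simps)
        have o: "opposed (mat_cat C) F ?G"
          using F h True obj obj' by (auto simp: opposed_def is_arrow_def mat_cat_simps hom_zero)
        have hG: "entry ?G j i = h" using h by (cases h) (auto simp: opposed_def)
        have "P (entry F a b) (entry ?G b a) = (if a = i \<and> b = j then P (entry F i j) h else 0)"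
          if ab: "a < length (tgt F)" "b < length (src F)" for a b
          using pairing_zero_right[OF opposed_entry[OF o ab]] hG by auto
        then have "mat_pairing P F ?G =
            (\<Sum>a<length (tgt F). \<Sum>b<length (src F). if a = i \<and> b = j then P (entry F i j) h else 0)"
          unfolding mat_pairing_def by (intro sum.cong refl) auto
        also have "\<dots> = (\<Sum>a<length (tgt F). if a = i then P (entry F i j) h else 0)"
          using True by (intro sum.cong refl) auto
        also have "\<dots> = P (entry F i j) h" using True by simp
        finally show ?thesis using orth[OF o] by simp
      qed
      then have "val (entry F i j) = 0"
        using nondegenerate is_arrow_entry[OF F] True unfolding nondegenerate_pairing_def by blast
      then show ?thesis by simp
    qed (use val_outside[OF F] in simp)
  qed
  moreover have "val G = 0" if G: "is_arrow (mat_cat C) G"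
    and orth: "\<And>F. opposed (mat_cat C) F G \<Longrightarrow> mat_pairing P F G = 0" for G
  proof (rule left[OF G])
    fix F assume o: "opposed (mat_cat C) G F"
    have "mat_pairing P G F = signed (deg G * deg F) (mat_pairing P F G)"
      using symmetric_mat o by (simp add: symmetric_pairing_def)
    then show "mat_pairing P G F = 0" using orth[of F] o opposed_sym[of "mat_cat C" G F] by simp
  qed
  ultimately show ?thesis unfolding nondegenerate_pairing_def by blast
qed

text \<open>
  The trace pairs the entry \<open>(i, j)\<close> of a composition, a sum over paths from \<open>i\<close> to \<open>j\<close>, with
  the entry \<open>(j, i)\<close> of the last matrix, which closes each path.
\<close>

lemma U_mat:
  assumes "cyclic_list (mat_cat C) fs"
  shows "U (mat_cat C) (mat_pairing P) fs =
    (\<Sum>i<length (tgt (hd fs)). \<Sum>ks \<in> index_paths fs i i. U C P (path_arrows fs ks))"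
proof -
  obtain gs g where fs: "fs = gs @ [g]" "gs \<noteq> []" "composable (mat_cat C) gs" "is_arrow (mat_cat C) g"
    "src (last gs) = tgt g" "src g = tgt (hd gs)"
    using assms by (rule cyclic_listE)
  let ?B = "barrow (mat_cat C) gs"
  have o: "opposed (mat_cat C) ?B g"
    using fs is_arrow_barrow_mat by (auto simp: opposed_def)
  have "P (entry ?B i j) (entry g j i) =
      (\<Sum>ks \<in> index_paths gs i j. P (barrow C (path_arrows gs ks)) (entry g j i))"
    if ij: "i < length (tgt ?B)" "j < length (src ?B)" for i j
  proof -
    have "bop C (path_arrows gs ks) \<in> Hom C (src (last gs) ! j) (tgt (hd gs) ! i) (deg ?B)"
      if "ks \<in> index_paths gs i j" for ks
      using is_arrow_barrow[of "path_arrows gs ks"] composable_path_arrows[OF fs(3) that]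
      unfolding is_arrow_def barrow_path_arrows[OF fs(3) that] by simp
    then show ?thesis
      using opposed_entry[OF o ij] unfolding entry_barrow
      by (subst pairing_sum_left) (auto simp: barrow_path_arrows[OF fs(3)])
  qed
  then have "U (mat_cat C) (mat_pairing P) fs = signed (tdeg gs + 1)
      (\<Sum>i<length (tgt ?B). \<Sum>j<length (src ?B). \<Sum>ks \<in> index_paths gs i j.
        P (barrow C (path_arrows gs ks)) (entry g j i))"
    by (simp add: U_def fs(1) sdeg_barrow mat_pairing_def)
  also have "\<dots> = (\<Sum>i<length (tgt ?B). \<Sum>j<length (src ?B). \<Sum>ks \<in> index_paths gs i j.
        U C P (path_arrows gs ks @ [entry g j i]))"
    by (simp add: U_def sdeg_barrow signed_sum)
  also have "\<dots> = (\<Sum>i<length (tgt (hd fs)). \<Sum>j<length (src ?B). \<Sum>ks \<in> index_paths gs i j.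
        \<Sum>ls \<in> index_paths [g] j i. U C P (path_arrows gs ks @ path_arrows [g] ls))"
    using fs by (intro sum.cong) (auto simp: sum_paths_single[where \<phi> = "\<lambda>l. U C P (_ @ l)"])
  also have "\<dots> = (\<Sum>i<length (tgt (hd fs)). \<Sum>ks \<in> index_paths fs i i. U C P (path_arrows fs ks))"
    unfolding fs(1) by (intro sum.cong refl, rule sum_paths_append[symmetric]) (use fs in auto)
  finally show ?thesis .
qed

lemma cyclic_mat: "cyclic_pairing (mat_cat C) (mat_pairing P)"
  unfolding cyclic_pairing_iff_U
proof (intro allI impI)
  fix us vs assume c: "cyclic_list (mat_cat C) (us @ vs)"
  show "U (mat_cat C) (mat_pairing P) (us @ vs) =
      signed (tdeg us * tdeg vs) (U (mat_cat C) (mat_pairing P) (vs @ us))"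
  proof (cases "us = [] \<or> vs = []")
    case False
    then have uv: "composable (mat_cat C) us" "composable (mat_cat C) vs"
      "src (last us) = tgt (hd vs)" "src (last vs) = tgt (hd us)" "2 \<le> length us + length vs"
      using c by (auto simp: cyclic_list_def composable_append)
    have rot: "U C P (path_arrows us ks @ path_arrows vs ls) =
        signed (tdeg us * tdeg vs) (U C P (path_arrows vs ls @ path_arrows us ks))"
      if "ks \<in> index_paths us i k" "ls \<in> index_paths vs k i" for i k ks ls
    proof -
      have "cyclic_list C (path_arrows us ks @ path_arrows vs ls)"
        using composable_path_arrows[OF uv(1) that(1)] composable_path_arrows[OF uv(2) that(2)]
          False uv by (auto simp: cyclic_list_def composable_append)
      from U_cyclic[OF this] show ?thesis by simp
    qed
    have "U (mat_cat C) (mat_pairing P) (us @ vs) =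
        (\<Sum>i<length (tgt (hd us)). \<Sum>k<length (tgt (hd vs)). \<Sum>ks \<in> index_paths us i k.
          \<Sum>ls \<in> index_paths vs k i. U C P (path_arrows us ks @ path_arrows vs ls))"
      using False uv unfolding U_mat[OF c]
      by (intro sum.cong, simp) (auto intro!: sum_paths_append)
    also have "\<dots> = (\<Sum>i<length (tgt (hd us)). \<Sum>k<length (tgt (hd vs)). \<Sum>ks \<in> index_paths us i k.
          \<Sum>ls \<in> index_paths vs k i.
            signed (tdeg us * tdeg vs) (U C P (path_arrows vs ls @ path_arrows us ks)))"
      by (intro sum.cong refl rot)
    also have "\<dots> = (\<Sum>k<length (tgt (hd vs)). \<Sum>i<length (tgt (hd us)). \<Sum>ls \<in> index_paths vs k i.
          \<Sum>ks \<in> index_paths us i k.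
            signed (tdeg us * tdeg vs) (U C P (path_arrows vs ls @ path_arrows us ks)))"
      by (subst sum.swap, rule sum.cong[OF refl], rule sum.cong[OF refl], rule sum.swap)
    also have "\<dots> = signed (tdeg us * tdeg vs) (U (mat_cat C) (mat_pairing P) (vs @ us))"
      using False uv unfolding U_mat[OF cyclic_list_rotate[OF c]] signed_sum
      by (intro sum.cong, simp)
        (auto intro!: sum_paths_append[where \<phi> = "\<lambda>l. signed (tdeg us * tdeg vs) (U C P l)", symmetric])
    finally show ?thesis .
  qed auto
qed

lemma calabi_yau_mat: "calabi_yau_pairing n (mat_cat C) (mat_pairing P)"
  unfolding calabi_yau_pairing_def
  using bilinear_mat pairing_degree_mat nondegenerate_mat symmetric_mat cyclic_mat by blast

end


section \<open>Words of morphisms and twisting matrices\<close>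

text \<open>
  In a word, \<open>True\<close> stands for the next morphism and \<open>False\<close> for a twisting matrix. Words are
  easy to cut into pieces, whereas the operations of twisted objects are indexed by the lengths of the
  runs of twisting matrices; \<open>gaps\<close> is the bijection from words to lists of run lengths.
\<close>

abbreviation ntrue :: "bool list \<Rightarrow> nat" where
  "ntrue w \<equiv> count_list w True"

fun gaps :: "bool list \<Rightarrow> nat list" where
  "gaps [] = [0]"
| "gaps (True # w) = 0 # gaps w"
| "gaps (False # w) = Suc (hd (gaps w)) # tl (gaps w)"

fun ungaps :: "nat list \<Rightarrow> bool list" where
  "ungaps [] = []"
| "ungaps [p] = replicate p False"
| "ungaps (p # q # ps) = replicate p False @ True # ungaps (q # ps)"

lemma gaps_not_Nil [simp]: "gaps w \<noteq> []"
  by (induction w rule: gaps.induct) auto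

lemma ntrue_replicate_False [simp]: "ntrue (replicate i False) = 0"
  by (induction i) auto

lemma length_gaps [simp]: "length (gaps w) = Suc (ntrue w)"
  by (induction w rule: gaps.induct) auto

lemma gaps_replicate: "gaps (replicate p False @ w) = (p + hd (gaps w)) # tl (gaps w)"
  by (induction p) auto

lemma gaps_ungaps: "ps \<noteq> [] \<Longrightarrow> gaps (ungaps ps) = ps"
proof (induction ps rule: ungaps.induct)
  case (2 p)
  then show ?case using gaps_replicate[of p "[]"] by simp
qed (simp_all add: gaps_replicate)

lemma ungaps_Suc: "ungaps (Suc p # ps) = False # ungaps (p # ps)"
  by (cases ps) auto

lemma ungaps_gaps [simp]: "ungaps (gaps w) = w"
proof (induction w rule: gaps.induct)
  case (2 w)
  then show ?case by (cases "gaps w") auto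
next
  case (3 w)
  then show ?case by (cases "gaps w") (auto simp: ungaps_Suc)
qed auto

lemma ntrue_ungaps: "ps \<noteq> [] \<Longrightarrow> Suc (ntrue (ungaps ps)) = length ps"
  using length_gaps[of "ungaps ps"] by (simp add: gaps_ungaps del: length_gaps)

lemma gaps_append_True: "gaps (w @ True # v) = gaps w @ gaps v"
  by (induction w rule: gaps.induct) auto

lemma gap_run: "p \<in> set (gaps w) \<Longrightarrow> \<exists>u v. w = u @ replicate p False @ v"
proof (induction w)
  case (Cons b w)
  have start: "\<exists>v. w = replicate (hd (gaps w)) False @ v"
  proof -
    have "w = ungaps (gaps w)" by simp
    moreover have "\<exists>v. ungaps ps = replicate (hd ps) False @ v" if "ps \<noteq> []" for ps
      using that by (induction ps rule: ungaps.induct) auto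
    ultimately show ?thesis using gaps_not_Nil by metis
  qed
  show ?case
  proof (cases "b \<or> p \<in> set (tl (gaps w))")
    case True
    then have "p = 0 \<or> p \<in> set (gaps w)"
      using Cons.prems by (cases b) (auto dest: list.set_sel(2)[OF gaps_not_Nil])
    then show ?thesis
    proof
      assume "p = 0"
      then show ?thesis by (intro exI[of _ "[]"] exI[of _ "b # w"]) simp
    next
      assume "p \<in> set (gaps w)"
      then obtain u v where "w = u @ replicate p False @ v" using Cons.IH by blast
      then have "b # w = (b # u) @ replicate p False @ v" by simp
      then show ?thesis by blast
    qed
  next
    case False
    then have "p = Suc (hd (gaps w))" "\<not> b" using Cons.prems by auto
    moreover obtain v where "w = replicate (hd (gaps w)) False @ v" using start by blast
    ultimately have "b # w = [] @ replicate p False @ v" by simp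
    then show ?thesis by blast
  qed
qed simp

text \<open>
  The bound on the runs makes all sums finite. Bounding runs instead of the length of a word has the
  advantage that the bounded words with \<open>x + z + 1\<close> letters \<open>True\<close> correspond exactly to pairs of
  bounded words with \<open>x\<close> and \<open>z\<close> such letters (\<open>sum_words_True\<close>).
\<close>

definition small :: "nat \<Rightarrow> bool list \<Rightarrow> bool" where
  "small K w \<longleftrightarrow> set (gaps w) \<subseteq> {..K}"

definition words :: "nat \<Rightarrow> nat \<Rightarrow> bool list set" where
  "words t K = {w. ntrue w = t \<and> small K w}"

lemma bij_betw_gaps: "bij_betw gaps (words t K) {ps. length ps = Suc t \<and> set ps \<subseteq> {..K}}"
proof (rule bij_betw_byWitness[where f' = ungaps])
  have "ntrue (ungaps ps) = t" if "length ps = Suc t" for ps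
    using that ntrue_ungaps[of ps] by (cases ps) auto
  then show "ungaps ` {ps. length ps = Suc t \<and> set ps \<subseteq> {..K}} \<subseteq> words t K"
    by (auto simp: words_def small_def gaps_ungaps simp flip: length_greater_0_conv)
qed (auto simp: words_def small_def gaps_ungaps simp flip: length_greater_0_conv)

lemma finite_boxes [simp]: "finite {ps. length ps = t \<and> set ps \<subseteq> {..K::nat}}"
  using finite_lists_length_eq[of "{..K}" t] by (simp add: conj_commute)

lemma finite_words [simp]: "finite (words t K)"
  using bij_betw_finite[OF bij_betw_gaps] by simp

lemma not_small_run:
  assumes "\<not> small K w"
  shows "\<exists>u v. w = u @ replicate K False @ v"
proof -
  have "\<exists>p \<in> set (gaps w). K < p" using assms by (auto simp: small_def subset_iff not_le)
  then obtain p where p: "p \<in> set (gaps w)" "K \<le> p" by (auto intro: less_imp_le)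
  then obtain u v where "w = u @ replicate p False @ v" using gap_run by blast
  also have "replicate p False = replicate K False @ replicate (p - K) False"
    using p(2) by (simp flip: replicate_add)
  finally show ?thesis by auto
qed

lemma words_0: "words 0 K = (\<lambda>i. replicate i False) ` {..K}"
proof -
  have rep: "gaps (replicate i False) = [i]" for i using gaps_replicate[of i "[]"] by simp
  have "w = replicate (length w) False" if "ntrue w = 0" for w
    using that by (induction w) (auto split: if_splits)
  then have "w \<in> (\<lambda>i. replicate i False) ` {..K}" if "w \<in> words 0 K" for w
    using that rep[of "length w"] by (auto simp: words_def small_def)
  then show ?thesis by (auto simp: words_def small_def rep)
qed

lemma sum_boxes_append:
  "(\<Sum>ps \<in> {ps. length ps = m + n \<and> set ps \<subseteq> S}. f ps) =
   (\<Sum>ps \<in> {ps. length ps = m \<and> set ps \<subseteq> S}. \<Sum>qs \<in> {qs. length qs = n \<and> set qs \<subseteq> S}. f (ps @ qs))"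
  unfolding sum.cartesian_product
  by (rule sum.reindex_bij_witness[where i = "\<lambda>(ps, qs). ps @ qs"
        and j = "\<lambda>ps. (take m ps, drop m ps)"])
    (auto dest: in_set_takeD in_set_dropD)

lemma sum_words_True:
  "(\<Sum>w \<in> words (Suc (x + z)) K. f w) = (\<Sum>w \<in> words x K. \<Sum>v \<in> words z K. f (w @ True # v))"
proof -
  let ?S = "\<lambda>t. {ps. length ps = t \<and> set ps \<subseteq> {..K}}"
  have words: "(\<Sum>w \<in> words t K. g (gaps w)) = (\<Sum>ps \<in> ?S (Suc t). g ps)"
    for t and g :: "nat list \<Rightarrow> 'a"
    by (rule sum.reindex_bij_betw[OF bij_betw_gaps])
  have "(\<Sum>w \<in> words (Suc (x + z)) K. f w) = (\<Sum>ps \<in> ?S (Suc x + Suc z). f (ungaps ps))"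
    using words[of "\<lambda>ps. f (ungaps ps)" "Suc (x + z)"] by simp
  also have "\<dots> = (\<Sum>w \<in> words x K. \<Sum>v \<in> words z K. f (ungaps (gaps w @ gaps v)))"
    unfolding sum_boxes_append words[of _ x, symmetric] words[of _ z, symmetric] ..
  finally show ?thesis by (simp flip: gaps_append_True)
qed


section \<open>Inserting twisting matrices\<close>

text \<open>
  The list of matrices that a word describes. \<open>T\<close> is the current object, whose twisting matrix is
  inserted for the letter \<open>False\<close>; it is needed when \<open>Fs\<close> is empty. The third equation is a default
  value, as words are used only with as many letters \<open>True\<close> as there are morphisms.
\<close>

fun tword :: "('o, 'v) twobj \<Rightarrow> (('o, 'v) twobj, 'v matrix) arrow list \<Rightarrow> bool list \<Rightarrow>
    ('o list, 'v matrix) arrow list" where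
  "tword T Fs [] = []"
| "tword T Fs (False # w) = tw_arrow T # tword T Fs w"
| "tword T [] (True # w) = []"
| "tword T (F # Fs) (True # w) = mat_arrow F # tword (src F) Fs w"

definition final :: "('o, 'v) twobj \<Rightarrow> (('o, 'v) twobj, 'v matrix) arrow list \<Rightarrow> ('o, 'v) twobj" where
  "final T Fs = (if Fs = [] then T else src (last Fs))"

lemma final_simps [simp]: "final T [] = T" "final T (F # Fs) = final (src F) Fs"
  "final T (Fs @ Gs) = final (final T Fs) Gs"
  by (simp_all add: final_def)

lemma length_tword: "ntrue w = length Fs \<Longrightarrow> length (tword T Fs w) = length w"
  by (induction T Fs w rule: tword.induct) auto

lemma tword_append:
  "ntrue w = length X \<Longrightarrow> tword T (X @ Y) (w @ v) = tword T X w @ tword (final T X) Y v"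
  by (induction T X w rule: tword.induct) auto

lemma tword_replicate: "tword T Fs (replicate i False @ w) = replicate i (tw_arrow T) @ tword T Fs w"
  by (induction i) auto

lemma arrow_sel_tw [simp]:
  "src (tw_arrow T) = fst T" "tgt (tw_arrow T) = fst T" "deg (tw_arrow T) = 1"
  "val (tw_arrow T) = snd T" "sdeg (tw_arrow T) = 0"
  "src (mat_arrow F) = fst (src F)" "tgt (mat_arrow F) = fst (tgt F)" "deg (mat_arrow F) = deg F"
  "val (mat_arrow F) = val F" "sdeg (mat_arrow F) = sdeg F"
  by (simp_all add: tw_arrow_def mat_arrow_def sdeg_def)

lemma tdeg_tword: "ntrue w = length Fs \<Longrightarrow> tdeg (tword T Fs w) = tdeg Fs"
  by (induction T Fs w rule: tword.induct) auto

lemma tw_insert_gaps: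
  assumes "ntrue w = length Fs" "Fs \<noteq> []"
  shows "tw_insert Fs (gaps w) = tword (tgt (hd Fs)) Fs w"
proof -
  have "tword T Fs w = replicate (hd (gaps w)) (tw_arrow T) @
      concat (map2 (\<lambda>F p. mat_arrow F # replicate p (tw_arrow (src F))) Fs (tl (gaps w)))" for T
    using assms(1)
  proof (induction T Fs w rule: tword.induct)
    case (4 T F Fs w)
    then show ?case by (cases "gaps w") auto
  qed auto
  then show ?thesis by (simp add: tw_insert_def)
qed

text \<open>
  One run of twisting matrices in front of each morphism, that is, one run for each gap of the cyclic
  word. Lists of this form are closed under concatenation, hence under rotation.
\<close>

definition cyc_insert :: "(('o, 'v) twobj, 'v matrix) arrow list \<Rightarrow> nat list \<Rightarrow>
    ('o list, 'v matrix) arrow list" where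
  "cyc_insert Fs ps = concat (map2 (\<lambda>F p. replicate p (tw_arrow (tgt F)) @ [mat_arrow F]) Fs ps)"

lemma cyc_insert_append:
  "length us = length ps \<Longrightarrow> cyc_insert (us @ vs) (ps @ qs) = cyc_insert us ps @ cyc_insert vs qs"
  by (simp add: cyc_insert_def)

lemma tdeg_cyc_insert: "length us = length ps \<Longrightarrow> tdeg (cyc_insert us ps) = tdeg us"
  by (induction us ps rule: list_induct2) (auto simp: cyc_insert_def sum_list_replicate)


section \<open>The category of twisted objects\<close>

lemma tw_cat_simps:
  "Obj (tw_cat R D) = {T. is_arrow (mat_cat D) (tw_arrow T) \<and>
                 (\<forall>i j. snd T i j \<noteq> 0 \<longrightarrow> R i j) \<and> maurer_cartan D T}"
  "Hom (tw_cat R D) T T' d = Hom (mat_cat D) (fst T) (fst T') d"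
  "scal (tw_cat R D) = scal (mat_cat D)"
  "bop (tw_cat R D) Fs = Sum_any (\<lambda>ps.
          if length ps = length Fs + 1 then bop (mat_cat D) (tw_insert Fs ps) else 0)"
  by (simp_all add: tw_cat_def)

lemma is_arrow_mat_arrow:
  assumes "is_arrow (tw_cat R D) F" shows "is_arrow (mat_cat D) (mat_arrow F)"
proof -
  have "is_arrow (mat_cat D) (tw_arrow (src F))" "is_arrow (mat_cat D) (tw_arrow (tgt F))"
    using assms by (auto simp: is_arrow_def[of "tw_cat R D"] tw_cat_simps)
  then show ?thesis using assms by (simp add: is_arrow_def tw_cat_simps)
qed

lemma opposed_mat_arrow:
  "opposed (tw_cat R D) F G \<Longrightarrow> opposed (mat_cat D) (mat_arrow F) (mat_arrow G)"
  by (auto simp: opposed_def is_arrow_mat_arrow)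

text \<open>
  Composable lists of morphisms ending in the object \<open>T\<close>. The empty list is included, with a
  prescribed object, since pieces of a word may consist of twisting matrices only.
\<close>

definition chain :: "(nat \<Rightarrow> nat \<Rightarrow> bool) \<Rightarrow> ('o, 'v::ab_group_add, 'k) ainf \<Rightarrow> ('o, 'v) twobj \<Rightarrow>
    (('o, 'v) twobj, 'v matrix) arrow list \<Rightarrow> bool" where
  "chain R D T Fs \<longleftrightarrow> T \<in> Obj (tw_cat R D) \<and>
    (Fs = [] \<or> composable (tw_cat R D) Fs \<and> tgt (hd Fs) = T)"

lemma chain_Nil [simp]: "chain R D T [] \<longleftrightarrow> T \<in> Obj (tw_cat R D)"
  by (simp add: chain_def)

lemma chain_Cons [simp]:
  "chain R D T (F # Fs) \<longleftrightarrow> is_arrow (tw_cat R D) F \<and> tgt F = T \<and> chain R D (src F) Fs"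
  by (cases "Fs = []") (auto simp: chain_def composable_Cons is_arrow_def)

lemma chain_append: "chain R D T (X @ Y) \<longleftrightarrow> chain R D T X \<and> chain R D (final T X) Y"
proof (induction X arbitrary: T)
  case Nil
  then show ?case by (auto simp: chain_def)
qed auto

lemma composable_chain: "composable (tw_cat R D) Fs \<Longrightarrow> chain R D (tgt (hd Fs)) Fs"
  by (cases Fs) (auto simp: chain_def composable_def is_arrow_def)

lemma chain_composable: "chain R D T Fs \<Longrightarrow> Fs \<noteq> [] \<Longrightarrow> composable (tw_cat R D) Fs \<and> tgt (hd Fs) = T"
  by (simp add: chain_def)

lemma chain_final: "chain R D T Fs \<Longrightarrow> final T Fs \<in> Obj (tw_cat R D)"
  by (induction Fs arbitrary: T) auto

lemma is_arrow_tw_arrow: "T \<in> Obj (tw_cat R D) \<Longrightarrow> is_arrow (mat_cat D) (tw_arrow T)"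
  by (simp add: tw_cat_simps)

lemma composable_tword:
  assumes "chain R D T Fs" "ntrue w = length Fs" "w \<noteq> []"
  shows "composable (mat_cat D) (tword T Fs w) \<and> tgt (hd (tword T Fs w)) = fst T \<and>
    src (last (tword T Fs w)) = fst (final T Fs)"
  using assms
proof (induction T Fs w rule: tword.induct)
  case (2 T Fs w)
  have "length (tword T Fs w) = length w" using 2 by (intro length_tword) simp
  then show ?case
    using 2 is_arrow_tw_arrow[of T R D] chain_final[of R D T "[]"]
    by (cases "w = []") (auto simp: composable_Cons chain_def)
next
  case (4 T F Fs w)
  have "length (tword (src F) Fs w) = length w" using 4 by (intro length_tword) simp
  then show ?case
    using 4 is_arrow_mat_arrow by (cases "w = []") (auto simp: composable_Cons)
qed auto

text \<open>
  Compositions with a run of \<open>K\<close> or more copies of one twisting matrix vanish as soon as \<open>K\<close>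
  bounds the sizes of all objects.
\<close>

definition bounded :: "nat \<Rightarrow> ('o, 'v) twobj \<Rightarrow> (('o, 'v) twobj, 'v matrix) arrow list \<Rightarrow> bool" where
  "bounded K T Fs \<longleftrightarrow> length (fst T) \<le> K \<and> (\<forall>F \<in> set Fs. length (fst (src F)) \<le> K)"

lemma bounded_append: "bounded K T (X @ Y) \<longleftrightarrow> bounded K T X \<and> bounded K (final T X) Y"
  by (cases X rule: rev_cases) (auto simp: bounded_def)

lemma bounded_final: "bounded K T X \<Longrightarrow> length (fst (final T X)) \<le> K"
  using bounded_append[of K T X "[]"] by (simp add: bounded_def)

lemma bounded_mono: "bounded K T Fs \<Longrightarrow> K \<le> L \<Longrightarrow> bounded L T Fs"
  by (auto simp: bounded_def)

lemma bounded_exists: "\<exists>K. bounded K T Fs"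
proof -
  have "finite (length ` fst ` insert T (src ` set Fs))" by simp
  then obtain K where "\<forall>l \<in> length ` fst ` insert T (src ` set Fs). l \<le> K"
    by (metis finite_nat_set_iff_bounded_le)
  then show ?thesis by (intro exI[of _ K]) (auto simp: bounded_def)
qed

lemma tword_set: "ntrue w = length Fs \<Longrightarrow> mat_arrow ` set Fs \<subseteq> set (tword T Fs w)"
  by (induction T Fs w rule: tword.induct) auto

lemma barrow_tword:
  assumes "chain R C T Fs" "ntrue w = length Fs" "w \<noteq> []"
  shows "barrow (mat_cat C) (tword T Fs w) =
    Arrow (fst (final T Fs)) (fst T) (tdeg Fs + 2) (bop (mat_cat C) (tword T Fs w))"
proof -
  have "deg (barrow (mat_cat C) (tword T Fs w)) = tdeg Fs + 2"
    using tdeg_tword[OF assms(2)] by (simp only: deg_barrow)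
  then show ?thesis
    using composable_tword[OF assms] by (simp add: barrow_def)
qed

lemma mat_arrow_barrow:
  assumes "chain R C T Fs" "Fs \<noteq> []"
  shows "mat_arrow (barrow (tw_cat R C) Fs) =
    Arrow (fst (final T Fs)) (fst T) (tdeg Fs + 2) (bop (tw_cat R C) Fs)"
  using chain_composable[OF assms] assms(2)
  unfolding mat_arrow_def deg_barrow by (simp add: final_def)

lemma not_Nil_of_ntrue: "ntrue w = length Fs \<Longrightarrow> Fs \<noteq> [] \<Longrightarrow> w \<noteq> []"
  by auto

lemma fst_Obj: "T \<in> Obj (tw_cat R C) \<Longrightarrow> fst T \<in> Obj (mat_cat C)"
  using is_arrow_tw_arrow[of T R C] by (simp add: is_arrow_def)

locale twisting = ainf_cat C for C :: "('o, 'v::ab_group_add, 'k::field) ainf" +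
  fixes R :: "nat \<Rightarrow> nat \<Rightarrow> bool"
  assumes trans_R: "transp R" and irrefl_R: "irreflp R"
begin

sublocale mat: ainf_cat "mat_cat C"
  by unfold_locales (rule ainf_category_mat)

abbreviation "tw \<equiv> tw_cat R C"

text \<open>
  A path of indices through a run of \<open>N\<close> matrices visits \<open>N + 1\<close> indices of a tuple of length at
  most \<open>N\<close>. If all entries along it were allowed by \<open>R\<close>, these indices would be distinct.
\<close>

lemma long_run_zero:
  assumes c: "composable (mat_cat C) (X @ replicate N (tw_arrow T) @ Z)"
    and T: "T \<in> Obj tw" and N: "length (fst T) \<le> N"
  shows "bop (mat_cat C) (X @ replicate N (tw_arrow T) @ Z) = 0"
proof (intro ext)
  fix i j
  let ?L = "X @ replicate N (tw_arrow T) @ Z" and ?a = "length X"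
  have pos: "fst T \<noteq> []" using is_arrow_tw_arrow[OF T] by (auto simp: is_arrow_def mat_cat_simps)
  then have "N > 0" using N by (cases N) auto
  have nth: "?L ! (?a + r) = tw_arrow T" if "r < N" for r using that by (simp add: nth_append)
  have "bop C (path_arrows ?L ks) = 0" if ks: "ks \<in> index_paths ?L i j" for ks
  proof -
    define f where "f r = ks ! (?a + r)" for r
    have bound: "f r < length (fst T) \<and> f (Suc r) < length (fst T)" if "r < N" for r
    proof -
      have "?a + r < length ?L" using that by simp
      then have "ks ! (?a + r) < length (tgt (?L ! (?a + r))) \<and> ks ! Suc (?a + r) < length (src (?L ! (?a + r)))"
        using ks unfolding index_paths_def by blast
      then show ?thesis unfolding nth[OF that] by (simp add: f_def)
    qed
    have "\<exists>r<N. \<not> R (f r) (f (Suc r))"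
    proof (rule ccontr)
      assume "\<not> ?thesis"
      then have step: "R (f r) (f (Suc r))" if "r < N" for r using that by blast
      have less: "R (f a) (f b)" if "a < b" "b \<le> N" for a b
        using that
      proof (induction b)
        case (Suc b)
        then show ?case using step[of b] trans_R by (cases "a = b") (auto dest: transpD)
      qed simp
      have "inj_on f {..N}"
      proof (rule inj_onI)
        fix a b assume "a \<in> {..N}" "b \<in> {..N}" "f a = f b"
        then show "a = b"
          using less[of a b] less[of b a] irrefl_R by (metis atMost_iff irreflpD linorder_neqE_nat)
      qed
      moreover have "f ` {..N} \<subseteq> {..<length (fst T)}"
      proof
        fix y assume "y \<in> f ` {..N}"
        then obtain r where "y = f r" "r \<le> N" by auto
        then show "y \<in> {..<length (fst T)}"
          using bound[of r] bound[of "N - 1"] \<open>N > 0\<close> by (cases "r = N") auto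
      qed
      ultimately have "card {..N} \<le> card {..<length (fst T)}" by (intro card_inj_on_le) auto
      then show False using N by simp
    qed
    then obtain r where r: "r < N" "\<not> R (f r) (f (Suc r))" by blast
    then have "snd T (f r) (f (Suc r)) = 0" using T by (auto simp: tw_cat_simps)
    then have v: "val (path_arrows ?L ks ! (?a + r)) = 0"
      using nth[OF r(1)] r(1) by (simp add: path_arrows_def f_def)
    have "path_arrows ?L ks = take (?a + r) (path_arrows ?L ks) @ path_arrows ?L ks ! (?a + r) #
        drop (Suc (?a + r)) (path_arrows ?L ks)"
      using r(1) by (intro id_take_nth_drop) simp
    moreover have "composable C (path_arrows ?L ks)" using composable_path_arrows[OF c ks] by blast
    ultimately show ?thesis using bop_zero_val[OF _ v] by metis
  qed
  then show "bop (mat_cat C) ?L i j = 0 i j" by (simp add: mat_cat_simps)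
qed

lemma long_word_zero:
  assumes ch: "chain R C T Fs" and w: "ntrue w = length Fs" "\<not> small K w" and b: "bounded K T Fs"
    and c: "composable (mat_cat C) (X @ tword T Fs w @ Z)"
  shows "bop (mat_cat C) (X @ tword T Fs w @ Z) = 0"
proof -
  obtain u v where uv: "w = u @ replicate K False @ v" using not_small_run[OF w(2)] by blast
  define Us Vs where "Us = take (ntrue u) Fs" and "Vs = drop (ntrue u) Fs"
  have Fs: "Fs = Us @ Vs" by (simp add: Us_def Vs_def)
  have nu: "ntrue u = length Us" using w(1) uv by (simp add: Us_def)
  have eq: "tword T Fs w = tword T Us u @ replicate K (tw_arrow (final T Us)) @ tword (final T Us) Vs v"
    unfolding uv Fs by (simp add: tword_append[OF nu] tword_replicate)
  have "final T Us \<in> Obj tw" "length (fst (final T Us)) \<le> K"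
    using ch b by (auto simp: Fs chain_append bounded_append intro: chain_final bounded_final)
  then show ?thesis
    using long_run_zero[of "X @ tword T Us u" K "final T Us" "tword (final T Us) Vs v @ Z"] c
    by (simp add: eq)
qed

text \<open>
  Every sufficiently large bound on the runs gives the same finite sum. The bound can thus be chosen
  uniformly for all the compositions that occur in one relation.
\<close>

lemma bop_tw:
  assumes c: "composable tw Fs" and b: "bounded K (tgt (hd Fs)) Fs"
  shows "bop tw Fs = (\<Sum>w \<in> words (length Fs) K. bop (mat_cat C) (tword (tgt (hd Fs)) Fs w))"
proof -
  let ?T = "tgt (hd Fs)" and ?S = "{ps. length ps = Suc (length Fs) \<and> set ps \<subseteq> {..K}}"
  have ne: "Fs \<noteq> []" using c by (simp add: composable_def)
  have ch: "chain R C ?T Fs" using c by (rule composable_chain)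
  have zero: "bop (mat_cat C) (tw_insert Fs ps) = 0"
    if ps: "length ps = Suc (length Fs)" "\<not> set ps \<subseteq> {..K}" for ps
  proof -
    have g: "gaps (ungaps ps) = ps" using ps(1) by (intro gaps_ungaps) auto
    then have w: "ntrue (ungaps ps) = length Fs" "\<not> small K (ungaps ps)"
      using length_gaps[of "ungaps ps"] ps by (auto simp: small_def)
    then have "ungaps ps \<noteq> []" using ne by auto
    then have "composable (mat_cat C) ([] @ tword ?T Fs (ungaps ps) @ [])"
      using composable_tword[OF ch w(1)] by simp
    from long_word_zero[OF ch w b this] show ?thesis
      using tw_insert_gaps[OF w(1) ne] by (simp add: g)
  qed
  have "bop tw Fs = (\<Sum>ps \<in> ?S. if length ps = length Fs + 1 then bop (mat_cat C) (tw_insert Fs ps) else 0)"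
    unfolding tw_cat_simps by (rule Sum_any.expand_superset) (use zero in \<open>auto split: if_splits\<close>)
  also have "\<dots> = (\<Sum>ps \<in> ?S. bop (mat_cat C) (tw_insert Fs ps))" by (rule sum.cong) auto
  also have "\<dots> = (\<Sum>w \<in> words (length Fs) K. bop (mat_cat C) (tw_insert Fs (gaps w)))"
    by (rule sum.reindex_bij_betw[OF bij_betw_gaps, symmetric])
  also have "\<dots> = (\<Sum>w \<in> words (length Fs) K. bop (mat_cat C) (tword ?T Fs w))"
    by (rule sum.cong) (auto simp: words_def tw_insert_gaps ne)
  finally show ?thesis .
qed

lemma maurer_cartan_words:
  assumes T: "T \<in> Obj tw" and K: "length (fst T) \<le> K"
  shows "(\<Sum>w \<in> words 0 K - {[]}. bop (mat_cat C) (tword T [] w)) = 0"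
proof -
  let ?m = "\<lambda>i. bop (mat_cat C) (replicate i (tw_arrow T))"
  have zero: "?m i = 0" if "i > K" for i
  proof -
    have "composable (mat_cat C) ([] @ replicate i (tw_arrow T) @ [])"
      using composable_tword[of R C T "[]" "replicate i False"] T that tword_replicate[of T "[]" i "[]"]
      by simp
    from long_run_zero[OF this T] show ?thesis using K that by simp
  qed
  have "0 = Sum_any (\<lambda>i. if 1 \<le> i then ?m i else 0)"
    using T by (simp add: tw_cat_simps maurer_cartan_def)
  also have "\<dots> = (\<Sum>i \<in> {1..K}. if 1 \<le> i then ?m i else 0)"
    by (rule Sum_any.expand_superset) (use zero in \<open>auto simp: not_less[symmetric] split: if_splits\<close>)
  also have "\<dots> = (\<Sum>i \<in> {1..K}. ?m i)" by (rule sum.cong) auto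
  also have "\<dots> = (\<Sum>w \<in> (\<lambda>i. replicate i False) ` {1..K}. bop (mat_cat C) (tword T [] w))"
    using tword_replicate[of T "[]" _ "[]"]
    by (subst sum.reindex) (auto simp: inj_on_def dest: arg_cong[of _ _ length])
  also have "(\<lambda>i. replicate i False) ` {1..K} = words 0 K - {[]}"
    unfolding words_0 by (auto simp: image_iff)
  finally show ?thesis by (rule sym)
qed

lemma hom_tword:
  assumes "chain R C T Fs" "ntrue w = length Fs" "w \<noteq> []"
  shows "bop (mat_cat C) (tword T Fs w) \<in> Hom (mat_cat C) (fst (final T Fs)) (fst T) (tdeg Fs + 2)"
  using mat.is_arrow_barrow[of "tword T Fs w"] composable_tword[OF assms]
  unfolding barrow_tword[OF assms] by (simp add: is_arrow_def)

lemma is_arrow_barrow_tw: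
  assumes c: "composable tw Fs"
  shows "is_arrow tw (barrow tw Fs)"
proof -
  let ?T = "tgt (hd Fs)"
  have ne: "Fs \<noteq> []" using c by (simp add: composable_def)
  have ch: "chain R C ?T Fs" using c by (rule composable_chain)
  have obj: "?T \<in> Obj tw" "final ?T Fs \<in> Obj tw"
    using ch chain_final[OF ch] by (auto simp: chain_def)
  then have obj': "fst ?T \<in> Obj (mat_cat C)" "fst (final ?T Fs) \<in> Obj (mat_cat C)"
    by (auto intro: fst_Obj)
  obtain K where K: "bounded K ?T Fs" using bounded_exists by blast
  have "bop tw Fs \<in> Hom (mat_cat C) (fst (final ?T Fs)) (fst ?T) (tdeg Fs + 2)"
    unfolding bop_tw[OF c K]
    by (rule mat.hom_sum) (use obj' hom_tword[OF ch] not_Nil_of_ntrue[OF _ ne] in \<open>auto simp: words_def\<close>)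
  then show ?thesis
    using obj ne unfolding is_arrow_def deg_barrow by (simp add: tw_cat_simps(2) final_def)
qed

lemma bop_tw_insert:
  assumes c: "composable tw (X @ F # Z)" and T: "T = tgt (hd (X @ F # Z))"
    and K: "bounded K T (X @ F # Z)"
  shows "bop tw (X @ F # Z) = (\<Sum>w \<in> words (length X) K. \<Sum>v \<in> words (length Z) K.
    bop (mat_cat C) (tword T X w @ mat_arrow F # tword (src F) Z v))"
proof -
  have "bop tw (X @ F # Z) = (\<Sum>w \<in> words (length X) K. \<Sum>v \<in> words (length Z) K.
      bop (mat_cat C) (tword T (X @ F # Z) (w @ True # v)))"
    using bop_tw[OF c, of K] K sum_words_True[where f = "\<lambda>w. bop (mat_cat C) (tword T (X @ F # Z) w)"
        and x = "length X" and z = "length Z" and K = K] by (simp add: T)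
  also have "\<dots> = (\<Sum>w \<in> words (length X) K. \<Sum>v \<in> words (length Z) K.
      bop (mat_cat C) (tword T X w @ mat_arrow F # tword (src F) Z v))"
    by (intro sum.cong refl) (auto simp: words_def tword_append)
  finally show ?thesis .
qed

lemma composable_tword_insert:
  assumes c: "composable tw (X @ F # Z)" and T: "T = tgt (hd (X @ F # Z))"
    and w: "ntrue w = length X" "ntrue v = length Z"
  shows "composable (mat_cat C) (tword T X w @ mat_arrow F # tword (src F) Z v)"
proof -
  have "tword T (X @ F # Z) (w @ True # v) = tword T X w @ mat_arrow F # tword (src F) Z v"
    using w by (simp add: tword_append)
  then show ?thesis
    using composable_tword[OF composable_chain[OF c], of "w @ True # v"] w by (simp add: T)
qed

lemma multilinear_tw: "multilinear_ops tw"
  unfolding multilinear_ops_def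
proof (intro allI impI)
  fix us x y d v w c vs
  assume a: "composable tw (us @ Arrow x y d v # vs)" "w \<in> Hom tw x y d"
  let ?F = "\<lambda>u. us @ Arrow x y d u # vs"
  define T where "T = tgt (hd (?F v))"
  have hd: "T = tgt (hd (?F u))" for u by (cases us) (auto simp: T_def)
  obtain K where "bounded K T (?F v)" using bounded_exists by blast
  then have K: "bounded K T (?F u)" for u by (simp add: bounded_def)
  have v: "v \<in> Hom tw x y d" and xy: "x \<in> Obj tw" "y \<in> Obj tw"
    using a(1) by (auto simp: composable_def is_arrow_def)
  have obj': "fst x \<in> Obj (mat_cat C)" "fst y \<in> Obj (mat_cat C)"
    using xy by (auto intro: fst_Obj)
  have comp: "composable tw (?F u)" if "u \<in> Hom tw x y d" for u
    using composable_replace[of tw us "[Arrow x y d v]" vs "Arrow x y d u"] a(1) xy that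
    by (simp add: is_arrow_def)
  have sum: "scal tw c v + w \<in> Hom tw x y d"
    using v a(2) obj' by (simp add: tw_cat_simps mat.hom_add mat.hom_scale)
  let ?G = "\<lambda>u p q. bop (mat_cat C) (tword T us p @ Arrow (fst x) (fst y) d u # tword x vs q)"
  have expand: "bop tw (?F u) = (\<Sum>p \<in> words (length us) K. \<Sum>q \<in> words (length vs) K. ?G u p q)"
    if "u \<in> Hom tw x y d" for u
    using bop_tw_insert[OF comp[OF that] hd K] by (simp add: mat_arrow_def)
  have key: "?G (scal tw c v + w) p q = scal tw c (?G v p q) + ?G w p q"
    if "p \<in> words (length us) K" "q \<in> words (length vs) K" for p q
    using mat.bop_linear[of "tword T us p" "fst x" "fst y" d v "tword x vs q" w c] a(2)
      composable_tword_insert[OF a(1) hd, of p q] that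
    by (simp add: words_def tw_cat_simps mat_arrow_def)
  show "bop tw (?F (scal tw c v + w)) = scal tw c (bop tw (?F v)) + bop tw (?F w)"
    unfolding expand[OF sum] expand[OF v] expand[OF a(2)]
    by (simp add: key) (simp add: tw_cat_simps(3) mat.scale_sum_right sum.distrib)
qed

text \<open>
  A word for \<open>X @ barrow tw Y # Z\<close> consists of a word for \<open>X\<close>, the composition, and a word for
  \<open>Z\<close>; the entry in the middle is itself a sum over words for \<open>Y\<close>.
\<close>

lemma tw_term:
  assumes ch: "chain R C T (X @ Y @ Z)" and Y: "Y \<noteq> []" and K: "bounded K T (X @ Y @ Z)"
  shows "(\<Sum>w \<in> words (length X) K. \<Sum>p \<in> words (length Y) K - {[]}. \<Sum>v \<in> words (length Z) K.
      bop (mat_cat C) (tword T X w @ barrow (mat_cat C) (tword (final T X) Y p) #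
        tword (final T (X @ Y)) Z v)) =
    bop tw (X @ barrow tw Y # Z)"
proof -
  let ?B = "barrow tw Y" and ?S = "final T X"
  have c: "composable tw (X @ Y @ Z)" and T: "tgt (hd (X @ Y @ Z)) = T"
    using chain_composable[OF ch] Y by auto
  have chY: "chain R C ?S Y" using ch by (simp add: chain_append)
  then have hdY: "tgt (hd Y) = ?S" using Y chain_composable by blast
  have B: "is_arrow tw ?B" using c Y by (intro is_arrow_barrow_tw) (rule composable_middle)
  have cB: "composable tw (X @ ?B # Z)"
    by (rule composable_replace[OF c Y B]) auto
  have TB: "T = tgt (hd (X @ ?B # Z))" using T Y by (cases X) auto
  have srcB: "src ?B = final T (X @ Y)" using Y by (simp add: final_def)
  have "length (fst (src ?B)) \<le> K"
    unfolding srcB using K bounded_append[of K T "X @ Y" Z] bounded_final[of K T "X @ Y"] by simp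
  then have KB: "bounded K T (X @ ?B # Z)" using K by (auto simp: bounded_def)
  have KY: "bounded K (tgt (hd Y)) Y" using K hdY by (simp add: bounded_append)
  have cY: "composable tw Y" using c Y by (rule composable_middle)
  have ne: "words (length Y) K - {[]} = words (length Y) K" using Y by (auto simp: words_def)
  have "bop (mat_cat C) (tword T X w @ mat_arrow ?B # tword (src ?B) Z v) =
      (\<Sum>p \<in> words (length Y) K. bop (mat_cat C)
        (tword T X w @ barrow (mat_cat C) (tword ?S Y p) # tword (final T (X @ Y)) Z v))"
    if wv: "w \<in> words (length X) K" "v \<in> words (length Z) K" for w v
  proof -
    have "composable (mat_cat C) (tword T X w @ mat_arrow ?B # tword (src ?B) Z v)"
      using wv by (intro composable_tword_insert[OF cB TB]) (auto simp: words_def)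
    moreover have "bop (mat_cat C) (tword ?S Y p) \<in> Hom (mat_cat C) (fst (final ?S Y)) (fst ?S) (tdeg Y + 2)"
      if "p \<in> words (length Y) K" for p
      using that Y by (intro hom_tword[OF chY]) (auto simp: words_def)
    moreover have "barrow (mat_cat C) (tword ?S Y p) =
        Arrow (fst (final ?S Y)) (fst ?S) (tdeg Y + 2) (bop (mat_cat C) (tword ?S Y p))"
      if "p \<in> words (length Y) K" for p
      using that Y by (intro barrow_tword[OF chY]) (auto simp: words_def)
    ultimately show ?thesis
      unfolding mat_arrow_barrow[OF chY Y] bop_tw[OF cY KY] hdY srcB
      by (subst mat.bop_sum) auto
  qed
  then have "bop tw (X @ ?B # Z) = (\<Sum>w \<in> words (length X) K. \<Sum>v \<in> words (length Z) K.
      \<Sum>p \<in> words (length Y) K. bop (mat_cat C)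
        (tword T X w @ barrow (mat_cat C) (tword ?S Y p) # tword (final T (X @ Y)) Z v))"
    unfolding bop_tw_insert[OF cB TB KB] by (intro sum.cong refl)
  also have "\<dots> = (\<Sum>w \<in> words (length X) K. \<Sum>p \<in> words (length Y) K. \<Sum>v \<in> words (length Z) K.
      bop (mat_cat C)
        (tword T X w @ barrow (mat_cat C) (tword ?S Y p) # tword (final T (X @ Y)) Z v))"
    by (rule sum.cong[OF refl], rule sum.swap)
  finally show ?thesis unfolding ne by simp
qed

text \<open>
  The middle piece is a run of twisting matrices of one object, and its length varies freely.
\<close>

lemma maurer_cartan_term:
  assumes ch: "chain R C T (X @ Z)" and K: "bounded K T (X @ Z)"
  shows "(\<Sum>w \<in> words (length X) K. \<Sum>p \<in> words 0 K - {[]}. \<Sum>v \<in> words (length Z) K.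
      bop (mat_cat C) (tword T X w @ barrow (mat_cat C) (tword (final T X) [] p) #
        tword (final T X) Z v)) = 0"
proof -
  let ?S = "final T X"
  have chS: "chain R C ?S []" using ch by (simp add: chain_append chain_final)
  then have S: "?S \<in> Obj tw" by simp
  have KS: "length (fst ?S) \<le> K" using K by (simp add: bounded_append bounded_final)
  have "(\<Sum>p \<in> words 0 K - {[]}. bop (mat_cat C) (tword T X w @ barrow (mat_cat C) (tword ?S [] p) #
      tword ?S Z v)) = 0"
    if wv: "w \<in> words (length X) K" "v \<in> words (length Z) K" for w v
  proof -
    have "tword T (X @ Z) (w @ False # v) = tword T X w @ [tw_arrow ?S] @ tword ?S Z v"
      using wv by (simp add: words_def tword_append)
    then have "composable (mat_cat C) (tword T X w @ [tw_arrow ?S] @ tword ?S Z v)"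
      using composable_tword[OF ch, of "w @ False # v"] wv by (simp add: words_def)
    then have c: "composable (mat_cat C) (tword T X w @ barrow (mat_cat C) [tw_arrow ?S] # tword ?S Z v)"
      by (intro mat.composable_barrow) auto
    \<comment> \<open>The degree \<open>2\<close> is written as for a word without morphisms.\<close>
    have "barrow (mat_cat C) [tw_arrow ?S] =
        Arrow (fst ?S) (fst ?S) (tdeg ([] :: (('o, 'v) twobj, 'v matrix) arrow list) + 2)
          (bop (mat_cat C) [tw_arrow ?S])"
      by (simp add: barrow_def)
    note c = c[unfolded this]
    have eq: "barrow (mat_cat C) (tword ?S [] p) =
        Arrow (fst ?S) (fst ?S) (tdeg ([] :: (('o, 'v) twobj, 'v matrix) arrow list) + 2)
          (bop (mat_cat C) (tword ?S [] p))"
      and hom: "bop (mat_cat C) (tword ?S [] p) \<in> Hom (mat_cat C) (fst ?S) (fst ?S)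
        (tdeg ([] :: (('o, 'v) twobj, 'v matrix) arrow list) + 2)"
      if "p \<in> words 0 K - {[]}" for p
      using that barrow_tword[OF chS, of p] hom_tword[OF chS, of p] by (auto simp: words_def)
    have "(\<Sum>p \<in> words 0 K - {[]}. bop (mat_cat C) (tword T X w @ barrow (mat_cat C) (tword ?S [] p) #
        tword ?S Z v)) =
      bop (mat_cat C) (tword T X w @ Arrow (fst ?S) (fst ?S)
        (tdeg ([] :: (('o, 'v) twobj, 'v matrix) arrow list) + 2)
        (\<Sum>p \<in> words 0 K - {[]}. bop (mat_cat C) (tword ?S [] p)) # tword ?S Z v)"
      by (subst mat.bop_sum[OF c hom]) (auto intro!: sum.cong simp: eq simp del: barrow_sel)
    also have "\<dots> = 0"
      by (simp only: maurer_cartan_words[OF S KS] mat.bop_zero[OF c])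
    finally show ?thesis .
  qed
  then have "(\<Sum>w \<in> words (length X) K. \<Sum>v \<in> words (length Z) K. \<Sum>p \<in> words 0 K - {[]}.
      bop (mat_cat C) (tword T X w @ barrow (mat_cat C) (tword ?S [] p) # tword ?S Z v)) = 0"
    by simp
  moreover have "(\<Sum>p \<in> words 0 K - {[]}. \<Sum>v \<in> words (length Z) K. g p v) =
      (\<Sum>v \<in> words (length Z) K. \<Sum>p \<in> words 0 K - {[]}. g p v)"
    for g :: "bool list \<Rightarrow> bool list \<Rightarrow> 'v matrix"
    by (rule sum.swap)
  ultimately show ?thesis by simp
qed

text \<open>
  The sum of the matrix relations over a finite set of words is rearranged by the three pieces
  \<open>(w, p, v)\<close> of the word. The set \<open>box\<close> consists of all triples with short runs in each piece. The
  words are those which arise by concatenating such triples. If such a word is cut into a triple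
  outside \<open>box\<close>, then some piece has a run of more than \<open>K\<close> twisting matrices and the term
  vanishes. In \<open>box\<close> the pieces vary independently once the numbers \<open>x\<close>, \<open>y\<close> of morphisms
  in \<open>w\<close> and \<open>p\<close> are fixed.
\<close>

lemma ainf_relations_tw: "ainf_relations tw"
  unfolding ainf_relations_def
proof (intro allI impI)
  fix Fs assume c: "composable tw Fs"
  define T where "T = tgt (hd Fs)"
  define t where "t = length Fs"
  have ch: "chain R C T Fs" unfolding T_def using c by (rule composable_chain)
  have ne: "Fs \<noteq> []" using c by (simp add: composable_def)
  obtain K where K: "bounded K T Fs" using bounded_exists by blast
  define pcs where "pcs x y = (take x Fs, take y (drop x Fs), drop (x + y) Fs)" for x y
  define H where "H = (\<lambda>x y w p v. case pcs x y of (X, Y, Z) \<Rightarrow>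
    signed (tdeg X) (bop (mat_cat C)
      (tword T X w @ barrow (mat_cat C) (tword (final T X) Y p) # tword (final T (X @ Y)) Z v)))"
  define A where "A = (\<lambda>(x, y). words x K \<times> (words y K - {[]}) \<times> words (t - (x + y)) K)"
  define J where "J = {(x, y). x + y \<le> t}"
  have finJ: "finite J"
    by (rule finite_subset[of _ "{..t} \<times> {..t}"]) (auto simp: J_def)
  define box where "box = (\<Union>q \<in> J. A q)"
  define h where "h = (\<lambda>(w, p, v). H (ntrue w) (ntrue p) w p v)"
  have fin_box: "finite box" unfolding box_def by (rule finite_UN_I[OF finJ]) (auto simp: A_def)
  define S where "S = (\<lambda>(w, p, v). w @ p @ v) ` box"
  have finS: "finite S" unfolding S_def using fin_box by simp
  have S_t: "ntrue w = t" if "w \<in> S" for w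
    using that by (auto simp: S_def box_def J_def A_def words_def)
  have pieces: "\<exists>X Y Z. pcs (ntrue w) (ntrue p) = (X, Y, Z) \<and> X @ Y @ Z = Fs \<and>
      ntrue w = length X \<and> ntrue p = length Y \<and> ntrue v = length Z"
    if "ntrue (w @ p @ v) = t" for w p v
  proof -
    have "take (ntrue w) Fs @ take (ntrue p) (drop (ntrue w) Fs) @ drop (ntrue w + ntrue p) Fs = Fs"
      by (rule append_three_pieces)
    then show ?thesis using that by (auto simp: pcs_def t_def)
  qed
  have rel: "(\<Sum>q \<in> splits w. h q) = 0" if w: "w \<in> S" for w
  proof -
    have nt: "ntrue w = length Fs" using S_t[OF w] by (simp add: t_def)
    let ?L = "tword T Fs w"
    have len: "length ?L = length w" using nt by (rule length_tword)
    have "w \<noteq> []" using nt ne by (rule not_Nil_of_ntrue)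
    then have comp: "composable (mat_cat C) ?L" using composable_tword[OF ch nt] by blast
    let ?g = "\<lambda>X Y Z. signed (tdeg X) (bop (mat_cat C) (X @ barrow (mat_cat C) Y # Z))"
    have "(\<Sum>(u, p, v) \<in> splits w. h (u, p, v)) = (\<Sum>(u, p, v) \<in> splits w.
        ?g (take (length u) ?L) (take (length p) (drop (length u) ?L)) (drop (length u + length p) ?L))"
    proof (rule sum_splits_cong)
      fix u p v assume uv: "u @ p @ v = w" "p \<noteq> []"
      then obtain X Y Z where XYZ: "pcs (ntrue u) (ntrue p) = (X, Y, Z)" "X @ Y @ Z = Fs"
        "ntrue u = length X" "ntrue p = length Y" "ntrue v = length Z"
        using pieces[of u p v] nt by (auto simp: t_def)
      have "?L = tword T X u @ tword (final T X) Y p @ tword (final T (X @ Y)) Z v"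
        using XYZ by (simp add: tword_append flip: uv(1) XYZ(2))
      moreover have "length (tword T X u) = length u" "length (tword (final T X) Y p) = length p"
        using XYZ by (simp_all add: length_tword)
      moreover have "tdeg (tword T X u) = tdeg X" using XYZ(3) by (rule tdeg_tword)
      ultimately show "h (u, p, v) =
          ?g (take (length u) ?L) (take (length p) (drop (length u) ?L)) (drop (length u + length p) ?L)"
        by (simp add: h_def H_def XYZ(1))
    qed
    also have "\<dots> = (\<Sum>(a, l) \<in> {(a, l). 1 \<le> l \<and> a + l \<le> length ?L}.
        ?g (take a ?L) (take l (drop a ?L)) (drop (a + l) ?L))"
      unfolding len sum_splits[symmetric, where fs = w] by (rule sum.cong) auto
    also have "\<dots> = 0" using mat.relations[OF comp] unfolding sum_splits[symmetric] .
    finally show ?thesis by (simp add: case_prod_beta)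
  qed
  let ?Sp = "\<Union>w \<in> S. splits w"
  have "0 = (\<Sum>w \<in> S. \<Sum>q \<in> splits w. h q)" by (simp add: rel)
  also have "\<dots> = (\<Sum>q \<in> ?Sp. h q)"
    by (rule sum.UNION_disjoint[symmetric], rule finS, simp) (auto simp: splits_def)
  also have "\<dots> = (\<Sum>q \<in> box. h q)"
  proof (rule sum.mono_neutral_right)
    show "finite ?Sp" using finS by simp
    show "box \<subseteq> ?Sp"
      by (auto simp: S_def splits_def box_def A_def intro!: bexI)
    show "\<forall>q \<in> ?Sp - box. h q = 0"
    proof
      fix q assume q: "q \<in> ?Sp - box"
      obtain w p v where q_eq: "q = (w, p, v)" by (cases q)
      with q have wpv: "w @ p @ v \<in> S" "p \<noteq> []" by (auto simp: splits_def)
      have nt: "ntrue (w @ p @ v) = t" using S_t[OF wpv(1)] .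
      then obtain X Y Z where XYZ: "pcs (ntrue w) (ntrue p) = (X, Y, Z)" "X @ Y @ Z = Fs"
        "ntrue w = length X" "ntrue p = length Y" "ntrue v = length Z"
        using pieces by blast
      have big: "\<not> small K w \<or> \<not> small K p \<or> \<not> small K v"
      proof (rule ccontr)
        assume "\<not> ?thesis"
        then have "(w, p, v) \<in> A (ntrue w, ntrue p)" "(ntrue w, ntrue p) \<in> J"
          using nt wpv(2) by (auto simp: A_def words_def J_def)
        then show False using q q_eq unfolding box_def by blast
      qed
      let ?X = "tword T X w" and ?Y = "tword (final T X) Y p" and ?Z = "tword (final T (X @ Y)) Z v"
      have chs: "chain R C T X" "chain R C (final T X) Y" "chain R C (final T (X @ Y)) Z"
        using ch by (simp_all add: chain_append flip: XYZ(2))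
      have Ks: "bounded K T X" "bounded K (final T X) Y" "bounded K (final T (X @ Y)) Z"
        using K by (simp_all add: bounded_append flip: XYZ(2))
      have "tword T Fs (w @ p @ v) = ?X @ ?Y @ ?Z"
        using XYZ by (simp add: tword_append flip: XYZ(2))
      then have comp: "composable (mat_cat C) (?X @ ?Y @ ?Z)"
        using composable_tword[OF ch, of "w @ p @ v"] nt wpv(2) by (simp add: t_def)
      have "length ?Y = length p" using XYZ(4) by (rule length_tword)
      then have Yne: "?Y \<noteq> []" using wpv(2) by auto
      have compB: "composable (mat_cat C) (?X @ barrow (mat_cat C) ?Y # ?Z)"
        using comp Yne by (rule mat.composable_barrow)
      have "bop (mat_cat C) (?X @ barrow (mat_cat C) ?Y # ?Z) = 0"
        using big
      proof (elim disjE)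
        assume "\<not> small K w"
        then show ?thesis
          using long_word_zero[OF chs(1) XYZ(3) _ Ks(1), of "[]" "barrow (mat_cat C) ?Y # ?Z"] compB by simp
      next
        assume "\<not> small K p"
        then have "bop (mat_cat C) ?Y = 0"
          using long_word_zero[OF chs(2) XYZ(4) _ Ks(2), of "[]" "[]"] composable_middle[OF comp Yne]
          by simp
        then show ?thesis using mat.bop_zero_val[OF compB] by simp
      next
        assume "\<not> small K v"
        then show ?thesis
          using long_word_zero[OF chs(3) XYZ(5) _ Ks(3), of "?X @ [barrow (mat_cat C) ?Y]" "[]"] compB
          by simp
      qed
      then show "h q = 0" by (simp add: q_eq h_def H_def XYZ(1))
    qed
  qed
  also have "\<dots> = (\<Sum>q \<in> J. \<Sum>r \<in> A q. h r)"
    unfolding box_def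
  proof (rule sum.UNION_disjoint[OF finJ])
    show "\<forall>q \<in> J. finite (A q)" by (auto simp: A_def)
  qed (auto simp: A_def words_def)
  also have "\<dots> = (\<Sum>(x, y) \<in> J. \<Sum>w \<in> words x K. \<Sum>p \<in> words y K - {[]}. \<Sum>v \<in> words (t - (x + y)) K.
      H x y w p v)"
  proof (rule sum.cong[OF refl])
    fix q assume "q \<in> J"
    obtain x y where q: "q = (x, y)" by (cases q)
    have "(\<Sum>r \<in> A q. h r) = (\<Sum>(w, p, v) \<in> A q. H x y w p v)"
      by (rule sum.cong) (auto simp: q A_def h_def words_def)
    then show "(\<Sum>r \<in> A q. h r) = (case q of (x, y) \<Rightarrow> \<Sum>w \<in> words x K. \<Sum>p \<in> words y K - {[]}.
        \<Sum>v \<in> words (t - (x + y)) K. H x y w p v)"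
      by (simp add: q A_def sum.cartesian_product)
  qed
  also have "\<dots> = (\<Sum>(x, y) \<in> J. if y = 0 then 0 else signed (tdeg (take x Fs))
      (bop tw (take x Fs @ [barrow tw (take y (drop x Fs))] @ drop (x + y) Fs)))"
  proof (rule sum.cong[OF refl], clarify)
    fix x y assume "(x, y) \<in> J"
    then have xy: "x + y \<le> t" by (simp add: J_def)
    define X Y Z where "X = take x Fs" and "Y = take y (drop x Fs)" and "Z = drop (x + y) Fs"
    have XYZ: "X @ Y @ Z = Fs" unfolding X_def Y_def Z_def by (rule append_three_pieces)
    have len: "length X = x" "length Y = y" "length Z = t - (x + y)"
      using xy by (auto simp: X_def Y_def Z_def t_def)
    have pcs: "pcs x y = (X, Y, Z)" by (simp add: pcs_def X_def Y_def Z_def)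
    have eq: "(\<Sum>w \<in> words x K. \<Sum>p \<in> words y K - {[]}. \<Sum>v \<in> words (t - (x + y)) K. H x y w p v) =
      signed (tdeg X) (\<Sum>w \<in> words (length X) K. \<Sum>p \<in> words (length Y) K - {[]}. \<Sum>v \<in> words (length Z) K.
      bop (mat_cat C) (tword T X w @ barrow (mat_cat C) (tword (final T X) Y p) #
        tword (final T (X @ Y)) Z v))"
      unfolding H_def pcs len signed_sum by simp
    show "(\<Sum>w \<in> words x K. \<Sum>p \<in> words y K - {[]}. \<Sum>v \<in> words (t - (x + y)) K. H x y w p v) =
        (if y = 0 then 0 else signed (tdeg (take x Fs))
          (bop tw (take x Fs @ [barrow tw (take y (drop x Fs))] @ drop (x + y) Fs)))"
    proof (cases "y = 0")
      case True
      then have "Y = []" using len by simp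
      then show ?thesis
        using maurer_cartan_term[of T X Z K] ch K XYZ True unfolding eq by simp
    next
      case False
      then have "Y \<noteq> []" using len by auto
      then show ?thesis
        using tw_term[of T X Y Z K] ch K XYZ False unfolding eq by (simp add: X_def Y_def Z_def)
    qed
  qed
  also have "\<dots> = (\<Sum>(x, y) \<in> {(x, y). 1 \<le> y \<and> x + y \<le> length Fs}. signed (tdeg (take x Fs))
      (bop tw (take x Fs @ [barrow tw (take y (drop x Fs))] @ drop (x + y) Fs)))"
    by (rule sum.mono_neutral_cong_right[OF finJ]) (auto simp: J_def t_def split: if_splits)
  finally show "(\<Sum>(a, l) \<in> {(a, l). 1 \<le> l \<and> a + l \<le> length Fs}. signed (tdeg (take a Fs))
      (bop tw (take a Fs @ [barrow tw (take l (drop a Fs))] @ drop (a + l) Fs))) = 0"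
    by (rule sym)
qed

text \<open>
  Inserting twisting matrices next to a unit gives lists of length different from two, where the
  matrix operations vanish. The exception is a single unit with one twisting matrix \<open>A\<close> on either
  side: these two terms are \<open>A\<close> and \<open>-A\<close>.
\<close>

lemma strict_unit_tw:
  assumes T: "T \<in> Obj tw" and e: "strict_unit (mat_cat C) (fst T) e"
  shows "strict_unit tw T e"
proof -
  let ?E = "Arrow T T 0 e" and ?M = "Arrow (fst T) (fst T) 0 e"
  have M: "mat_arrow ?E = ?M" by (simp add: mat_arrow_def)
  have E: "is_arrow tw ?E"
    using T e by (simp add: is_arrow_def strict_unit_def tw_cat_simps(2))
  have zero: "bop (mat_cat C) (tword S Fs w) = 0"
    if "chain R C S Fs" "ntrue w = length Fs" "?E \<in> set Fs" "length w \<noteq> 2" for S Fs w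
  proof -
    have "w \<noteq> []" using that by auto
    then have "composable (mat_cat C) (tword S Fs w)" using composable_tword that by blast
    moreover have "?M \<in> set (tword S Fs w)" using tword_set[OF that(2), of S] that(3) M by force
    moreover have "length (tword S Fs w) \<noteq> 2" using that length_tword by metis
    ultimately show ?thesis using e unfolding strict_unit_def by blast
  qed
  have two: "bop tw Fs = bop (mat_cat C) (tword (tgt (hd Fs)) Fs [True, True])"
    if c: "composable tw Fs" and len: "length Fs = 2" and EF: "?E \<in> set Fs" for Fs
  proof -
    obtain K where K: "bounded K (tgt (hd Fs)) Fs" using bounded_exists by blast
    have "w = [True, True]" if "ntrue w = 2" "length w = 2" for w
      using that by (auto simp: length_Suc_conv numeral_2_eq_2 split: if_splits)
    moreover have "[True, True] \<in> words 2 K" by (simp add: words_def small_def)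
    ultimately have "(\<Sum>w \<in> words 2 K. bop (mat_cat C) (tword (tgt (hd Fs)) Fs w)) =
        (\<Sum>w \<in> {[True, True]}. bop (mat_cat C) (tword (tgt (hd Fs)) Fs w))"
      using zero[OF composable_chain[OF c] _ EF] len
      by (intro sum.mono_neutral_right finite_words) (auto simp: words_def)
    then show ?thesis using bop_tw[OF c K] len by simp
  qed
  show ?thesis
    unfolding strict_unit_def
  proof (intro conjI allI impI)
    show "e \<in> Hom tw T T 0" using E by (simp add: is_arrow_def)
  next
    fix F assume F: "is_arrow tw F \<and> tgt F = T"
    then have "bop tw [?E, F] = bop (mat_cat C) [?M, mat_arrow F]"
      using two[of "[?E, F]"] E by (simp add: composable_Cons M)
    then show "bop tw [?E, F] = val F"
      using e F is_arrow_mat_arrow[of R C F] unfolding strict_unit_def by simp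
  next
    fix F assume F: "is_arrow tw F \<and> src F = T"
    then have "bop tw [F, ?E] = bop (mat_cat C) [mat_arrow F, ?M]"
      using two[of "[F, ?E]"] E by (simp add: composable_Cons M)
    then show "bop tw [F, ?E] = signed (deg F) (val F)"
      using e F is_arrow_mat_arrow[of R C F] unfolding strict_unit_def by simp
  next
    fix Fs assume Fs: "composable tw Fs \<and> length Fs \<noteq> 2 \<and> ?E \<in> set Fs"
    then have c: "composable tw Fs" by simp
    let ?T = "tgt (hd Fs)"
    obtain K where K: "bounded K ?T Fs" using bounded_exists by blast
    show "bop tw Fs = 0"
    proof (cases "length Fs = 1")
      case True
      then have FE: "Fs = [?E]" using Fs by (cases Fs) auto
      have "fst T \<noteq> []" using is_arrow_tw_arrow[OF T] by (auto simp: is_arrow_def mat_cat_simps)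
      then have "1 \<le> K" using K FE by (cases "fst T") (auto simp: bounded_def)
      then have sub: "{[True, False], [False, True]} \<subseteq> words 1 K"
        by (auto simp: words_def small_def)
      have "w = [True, False] \<or> w = [False, True]" if "ntrue w = 1" "length w = 2" for w
        using that by (auto simp: length_Suc_conv numeral_2_eq_2 split: if_splits)
      then have "(\<Sum>w \<in> words 1 K. bop (mat_cat C) (tword ?T Fs w)) =
          (\<Sum>w \<in> {[True, False], [False, True]}. bop (mat_cat C) (tword ?T Fs w))"
        using zero[OF composable_chain[OF c]] FE sub
        by (intro sum.mono_neutral_right finite_words) (auto simp: words_def)
      also have "\<dots> = bop (mat_cat C) [?M, tw_arrow T] + bop (mat_cat C) [tw_arrow T, ?M]"
        by (simp add: FE M)
      also have "\<dots> = 0"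
        using e is_arrow_tw_arrow[OF T] unfolding strict_unit_def by (simp add: signed_def)
      finally show ?thesis using bop_tw[OF c K] True by simp
    next
      case False
      then have "length Fs \<ge> 3" using Fs by (cases Fs rule: remdups_adj.cases) (auto simp: Suc_le_eq)
      then have "bop (mat_cat C) (tword ?T Fs w) = 0" if "w \<in> words (length Fs) K" for w
        using zero[OF composable_chain[OF c], of w] Fs that count_le_length[of w True]
        by (auto simp: words_def)
      then show ?thesis using bop_tw[OF c K] by simp
    qed
  qed
qed

lemma ainf_category_tw: "ainf_category tw"
  unfolding ainf_category_def
proof (intro conjI ballI allI impI)
  show "vector_space (scal tw)" unfolding tw_cat_simps by (rule vector_space_mat)
next
  fix x y d assume "x \<in> Obj tw" "y \<in> Obj tw"
  then have "fst x \<in> Obj (mat_cat C)" "fst y \<in> Obj (mat_cat C)"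
    by (auto intro: fst_Obj)
  then show "module.subspace (scal tw) (Hom tw x y d)"
    unfolding tw_cat_simps by (rule subspace_mat)
next
  fix T assume T: "T \<in> Obj tw"
  then have "fst T \<in> Obj (mat_cat C)" by (rule fst_Obj)
  then obtain e where "strict_unit (mat_cat C) (fst T) e"
    using ainf_category_mat unfolding ainf_category_def by blast
  then show "\<exists>e. strict_unit tw T e" using strict_unit_tw[OF T] by blast
qed (use is_arrow_barrow_tw multilinear_tw ainf_relations_tw in auto)

end


section \<open>The pairing on twisted objects\<close>

definition tw_pairing ::
    "('o, 'v, 'k::field) pairing \<Rightarrow> (('o, 'v) twobj, 'v matrix, 'k) pairing" where
  "tw_pairing P F G = mat_pairing P (mat_arrow F) (mat_arrow G)"

locale cy_twisting = twisting C R + cy_cat C n P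
  for C :: "('o, 'v::ab_group_add, 'k::field_char_0) ainf"
    and R :: "nat \<Rightarrow> nat \<Rightarrow> bool" and n :: int and P :: "('o, 'v, 'k) pairing"
begin

sublocale mat: cy_cat "mat_cat C" n "mat_pairing P"
  by unfold_locales (rule calabi_yau_mat)

lemma tword_cyc_insert:
  "\<lbrakk>ntrue w = length gs; chain R C T (gs @ [g])\<rbrakk> \<Longrightarrow>
    tword T gs w @ [mat_arrow g] = cyc_insert (gs @ [g]) (gaps w)"
proof (induction T gs w rule: tword.induct)
  case (2 T gs w)
  then have "tgt (hd (gs @ [g])) = T" by (cases gs) auto
  then show ?case using 2 by (cases gs; cases "gaps w") (auto simp: cyc_insert_def)
next
  case (4 T F gs w)
  then show ?case by (auto simp: cyc_insert_def)
qed (auto simp: cyc_insert_def)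

text \<open>
  The composition of all morphisms but the last has runs of twisting matrices at both of its ends, so
  every gap of the closed word has a run.
\<close>

lemma U_tw:
  assumes cyc: "cyclic_list tw fs" and K: "bounded K (tgt (hd fs)) fs"
  shows "U tw (tw_pairing P) fs =
    (\<Sum>ps \<in> {ps. length ps = length fs \<and> set ps \<subseteq> {..K}}. U (mat_cat C) (mat_pairing P) (cyc_insert fs ps))"
proof -
  obtain gs g where fs: "fs = gs @ [g]" "gs \<noteq> []" "composable tw gs" "is_arrow tw g"
    "src (last gs) = tgt g" "src g = tgt (hd gs)"
    using cyc by (rule cyclic_listE)
  let ?T = "tgt (hd gs)"
  have hd: "tgt (hd fs) = ?T" using fs by simp
  have ch: "chain R C ?T (gs @ [g])" using composable_chain[of R C fs] cyc hd fs(1) by (simp add: cyclic_list_def)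
  then have chg: "chain R C ?T gs" by (simp add: chain_append)
  have Kg: "bounded K ?T gs" using K hd by (auto simp: bounded_def fs(1))
  have o: "opposed tw (barrow tw gs) g"
    using cyclic_list_opposed[OF ainf_category_tw cyc] fs by simp
  have hom: "bop (mat_cat C) (tword ?T gs w) \<in> Hom (mat_cat C) (fst (final ?T gs)) (fst ?T) (tdeg gs + 2)"
    and barrow: "barrow (mat_cat C) (tword ?T gs w) =
      Arrow (fst (final ?T gs)) (fst ?T) (tdeg gs + 2) (bop (mat_cat C) (tword ?T gs w))"
    if "w \<in> words (length gs) K" for w
    using that not_Nil_of_ntrue[OF _ fs(2), of w] hom_tword[OF chg, of w] barrow_tword[OF chg, of w]
    by (auto simp: words_def)
  have "U tw (tw_pairing P) fs = signed (tdeg gs + 1)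
      (mat_pairing P (mat_arrow (barrow tw gs)) (mat_arrow g))"
    by (simp add: U_def fs(1) sdeg_barrow tw_pairing_def)
  also have "mat_pairing P (mat_arrow (barrow tw gs)) (mat_arrow g) =
      (\<Sum>w \<in> words (length gs) K. mat_pairing P (barrow (mat_cat C) (tword ?T gs w)) (mat_arrow g))"
    using opposed_mat_arrow[OF o] hom
    unfolding mat_arrow_barrow[OF chg fs(2)] bop_tw[OF fs(3) Kg]
    by (subst mat.pairing_sum_left) (auto simp: barrow)
  also have "signed (tdeg gs + 1) \<dots> = (\<Sum>w \<in> words (length gs) K.
      U (mat_cat C) (mat_pairing P) (tword ?T gs w @ [mat_arrow g]))"
    by (auto simp: U_def sdeg_barrow signed_sum tdeg_tword words_def intro!: sum.cong)
  also have "\<dots> = (\<Sum>w \<in> words (length gs) K. U (mat_cat C) (mat_pairing P) (cyc_insert fs (gaps w)))"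
    unfolding fs(1) by (rule sum.cong) (auto simp: words_def tword_cyc_insert[OF _ ch])
  also have "\<dots> = (\<Sum>ps \<in> {ps. length ps = Suc (length gs) \<and> set ps \<subseteq> {..K}}.
      U (mat_cat C) (mat_pairing P) (cyc_insert fs ps))"
    by (rule sum.reindex_bij_betw[OF bij_betw_gaps])
  finally show ?thesis by (simp add: fs(1))
qed

lemma cyclic_list_cyc_insert:
  assumes cyc: "cyclic_list tw fs" and ps: "length ps = length fs"
  shows "cyclic_list (mat_cat C) (cyc_insert fs ps)"
proof -
  obtain gs g where fs: "fs = gs @ [g]" "gs \<noteq> []" "composable tw gs" "is_arrow tw g"
    "src (last gs) = tgt g" "src g = tgt (hd gs)"
    using cyc by (rule cyclic_listE)
  let ?T = "tgt (hd gs)"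
  have ch: "chain R C ?T (gs @ [g])"
    using composable_chain[of R C fs] cyc fs by (simp add: cyclic_list_def)
  define w where "w = ungaps ps"
  have g: "gaps w = ps" using ps fs(1) unfolding w_def by (intro gaps_ungaps) auto
  have nt: "ntrue w = length gs" using length_gaps[of w] ps unfolding g fs(1) by simp
  have eq: "cyc_insert fs ps = tword ?T fs (w @ [True])"
    using tword_cyc_insert[OF nt ch] nt by (simp add: fs(1) g tword_append)
  have nt': "ntrue (w @ [True]) = length fs" using nt fs(1) by simp
  have "length (w @ [True]) \<ge> 2" using nt fs(2) count_le_length[of w True] by (cases gs) auto
  then show ?thesis
    using composable_tword[of R C ?T fs "w @ [True]"] ch nt' length_tword[OF nt', of ?T] fs(6)
    unfolding eq cyclic_list_def by (simp add: fs(1) tword_append nt)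
qed

text \<open>
  The runs are split between \<open>us\<close> and \<open>vs\<close> just as the morphisms are, and both orders use the
  same run lengths.
\<close>

lemma cyclic_tw: "cyclic_pairing tw (tw_pairing P)"
  unfolding cyclic_pairing_iff_U
proof (intro allI impI)
  fix us vs assume c: "cyclic_list tw (us @ vs)"
  let ?U = "U (mat_cat C) (mat_pairing P)"
  have c': "cyclic_list tw (vs @ us)" using c by (rule cyclic_list_rotate)
  obtain K1 K2 where "bounded K1 (tgt (hd (us @ vs))) (us @ vs)" "bounded K2 (tgt (hd (vs @ us))) (vs @ us)"
    using bounded_exists by metis
  then obtain K where K: "bounded K (tgt (hd (us @ vs))) (us @ vs)" "bounded K (tgt (hd (vs @ us))) (vs @ us)"
    by (intro that[of "max K1 K2"]) (auto intro: bounded_mono)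
  let ?S = "\<lambda>fs. {ps. length ps = length fs \<and> set ps \<subseteq> {..K}}"
  have exp: "(\<Sum>ps \<in> ?S (xs @ ys). ?U (cyc_insert (xs @ ys) ps)) =
      (\<Sum>ps \<in> ?S xs. \<Sum>qs \<in> ?S ys. ?U (cyc_insert xs ps @ cyc_insert ys qs))" for xs ys
    by (simp add: sum_boxes_append cyc_insert_append)
  have rot: "?U (cyc_insert us ps @ cyc_insert vs qs) =
      signed (tdeg us * tdeg vs) (?U (cyc_insert vs qs @ cyc_insert us ps))"
    if "ps \<in> ?S us" "qs \<in> ?S vs" for ps qs
  proof -
    have "cyclic_list (mat_cat C) (cyc_insert us ps @ cyc_insert vs qs)"
      using cyclic_list_cyc_insert[OF c, of "ps @ qs"] that by (simp add: cyc_insert_append)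
    from mat.U_cyclic[OF this] show ?thesis using that by (simp add: tdeg_cyc_insert)
  qed
  have "U tw (tw_pairing P) (us @ vs) =
      (\<Sum>ps \<in> ?S us. \<Sum>qs \<in> ?S vs. ?U (cyc_insert us ps @ cyc_insert vs qs))"
    unfolding U_tw[OF c K(1)] exp ..
  also have "\<dots> = (\<Sum>ps \<in> ?S us. \<Sum>qs \<in> ?S vs.
      signed (tdeg us * tdeg vs) (?U (cyc_insert vs qs @ cyc_insert us ps)))"
    by (intro sum.cong refl rot)
  also have "\<dots> = (\<Sum>qs \<in> ?S vs. \<Sum>ps \<in> ?S us.
      signed (tdeg us * tdeg vs) (?U (cyc_insert vs qs @ cyc_insert us ps)))"
    by (rule sum.swap)
  also have "\<dots> = signed (tdeg us * tdeg vs) (U tw (tw_pairing P) (vs @ us))"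
    unfolding U_tw[OF c' K(2)] exp signed_sum ..
  finally show "U tw (tw_pairing P) (us @ vs) = signed (tdeg us * tdeg vs) (U tw (tw_pairing P) (vs @ us))" .
qed

lemma nondegenerate_tw: "nondegenerate_pairing tw (tw_pairing P)"
  unfolding nondegenerate_pairing_def
proof (intro conjI allI impI)
  have lift: "\<exists>G. opposed tw F G \<and> mat_arrow G = h"
    if "is_arrow tw F" "opposed (mat_cat C) (mat_arrow F) h" for F h
    using that
    by (intro exI[of _ "Arrow (tgt F) (src F) (deg h) (val h)"])
      (cases h, auto simp: opposed_def is_arrow_def tw_cat_simps(2) mat_arrow_def)
  {
    fix F assume F: "is_arrow tw F \<and> (\<forall>G. opposed tw F G \<longrightarrow> tw_pairing P F G = 0)"
    then have "mat_pairing P (mat_arrow F) h = 0" if "opposed (mat_cat C) (mat_arrow F) h" for h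
      using lift[OF _ that] by (auto simp: tw_pairing_def)
    then have "val (mat_arrow F) = 0"
      using mat.nondegenerate is_arrow_mat_arrow F unfolding nondegenerate_pairing_def by blast
    then show "val F = 0" by simp
  next
    fix F assume F: "is_arrow tw F \<and> (\<forall>G. opposed tw G F \<longrightarrow> tw_pairing P G F = 0)"
    then have "mat_pairing P h (mat_arrow F) = 0" if "opposed (mat_cat C) h (mat_arrow F)" for h
      using lift[of F h] that opposed_sym[of "mat_cat C"] opposed_sym[of tw] by (auto simp: tw_pairing_def)
    then have "val (mat_arrow F) = 0"
      using mat.nondegenerate is_arrow_mat_arrow F unfolding nondegenerate_pairing_def by blast
    then show "val F = 0" by simp
  }
qed

lemma calabi_yau_tw: "calabi_yau_category n tw"
proof -
  have arr: "mat_arrow (Arrow x y d v) = Arrow (fst x) (fst y) d v"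
    for x y :: "('o, 'v) twobj" and d v
    by (simp add: mat_arrow_def)
  have "bilinear_pairing tw (tw_pairing P)"
    unfolding bilinear_pairing_def tw_pairing_def tw_cat_simps arr
    using mat.pairing_linear_left mat.pairing_linear_right
    by (auto dest!: opposed_mat_arrow simp: arr)
  moreover have "pairing_degree n tw (tw_pairing P)"
    using mat.pairing_deg by (auto simp: pairing_degree_def tw_pairing_def dest!: opposed_mat_arrow)
  moreover have "symmetric_pairing tw (tw_pairing P)"
    unfolding symmetric_pairing_def tw_pairing_def
    using mat.pairing_swap[OF opposed_mat_arrow] by simp
  ultimately show ?thesis
    using nondegenerate_tw cyclic_tw ainf_category_tw
    unfolding calabi_yau_category_def calabi_yau_pairing_def by blast
qed

end

lemma calabi_yau_tw_cat:
  fixes D :: "('o, 'v::ab_group_add, 'k::field_char_0) ainf"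
  assumes "calabi_yau_category n D" "transp R" "irreflp R"
  shows "calabi_yau_category n (tw_cat R D)"
proof -
  from assms(1) obtain P where "ainf_category D" "calabi_yau_pairing n D P"
    by (auto simp: calabi_yau_category_def)
  then interpret cy_twisting D R n P
    using assms by unfold_locales
  show ?thesis by (rule calabi_yau_tw)
qed

theorem theorem4p1p9:
  fixes C :: "('o, 'v::ab_group_add, 'k::field_char_0) ainf" and n :: int
  assumes "calabi_yau_category n C"
  shows "calabi_yau_category n (tw_l C) \<and> calabi_yau_category n (tw_r C)"
  unfolding tw_l_def tw_r_def
  using assms
  by (intro conjI calabi_yau_tw_cat calabi_yau_shift calabi_yau_opp) (auto simp: transp_def irreflp_def)

end
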